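(* Let $(A_n)_{n\ge0}$ denote Diffusion Limited Aggregation on $\mathbf{Z}^2$ (defined in the context). There exists a constant $c>0$ such that for any nonempty finite connected subset $a$ of $\mathbf{Z}^2$ there exists a positive integer $L$ with $$P\bigl(H(A_L)\ge H(A_0)+1 \,\bigm|\, A_0=a\bigr)\ge c .$$
   Context: Two points of $\mathbf{Z}^2$ are adjacent if their Euclidean distance is $1$; a subset $b$ of $\mathbf{Z}^2$ is connected if any two points of $b$ can be joined by a nearest-neighbor lattice path all of whose points belong to $b$. The boundary $\partial b$ of $b\subset\mathbf{Z}^2$ is the set of lattice points adjacent to a point of $b$ but not in $b$. Diffusion Limited Aggregation (DLA) on $\mathbf{Z}^2$ is the Markov chain $(A_n)_{n\ge0}$ of finite connected subsets of $\mathbf{Z}^2$ with transition probabilities $P(A_{n+1}=A_n\cup\{x\}\mid A_n)=\mu_{\partial A_n}(x)$ for $x\in\partial A_n$, where for a finite nonempty set $B\subset\mathbf{Z}^2$, $\mu_B$ is harmonic measure on $B$ (from infinity), i.e. $\mu_B(x)=\lim_{|y|\to\infty}P_y(S_{\tau_B}=x)$, with $S$ a symmetric nearest-neighbor simple random walk on $\mathbf{Z}^2$ started at $y$ and $\tau_B$ its hitting time of $B$. A hole of $b\subset\mathbf{Z}^2$ is a finite maximal connected subset (finite connected component) of $\mathbf{Z}^2\setminus b$, and $H(b)$ is the number of holes of $b$. *)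

theory Defs
  imports "HOL-Probability.Probability"
begin

type_synonym pt = "int \<times> int"

text \<open>The norm on \<open>real \<times> real\<close> is the Euclidean one.\<close>
definition eucl_norm :: "pt \<Rightarrow> real" where
  "eucl_norm p = norm (real_of_int (fst p), real_of_int (snd p))"

definition adjacent :: "pt \<Rightarrow> pt \<Rightarrow> bool" where
  "adjacent p q \<longleftrightarrow> eucl_norm (p - q) = 1"

definition lattice_connected :: "pt set \<Rightarrow> bool" where
  "lattice_connected b \<longleftrightarrow>
     (\<forall>p\<in>b. \<forall>q\<in>b. (\<lambda>u v. u \<in> b \<and> v \<in> b \<and> adjacent u v)\<^sup>*\<^sup>* p q)"

definition boundary :: "pt set \<Rightarrow> pt set" where
  "boundary b = {x. x \<notin> b \<and> (\<exists>y\<in>b. adjacent x y)}"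

text \<open>
  The empty set counts as connected here, so \<open>h \<noteq> {}\<close> is needed to exclude it as a hole of
  the full lattice.
\<close>
definition is_hole :: "pt set \<Rightarrow> pt set \<Rightarrow> bool" where
  "is_hole b h \<longleftrightarrow> finite h \<and> h \<noteq> {} \<and> h \<subseteq> - b \<and> lattice_connected h \<and>
     (\<forall>k. h \<subseteq> k \<and> k \<subseteq> - b \<and> lattice_connected k \<longrightarrow> k = h)"

text \<open>
  A finite set has finitely many holes, so \<open>card\<close> does not hide an infinite count for
  the clusters considered below.
\<close>
definition num_holes :: "pt set \<Rightarrow> nat" where
  "num_holes b = card {h. is_hole b h}"

definition srw_step :: "pt pmf" where
  "srw_step = pmf_of_set {(1, 0), (-1, 0), (0, 1), (0, -1)}"

definition srw_steps :: "(nat \<Rightarrow> pt) measure" where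
  "srw_steps = PiM UNIV (\<lambda>_. measure_pmf srw_step)"

definition walk :: "pt \<Rightarrow> (nat \<Rightarrow> pt) \<Rightarrow> nat \<Rightarrow> pt" where
  "walk y \<xi> n = y + (\<Sum>i<n. \<xi> i)"

text \<open>Meaningful only when the walk hits \<open>B\<close>; \<open>hitting_prob\<close> adds that condition.\<close>
definition hitting_time :: "pt set \<Rightarrow> (nat \<Rightarrow> pt) \<Rightarrow> nat" where
  "hitting_time B s = (LEAST n. s n \<in> B)"

definition hitting_prob :: "pt set \<Rightarrow> pt \<Rightarrow> pt \<Rightarrow> real" where
  "hitting_prob B y x =
     \<P>(\<xi> in srw_steps. (\<exists>n. walk y \<xi> n \<in> B) \<and> walk y \<xi> (hitting_time B (walk y \<xi>)) = x)"

text \<open>The filter expresses \<open>\<bar>y\<bar> \<rightarrow> \<infinity>\<close>; \<open>Lim\<close> is unspecified if the limit does not exist.\<close>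
definition harmonic_measure :: "pt set \<Rightarrow> pt \<Rightarrow> real" where
  "harmonic_measure B x = Lim (filtercomap eucl_norm at_top) (\<lambda>y. hitting_prob B y x)"

text \<open>
  \<open>embed_pmf f\<close> is the distribution with mass function \<open>f\<close> provided \<open>f\<close> is nonnegative with
  total mass 1. For \<open>f = harmonic_measure (boundary b)\<close> with \<open>b\<close> finite and nonempty this is the
  classical fact that harmonic measure exists and is a probability; it is not assumed here.
\<close>
definition dla_step :: "pt set \<Rightarrow> pt set pmf" where
  "dla_step b = map_pmf (\<lambda>x. b \<union> {x}) (embed_pmf (harmonic_measure (boundary b)))"

text \<open>
  \<open>dla a\<close> is the law on path space of the Markov chain with transition kernel \<open>dla_step\<close>
  started at \<open>a\<close>, obtained from the Ionescu-Tulcea theorem; \<open>A\<^sub>n\<close> is the \<open>n\<close>-th coordinate of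
  the path. See \<open>dla_cylinder\<close> for its finite-dimensional distributions.
\<close>
definition dla_kernel :: "pt set \<Rightarrow> nat \<Rightarrow> (nat \<Rightarrow> pt set) \<Rightarrow> pt set measure" where
  "dla_kernel a n A = measure_pmf (if n = 0 then return_pmf a else dla_step (A (n - 1)))"

definition dla :: "pt set \<Rightarrow> (nat \<Rightarrow> pt set) measure" where
  "dla a = projective_family.lim UNIV
     (Ionescu_Tulcea.CI (dla_kernel a) (\<lambda>_. count_space UNIV)) (\<lambda>_. count_space UNIV)"

lemma Ionescu_Tulcea_dla: "Ionescu_Tulcea (dla_kernel a) (\<lambda>_. count_space UNIV)"
proof (rule Ionescu_Tulcea.intro)
  fix n :: nat
  show "dla_kernel a n \<in> measurable (PiM {0..<n} (\<lambda>_. count_space UNIV))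
          (subprob_algebra (count_space UNIV))"
  proof (cases n)
    case 0
    then show ?thesis
      by (simp add: dla_kernel_def [abs_def] measure_pmf_in_subprob_algebra)
  next
    case (Suc m)
    have "(\<lambda>A. A m) \<in> measurable (PiM {0..<n} (\<lambda>_. count_space UNIV)) (count_space UNIV)"
      by (rule measurable_component_singleton) (simp add: Suc)
    moreover have "(\<lambda>b. measure_pmf (dla_step b)) \<in>
        measurable (count_space UNIV) (subprob_algebra (count_space UNIV))"
      by (simp add: measure_pmf_in_subprob_algebra)
    ultimately show ?thesis
      unfolding Suc dla_kernel_def [abs_def] by (simp add: measurable_compose)
  qed
qed (simp add: dla_kernel_def prob_space_measure_pmf)

lemma sets_dla: "sets (dla a) = sets (PiM UNIV (\<lambda>_. count_space UNIV))"
proof -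
  interpret Ionescu_Tulcea "dla_kernel a" "\<lambda>_. count_space UNIV"
    by (rule Ionescu_Tulcea_dla)
  show ?thesis
    unfolding dla_def by (rule PF.sets_lim)
qed

lemma space_dla: "space (dla a) = UNIV"
  using sets_eq_imp_space_eq [OF sets_dla] by (simp add: space_PiM)

lemma emeasure_dla_cylinder:
  "emeasure (dla a) {A. \<forall>i<n. A i = b i} =
     (\<Prod>i<n. ennreal (pmf (if i = 0 then return_pmf a else dla_step (b (i - 1))) (b i)))"
proof -
  let ?M = "\<lambda>_ :: nat. count_space (UNIV :: pt set set)"
  let ?cyl = "\<lambda>n. PiE {0..<n} (\<lambda>i. {b i})"
  let ?p = "\<lambda>i. ennreal (pmf (if i = 0 then return_pmf a else dla_step (b (i - 1))) (b i))"
  interpret Ionescu_Tulcea "dla_kernel a" ?M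
    by (rule Ionescu_Tulcea_dla)
  have cyl: "?cyl n \<in> sets (PiM {0..<n} ?M)" for n
    by (intro sets_PiM_I_finite) auto
  have u: "(\<lambda>_. undefined) \<in> space (PiM {0..<0} ?M)"
    by (simp add: space_PiM)
  have C: "emeasure (C 0 n (\<lambda>_. undefined)) (?cyl n) = (\<Prod>i<n. ?p i)" for n
  proof (induction n)
    case 0
    have "{\<lambda>_. undefined} \<in> sets (PiM {} ?M)"
      using cyl [of 0] by simp
    then show ?case by simp
  next
    case (Suc n)
    let ?C = "C 0 n (\<lambda>_. undefined)"
    have sp: "space ?C = space (PiM {0..<n} ?M)"
      using space_C [OF u, of n] by simp
    have st: "sets ?C = sets (PiM {0..<n} ?M)"
      using sets_C [OF u, of n] by simp
    have eP: "emeasure (eP n \<omega>) (?cyl (Suc n)) = ?p n * indicator (?cyl n) \<omega>"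
      if \<omega>: "\<omega> \<in> space (PiM {0..<n} ?M)" for \<omega>
    proof -
      have ext: "\<omega> \<in> extensional {0..<n}"
        using \<omega> by (auto simp: space_PiM PiE_def)
      have "emeasure (eP n \<omega>) (?cyl (Suc n)) =
          emeasure (dla_kernel a n \<omega>) ((\<lambda>x. fun_upd \<omega> n x) -` ?cyl (Suc n))"
        using emeasure_eP [OF \<omega> cyl] by simp
      also have "(\<lambda>x. fun_upd \<omega> n x) -` ?cyl (Suc n) = (if \<omega> \<in> ?cyl n then {b n} else {})"
      proof -
        have "fun_upd \<omega> n x \<in> ?cyl (Suc n) \<longleftrightarrow> x = b n \<and> \<omega> \<in> ?cyl n" for x
        proof -
          have "(\<forall>i\<in>{0..<Suc n}. fun_upd \<omega> n x i = b i) \<longleftrightarrow>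
              x = b n \<and> (\<forall>i\<in>{0..<n}. \<omega> i = b i)"
            by (simp add: atLeastLessThanSuc)
          moreover have "fun_upd \<omega> n x \<in> extensional {0..<Suc n}"
            using ext by (simp add: extensional_def)
          ultimately show ?thesis
            using ext by (simp only: PiE_iff singleton_iff simp_thms)
        qed
        then show ?thesis by (simp add: set_eq_iff)
      qed
      also have "emeasure (dla_kernel a n \<omega>) \<dots> = ?p n * indicator (?cyl n) \<omega>"
        by (auto simp: dla_kernel_def emeasure_pmf_single PiE_iff)
      finally show ?thesis .
    qed
    have "emeasure (C 0 (Suc n) (\<lambda>_. undefined)) (?cyl (Suc n)) =
        (\<integral>\<^sup>+\<omega>. emeasure (eP n \<omega>) (?cyl (Suc n)) \<partial>?C)"
    proof -
      have "eP n \<in> measurable ?C (subprob_algebra (PiM {0..<Suc n} ?M))"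
        using measurable_eP [of n] measurable_cong_sets [OF st refl] by blast
      moreover have "space ?C \<noteq> {}"
        by (simp add: sp space_PiM PiE_eq_empty_iff)
      ultimately show ?thesis
        using emeasure_bind [of ?C "eP n" "PiM {0..<Suc n} ?M" "?cyl (Suc n)"] cyl by simp
    qed
    also have "\<dots> = (\<integral>\<^sup>+\<omega>. ?p n * indicator (?cyl n) \<omega> \<partial>?C)"
      by (intro nn_integral_cong eP) (simp add: sp)
    also have "\<dots> = ?p n * emeasure ?C (?cyl n)"
      by (rule nn_integral_cmult_indicator) (simp add: st cyl)
    finally show ?case
      by (simp add: Suc.IH mult.commute)
  qed
  have "{A. \<forall>i<n. A i = b i} = PF.emb UNIV {0..<n} (?cyl n)"
    by (auto simp: prod_emb_def space_PiM PiE_iff extensional_def restrict_def)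
  then have "emeasure (dla a) {A. \<forall>i<n. A i = b i} = emeasure (CI {0..<n}) (?cyl n)"
    using lim [OF _ cyl] by (simp add: dla_def)
  also have "\<dots> = emeasure (C 0 n (\<lambda>_. undefined)) (PF.emb {0..<n} {0..<n} (?cyl n))"
    by (rule emeasure_CI [OF _ cyl]) simp
  also have "PF.emb {0..<n} {0..<n} (?cyl n) = ?cyl n"
    by (rule prod_emb_id) (auto simp: PiE_iff)
  finally show ?thesis
    by (simp add: C)
qed

lemma prob_space_dla: "prob_space (dla a)"
  by (rule prob_spaceI) (use emeasure_dla_cylinder [of a 0] in \<open>simp add: space_dla\<close>)

lemma dla_cylinder:
  "\<P>(A in dla a. \<forall>i\<le>n. A i = b i) =
     (if b 0 = a then 1 else 0) * (\<Prod>i<n. pmf (dla_step (b i)) (b (Suc i)))"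
proof -
  have "(\<Prod>i<Suc n. ennreal (pmf (if i = 0 then return_pmf a else dla_step (b (i - 1))) (b i))) =
      ennreal ((if b 0 = a then 1 else 0) * (\<Prod>i<n. pmf (dla_step (b i)) (b (Suc i))))"
    by (subst prod.lessThan_Suc_shift) (auto simp: prod_ennreal)
  then have "emeasure (dla a) {A. \<forall>i\<le>n. A i = b i} =
      ennreal ((if b 0 = a then 1 else 0) * (\<Prod>i<n. pmf (dla_step (b i)) (b (Suc i))))"
    using emeasure_dla_cylinder [of a "Suc n" b]
    by (simp add: less_Suc_eq_le del: prod.lessThan_Suc)
  then show ?thesis
    by (simp add: measure_def space_dla prod_nonneg)
qed

lemma filtercomap_eucl_norm_neq_bot: "filtercomap eucl_norm at_top \<noteq> bot"
proof (rule filtercomap_neq_bot)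
  fix P :: "real \<Rightarrow> bool"
  assume "eventually P at_top"
  then obtain N where N: "\<And>r. r \<ge> N \<Longrightarrow> P r"
    by (auto simp: eventually_at_top_linorder)
  obtain n :: nat where "N \<le> real n"
    using real_arch_simple by blast
  then have "P (eucl_norm (int n, 0))"
    using N by (simp add: eucl_norm_def norm_Pair)
  then show "\<exists>x. P (eucl_norm x)" ..
qed

lemma pmf_dla_step:
  assumes "\<And>x. 0 \<le> harmonic_measure (boundary b) x"
    and "(\<integral>\<^sup>+x. ennreal (harmonic_measure (boundary b) x) \<partial>count_space UNIV) = 1"
    and "x \<in> boundary b"
  shows "pmf (dla_step b) (b \<union> {x}) = harmonic_measure (boundary b) x"
proof -
  let ?p = "embed_pmf (harmonic_measure (boundary b))"
  have inb: "y \<in> boundary b" if "harmonic_measure (boundary b) y \<noteq> 0" for y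
  proof (rule ccontr)
    assume y: "y \<notin> boundary b"
    have "hitting_prob (boundary b) z y = 0" for z
    proof -
      have "s (hitting_time (boundary b) s) \<in> boundary b" if "\<exists>n. s n \<in> boundary b" for s
        unfolding hitting_time_def using that by (rule LeastI_ex)
      then have "{\<xi> \<in> space srw_steps. (\<exists>n. walk z \<xi> n \<in> boundary b) \<and>
          walk z \<xi> (hitting_time (boundary b) (walk z \<xi>)) = y} = {}"
        using y by blast
      then show ?thesis
        unfolding hitting_prob_def by (metis measure_empty)
    qed
    moreover have "filtercomap eucl_norm at_top \<noteq> bot"
      by (rule filtercomap_eucl_norm_neq_bot)
    ultimately have "harmonic_measure (boundary b) y = 0"
      unfolding harmonic_measure_def by (simp add: tendsto_Lim)
    with that show False by simp
  qed
  have set_p: "set_pmf ?p \<subseteq> boundary b"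
    using inb by (auto simp: set_embed_pmf assms)
  have "pmf (dla_step b) (b \<union> {x}) = measure ?p ((\<lambda>x. b \<union> {x}) -` {b \<union> {x}})"
    by (simp add: dla_step_def pmf_map)
  also have "\<dots> = measure ?p {x}"
    using set_p assms(3)
    by (intro measure_pmf.finite_measure_eq_AE) (auto simp: AE_measure_pmf_iff boundary_def)
  also have "\<dots> = harmonic_measure (boundary b) x"
    by (simp add: measure_pmf_single pmf_embed_pmf assms)
  finally show ?thesis .
qed

end

theory Submission
  imports Defs
begin

text \<open>
A walker that comes from infinity is, at some moment, for the first time within \<open>l1\<close>-distance 30
of the cluster. It then stands at a point \<open>w\<close> at distance exactly 30 from the cluster, and it
entered the disc of radius 30 around \<open>w\<close> at a point farther than 30 from the cluster. Such a
\<^emph>\<open>clean entry\<close> leaves the walker free: without landing earlier it can be led to \<open>w\<close> and from there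
to the next site of a suitable ring inside the disc, at the price of a constant factor
\<open>kappa\<close>. Hence twelve clean entries into one disc can be turned into twelve landings that
close a ring around a vacant lattice point (\<open>growth_prob_ge_clean_visits\<close>). The earlier holes survive,
because harmonic measure gives no mass to the inside of a hole (\<open>landing_outside_holes\<close>).

It remains to find a disc that receives twelve clean entries before anything else happens in it.
If one clean entry during \<open>N\<close> arrivals has probability at least \<open>\<epsilon>\<close>, then twelve of them during
\<open>12 N\<close> arrivals have probability at least \<open>\<epsilon> ^ 12 / fact 12\<close> by convexity of powers
(\<open>clean_visits_power_bound\<close>), so one has to see that a disc with such an \<open>\<epsilon>\<close> turns up; the cluster
is then called ripe. Every arrival makes a clean entry somewhere, so the probabilities of
immediate clean entry add up to at least 1 over the touching discs (\<open>sum_clean_entry_ge_1\<close>).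
The \<^emph>\<open>exposure\<close> of a disc, the chance of a clean entry in the remaining time plus a multiple of the
number of vacant sites in the disc, is on average used up at that rate: a visit to the disc ends in a
landing inside it with conditional probability at least \<open>kappa\<close> and takes a vacant site away
(\<open>exposure_descent\<close>). While the cluster is not ripe, a disc has small exposure and a landing creates
boundedly many new touching discs. For small \<open>\<epsilon>\<close> this supply lasts, from a cluster of \<open>N\<close> points on,
for at most \<open>N / 2\<close> of the first \<open>N\<close> steps in expectation (\<open>idle_le_exposure\<close>); at the remaining ones
the cluster is ripe or has been so. So with \<open>N = card a\<close> a new hole is present at time \<open>13 N\<close> with a probability
bounded below, independently of \<open>a\<close>.

The existence of harmonic measure and its Markov property rest on the potential kernel: it
yields the Liouville theorem for functions that are superharmonic and bounded below. A
bounded function is therefore determined by its values on a nonempty set \<open>B\<close> and its harmonicity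
off \<open>B\<close> (\<open>harmonic_unique\<close>), and for finite \<open>B\<close> it has a limit at infinity (\<open>limit_at_infinity\<close>). Identities
between hitting probabilities are proved by this uniqueness instead of by stopping times.
\<close>

section \<open>The lazy walk on the integers\<close>

text \<open>
The value at \<open>j\<close> is \<open>(2 n choose n + j) / 4 ^ n\<close>. In the coordinates \<open>(x + y) / 2\<close>
and \<open>(x - y) / 2\<close> on the even sublattice, two steps of the planar walk are one step of two
independent copies of this walk.
\<close>

fun lazy_pmf :: "nat \<Rightarrow> int \<Rightarrow> real" where
  "lazy_pmf 0 j = (if j = 0 then 1 else 0)"
| "lazy_pmf (Suc n) j = (lazy_pmf n (j - 1) + 2 * lazy_pmf n j + lazy_pmf n (j + 1)) / 4"

lemma lazy_pmf_nonneg: "0 \<le> lazy_pmf n j"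
  by (induction n arbitrary: j) auto

lemma lazy_pmf_minus: "lazy_pmf n (- j) = lazy_pmf n j"
proof (induction n arbitrary: j)
  case (Suc n)
  have "lazy_pmf n (- j - 1) = lazy_pmf n (j + 1)" "lazy_pmf n (- j + 1) = lazy_pmf n (j - 1)"
    using Suc.IH [of "j + 1"] Suc.IH [of "j - 1"] by simp_all
  then show ?case using Suc.IH by simp
qed simp

lemma lazy_pmf_zero: "int n < \<bar>j\<bar> \<Longrightarrow> lazy_pmf n j = 0"
  by (induction n arbitrary: j) auto

text \<open>
This is the quotient of neighbouring binomial coefficients; it gives monotonicity in \<open>\<bar>j\<bar>\<close> and the
size of the increments.
\<close>

lemma lazy_pmf_ratio: "(real n + j + 1) * lazy_pmf n (j + 1) = (real n - j) * lazy_pmf n j"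
proof (induction n arbitrary: j)
  case (Suc n)
  have e: "(real n + j) * lazy_pmf n j = (real n - j + 1) * lazy_pmf n (j - 1)"
    using Suc.IH [of "j - 1"] by (simp add: algebra_simps)
  have f: "(real n + j + 1) * lazy_pmf n (j + 1) = (real n - j) * lazy_pmf n j"
    by (rule Suc.IH)
  have g: "(real n + j + 2) * lazy_pmf n (j + 1 + 1) = (real n - j - 1) * lazy_pmf n (j + 1)"
    using Suc.IH [of "j + 1"] by (simp add: algebra_simps)
  have "(real n + j + 2) * (lazy_pmf n j + 2 * lazy_pmf n (j + 1) + lazy_pmf n (j + 1 + 1)) =
        (real n + 1 - j) * (lazy_pmf n (j - 1) + 2 * lazy_pmf n j + lazy_pmf n (j + 1))"
    using e f g by algebra
  then show ?case
    by (simp add: add.commute add.left_commute)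
qed auto

lemma lazy_pmf_decreasing:
  assumes "0 \<le> j" shows "lazy_pmf n (j + 1) \<le> lazy_pmf n j"
proof -
  have "(real n + j + 1) * lazy_pmf n (j + 1) \<le> (real n + j + 1) * lazy_pmf n j"
    unfolding lazy_pmf_ratio using assms lazy_pmf_nonneg [of n j] by (intro mult_right_mono) auto
  moreover have "real n + j + 1 > 0" using assms by simp
  ultimately show ?thesis by simp
qed

lemma lazy_pmf_antimono:
  assumes "0 \<le> i" "i \<le> j" shows "lazy_pmf n j \<le> lazy_pmf n i"
  using assms(2)
proof (induction j rule: int_ge_induct)
  case (step j)
  then show ?case using lazy_pmf_decreasing [of j n] assms(1) by linarith
qed simp

lemma lazy_pmf_le_centre: "lazy_pmf n j \<le> lazy_pmf n 0"
  using lazy_pmf_antimono [of 0 j n] lazy_pmf_antimono [of 0 "- j" n] lazy_pmf_minus [of n j]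
  by (cases "0 \<le> j") auto

lemma sum_lazy_pmf_le_1: "finite F \<Longrightarrow> (\<Sum>j\<in>F. lazy_pmf n j) \<le> 1"
proof (induction n arbitrary: F)
  case 0
  then show ?case by (simp add: sum.delta)
next
  case (Suc n)
  have "(\<Sum>j\<in>F. lazy_pmf n (j - 1)) = (\<Sum>j\<in>(\<lambda>j. j - 1) ` F. lazy_pmf n j)"
    "(\<Sum>j\<in>F. lazy_pmf n (j + 1)) = (\<Sum>j\<in>(\<lambda>j. j + 1) ` F. lazy_pmf n j)"
    by (subst sum.reindex; auto simp: inj_on_def)+
  then have "(\<Sum>j\<in>F. lazy_pmf n (j - 1)) \<le> 1" "(\<Sum>j\<in>F. lazy_pmf n (j + 1)) \<le> 1" "(\<Sum>j\<in>F. lazy_pmf n j) \<le> 1"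
    using Suc by auto
  then show ?case
    by (simp add: sum_divide_distrib [symmetric] sum.distrib sum_distrib_left [symmetric])
qed

text \<open>
The values at \<open>1, \<dots>, j\<close> are all at least the one at \<open>j\<close>, and their sum is at most 1.
\<close>

lemma mult_lazy_pmf_le_1:
  assumes "0 \<le> j" shows "j * lazy_pmf n j \<le> 1"
proof -
  have "real (card {1..j}) * lazy_pmf n j \<le> (\<Sum>i\<in>{1..j}. lazy_pmf n i)"
    by (rule sum_bounded_below) (use lazy_pmf_antimono in auto)
  also have "\<dots> \<le> 1" by (rule sum_lazy_pmf_le_1) simp
  finally show ?thesis using assms by simp
qed

text \<open>
By the ratio formula the increment, multiplied by \<open>n + j + 1\<close>, equals
\<open>(2 j + 1) * lazy_pmf n j\<close>, which is bounded.
\<close>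

lemma lazy_pmf_diff_nonneg:
  assumes "0 \<le> j" shows "\<bar>lazy_pmf n (j + 1) - lazy_pmf n j\<bar> \<le> 3 / (real n + 1)"
proof -
  have p: "real n + j + 1 > 0" using assms by simp
  have "(real n + j + 1) * (lazy_pmf n j - lazy_pmf n (j + 1)) = 2 * (j * lazy_pmf n j) + lazy_pmf n j"
    using lazy_pmf_ratio [of n j] by (simp add: algebra_simps)
  also have "\<dots> \<le> 3"
    using mult_lazy_pmf_le_1 [OF assms, of n] sum_lazy_pmf_le_1 [of "{j}" n] by simp
  finally have "lazy_pmf n j - lazy_pmf n (j + 1) \<le> 3 / (real n + j + 1)"
    using p by (simp add: field_simps)
  also have "\<dots> \<le> 3 / (real n + 1)" using assms by (intro divide_left_mono) auto
  finally show ?thesis using lazy_pmf_decreasing [OF assms, of n] by simp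
qed

lemma lazy_pmf_diff: "\<bar>lazy_pmf n (j + 1) - lazy_pmf n j\<bar> \<le> 3 / (real n + 1)"
proof (cases "0 \<le> j")
  case False
  have "\<bar>lazy_pmf n (- j - 1 + 1) - lazy_pmf n (- j - 1)\<bar> \<le> 3 / (real n + 1)"
    by (rule lazy_pmf_diff_nonneg) (use False in simp)
  moreover have "lazy_pmf n (- j - 1) = lazy_pmf n (j + 1)"
    using lazy_pmf_minus [of n "j + 1"] by simp
  ultimately show ?thesis using lazy_pmf_minus [of n j] by (simp add: abs_minus_commute)
qed (rule lazy_pmf_diff_nonneg)

lemma lazy_pmf_centre_Suc:
  "(2 * real n + 2) * lazy_pmf (Suc n) 0 = (2 * real n + 1) * lazy_pmf n 0"
proof -
  have "lazy_pmf n (-1) = lazy_pmf n 1" by (rule lazy_pmf_minus)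
  moreover have "(real n + 1) * lazy_pmf n 1 = real n * lazy_pmf n 0"
    using lazy_pmf_ratio [of n 0] by simp
  ultimately show ?thesis by (simp add: field_simps)
qed

text \<open>
The probability of return at time \<open>2 n\<close> of the planar walk is the square of the central value, so it is of
order \<open>1 / n\<close>. The upper bound makes the increments of the potential kernel summable, the lower one
makes the kernel unbounded.
\<close>

lemma lazy_pmf_centre_le: "(lazy_pmf n 0)\<^sup>2 \<le> 1 / (2 * real n + 1)"
proof (induction n)
  case (Suc n)
  have "(2 * real n + 3) * ((2 * real n + 2) * lazy_pmf (Suc n) 0)\<^sup>2 = (2 * real n + 3) * (2 * real n + 1)\<^sup>2 * (lazy_pmf n 0)\<^sup>2"
    unfolding lazy_pmf_centre_Suc by (simp add: power_mult_distrib)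
  also have "\<dots> \<le> (2 * real n + 3) * (2 * real n + 1)\<^sup>2 * (1 / (2 * real n + 1))"
    by (intro mult_left_mono Suc.IH) auto
  also have "\<dots> = (2 * real n + 3) * (2 * real n + 1)" by (simp add: power2_eq_square)
  also have "\<dots> \<le> (2 * real n + 2)\<^sup>2" by (simp add: power2_eq_square algebra_simps)
  finally have "(2 * real n + 2)\<^sup>2 * ((2 * real n + 3) * (lazy_pmf (Suc n) 0)\<^sup>2) \<le> (2 * real n + 2)\<^sup>2 * 1"
    by (simp add: power_mult_distrib mult_ac del: lazy_pmf.simps)
  then have "(2 * real n + 3) * (lazy_pmf (Suc n) 0)\<^sup>2 \<le> 1"
    by (subst (asm) mult_le_cancel_left_pos) (auto simp del: lazy_pmf.simps)
  then show ?case by (simp add: field_simps del: lazy_pmf.simps)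
qed simp

lemma lazy_pmf_centre_ge: "1 / (4 * (real n + 1)) \<le> (lazy_pmf (Suc n) 0)\<^sup>2"
proof (induction n)
  case (Suc n)
  have "(2 * real n + 4)\<^sup>2 * (real n + 1) \<le> (2 * real n + 3)\<^sup>2 * (real n + 2)"
    by (simp add: power2_eq_square algebra_simps)
  then have "(2 * real n + 4)\<^sup>2 \<le> (2 * real n + 3)\<^sup>2 * (real n + 2) / (real n + 1)"
    by (simp add: pos_le_divide_eq)
  also have "\<dots> = 4 * (real n + 2) * ((2 * real n + 3)\<^sup>2 * (1 / (4 * (real n + 1))))" by (simp add: field_simps)
  also have "\<dots> \<le> 4 * (real n + 2) * ((2 * real n + 3)\<^sup>2 * (lazy_pmf (Suc n) 0)\<^sup>2)"
    by (intro mult_left_mono Suc.IH) auto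
  also have "(2 * real n + 3)\<^sup>2 * (lazy_pmf (Suc n) 0)\<^sup>2 = ((2 * real n + 4) * lazy_pmf (Suc (Suc n)) 0)\<^sup>2"
    using lazy_pmf_centre_Suc [of "Suc n"] by (simp only: power_mult_distrib [symmetric]) (simp add: algebra_simps del: lazy_pmf.simps)
  also have "4 * (real n + 2) * \<dots> = (2 * real n + 4)\<^sup>2 * (4 * (real n + 2) * (lazy_pmf (Suc (Suc n)) 0)\<^sup>2)"
    by (simp add: power_mult_distrib del: lazy_pmf.simps)
  finally have "(2 * real n + 4)\<^sup>2 * 1 \<le> (2 * real n + 4)\<^sup>2 * (4 * (real n + 2) * (lazy_pmf (Suc (Suc n)) 0)\<^sup>2)"
    by (simp del: lazy_pmf.simps)
  then have "1 \<le> 4 * (real n + 2) * (lazy_pmf (Suc (Suc n)) 0)\<^sup>2"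
    by (subst (asm) mult_le_cancel_left_pos) (auto simp del: lazy_pmf.simps)
  then show ?case by (simp add: field_simps del: lazy_pmf.simps)
qed (simp add: power2_eq_square)

definition step_bound :: "nat \<Rightarrow> real" where
  "step_bound n = 3 * (real n + 1) powr (- 3 / 2)"

lemma summable_step_bound: "summable step_bound"
proof -
  have "summable (\<lambda>n. of_nat (Suc n) powr (- 3 / 2) :: real)"
    by (subst summable_Suc_iff, subst summable_real_powr_iff) simp
  then have "summable (\<lambda>n. 3 * (of_nat (Suc n) powr (- 3 / 2)) :: real)" by (rule summable_mult)
  then show ?thesis by (simp add: step_bound_def [abs_def] add.commute)
qed

text \<open>
An increment of order \<open>1 / n\<close> is multiplied by a value of order \<open>1 / sqrt n\<close>.
\<close>

lemma lazy_pmf_product_step: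
  "\<bar>lazy_pmf n (u + 1) * lazy_pmf n v - lazy_pmf n u * lazy_pmf n v\<bar> \<le> step_bound n"
proof -
  have "(lazy_pmf n 0)\<^sup>2 \<le> 1 / (real n + 1)"
    by (rule order_trans [OF lazy_pmf_centre_le]) (auto intro!: divide_left_mono)
  also have "\<dots> = ((real n + 1) powr (- 1 / 2))\<^sup>2"
    by (simp add: powr_minus_divide powr_half_sqrt power_divide)
  finally have c: "lazy_pmf n 0 \<le> (real n + 1) powr (- 1 / 2)"
    by (rule power2_le_imp_le) simp
  have "\<bar>lazy_pmf n (u + 1) * lazy_pmf n v - lazy_pmf n u * lazy_pmf n v\<bar> =
      \<bar>lazy_pmf n (u + 1) - lazy_pmf n u\<bar> * lazy_pmf n v"
    using lazy_pmf_nonneg [of n v] by (simp add: abs_mult left_diff_distrib [symmetric])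
  also have "\<dots> \<le> 3 / (real n + 1) * (real n + 1) powr (- 1 / 2)"
    by (intro mult_mono lazy_pmf_diff order_trans [OF lazy_pmf_le_centre c] lazy_pmf_nonneg) simp
  also have "\<dots> = step_bound n"
  proof -
    have "3 / (real n + 1) = 3 * (real n + 1) powr (-1)"
      by (simp add: powr_minus_divide)
    moreover have "(real n + 1) powr (-1) * (real n + 1) powr (- 1 / 2) = (real n + 1) powr (- 3 / 2)"
      by (simp only: powr_add [symmetric]) simp
    ultimately show ?thesis by (simp only: step_bound_def mult.assoc)
  qed
  finally show ?thesis .
qed

lemma lazy_pmf_product_step_right:
  "\<bar>lazy_pmf n u * lazy_pmf n (v + 1) - lazy_pmf n u * lazy_pmf n v\<bar> \<le> step_bound n"
  using lazy_pmf_product_step [of n v u] by (simp add: mult.commute)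

section \<open>The potential kernel of the plane\<close>

text \<open>
This is the potential kernel on the even sublattice, in diagonal coordinates: the sum over all even
times of the probability of being at the origin minus that of being at the given site. The two
series diverge separately.
\<close>

definition diag_kernel :: "int \<Rightarrow> int \<Rightarrow> real" where
  "diag_kernel u v = (\<Sum>n. (lazy_pmf n 0)\<^sup>2 - lazy_pmf n u * lazy_pmf n v)"

lemma summable_product_step:
  "summable (\<lambda>n. lazy_pmf n (u + 1) * lazy_pmf n v - lazy_pmf n u * lazy_pmf n v)"
  "summable (\<lambda>n. lazy_pmf n u * lazy_pmf n (v + 1) - lazy_pmf n u * lazy_pmf n v)"
  by (rule summable_comparison_test [OF _ summable_step_bound],
      use lazy_pmf_product_step lazy_pmf_product_step_right in auto)+

lemma int_step_induct:
  fixes P :: "int \<Rightarrow> bool"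
  assumes "P 0" "\<And>u. P u \<longleftrightarrow> P (u + 1)"
  shows "P u"
proof (induction u rule: int_induct [of _ 0])
  case (step2 i)
  then show ?case using assms(2) [of "i - 1"] by simp
qed (use assms in auto)

text \<open>
The summand vanishes at the origin, and moving to a neighbouring site changes it by a summable amount.
\<close>

lemma summable_diag_kernel: "summable (\<lambda>n. (lazy_pmf n 0)\<^sup>2 - lazy_pmf n u * lazy_pmf n v)"
proof -
  have 1: "summable (\<lambda>n. (lazy_pmf n 0)\<^sup>2 - lazy_pmf n u * lazy_pmf n 0)" for u
  proof (rule int_step_induct [of "\<lambda>u. summable (\<lambda>n. (lazy_pmf n 0)\<^sup>2 - lazy_pmf n u * lazy_pmf n 0)"])
    fix u
    show "summable (\<lambda>n. (lazy_pmf n 0)\<^sup>2 - lazy_pmf n u * lazy_pmf n 0) \<longleftrightarrow>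
        summable (\<lambda>n. (lazy_pmf n 0)\<^sup>2 - lazy_pmf n (u + 1) * lazy_pmf n 0)"
      using summable_diff [OF _ summable_product_step(1) [of u 0]]
        summable_add [OF _ summable_product_step(1) [of u 0]] by fastforce
  qed (simp add: power2_eq_square)
  show ?thesis
  proof (rule int_step_induct [of "\<lambda>v. summable (\<lambda>n. (lazy_pmf n 0)\<^sup>2 - lazy_pmf n u * lazy_pmf n v)"])
    fix v
    show "summable (\<lambda>n. (lazy_pmf n 0)\<^sup>2 - lazy_pmf n u * lazy_pmf n v) \<longleftrightarrow>
        summable (\<lambda>n. (lazy_pmf n 0)\<^sup>2 - lazy_pmf n u * lazy_pmf n (v + 1))"
      using summable_diff [OF _ summable_product_step(2) [of u v]]
        summable_add [OF _ summable_product_step(2) [of u v]] by fastforce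
  qed (rule 1)
qed

lemma diag_kernel_term_nonneg: "0 \<le> (lazy_pmf n 0)\<^sup>2 - lazy_pmf n u * lazy_pmf n v"
  using mult_mono [OF lazy_pmf_le_centre [of n u] lazy_pmf_le_centre [of n v]]
    lazy_pmf_nonneg by (simp add: power2_eq_square)

lemma diag_kernel_0: "diag_kernel 0 0 = 0"
  by (simp add: diag_kernel_def power2_eq_square)

text \<open>
Averaging over two steps of the planar walk shifts the time index of the second product by one, so the sum
telescopes and only the term at time 0 remains.
\<close>

lemma diag_kernel_two_step:
  "(diag_kernel (u-1) (v-1) + 2 * diag_kernel (u-1) v + diag_kernel (u-1) (v+1)
    + 2 * diag_kernel u (v-1) + 4 * diag_kernel u v + 2 * diag_kernel u (v+1)
    + diag_kernel (u+1) (v-1) + 2 * diag_kernel (u+1) v + diag_kernel (u+1) (v+1)) / 16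
   = diag_kernel u v + (if u = 0 \<and> v = 0 then 1 else 0)"
proof -
  let ?t = "\<lambda>u v n. (lazy_pmf n 0)\<^sup>2 - lazy_pmf n u * lazy_pmf n v"
  have S: "?t u v sums diag_kernel u v" for u v
    unfolding diag_kernel_def by (rule summable_sums [OF summable_diag_kernel])
  have "(\<lambda>n. (?t (u-1) (v-1) n + 2 * ?t (u-1) v n + ?t (u-1) (v+1) n
    + 2 * ?t u (v-1) n + 4 * ?t u v n + 2 * ?t u (v+1) n
    + ?t (u+1) (v-1) n + 2 * ?t (u+1) v n + ?t (u+1) (v+1) n) / 16) sums
    ((diag_kernel (u-1) (v-1) + 2 * diag_kernel (u-1) v + diag_kernel (u-1) (v+1)
    + 2 * diag_kernel u (v-1) + 4 * diag_kernel u v + 2 * diag_kernel u (v+1)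
    + diag_kernel (u+1) (v-1) + 2 * diag_kernel (u+1) v + diag_kernel (u+1) (v+1)) / 16)"
    by (intro sums_divide sums_add sums_mult S)
  moreover have "(?t (u-1) (v-1) n + 2 * ?t (u-1) v n + ?t (u-1) (v+1) n
    + 2 * ?t u (v-1) n + 4 * ?t u v n + 2 * ?t u (v+1) n
    + ?t (u+1) (v-1) n + 2 * ?t (u+1) v n + ?t (u+1) (v+1) n) / 16 =
    (lazy_pmf n 0)\<^sup>2 - lazy_pmf (Suc n) u * lazy_pmf (Suc n) v" for n
    by (simp add: field_simps)
  ultimately have 1: "(\<lambda>n. (lazy_pmf n 0)\<^sup>2 - lazy_pmf (Suc n) u * lazy_pmf (Suc n) v) sums
    ((diag_kernel (u-1) (v-1) + 2 * diag_kernel (u-1) v + diag_kernel (u-1) (v+1)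
    + 2 * diag_kernel u (v-1) + 4 * diag_kernel u v + 2 * diag_kernel u (v+1)
    + diag_kernel (u+1) (v-1) + 2 * diag_kernel (u+1) v + diag_kernel (u+1) (v+1)) / 16)"
    (is "_ sums ?R") by (simp only:)
  have "(\<lambda>n. lazy_pmf n u * lazy_pmf n v) \<longlonglongrightarrow> 0"
  proof (rule tendsto_sandwich [OF _ _ tendsto_const])
    show "\<forall>\<^sub>F n in sequentially. 0 \<le> lazy_pmf n u * lazy_pmf n v"
      by (simp add: lazy_pmf_nonneg)
    show "\<forall>\<^sub>F n in sequentially. lazy_pmf n u * lazy_pmf n v \<le> inverse (real (Suc n))"
    proof (intro always_eventually allI)
      fix n
      have "lazy_pmf n u * lazy_pmf n v \<le> (lazy_pmf n 0)\<^sup>2"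
        using diag_kernel_term_nonneg [of n u v] by simp
      also have "\<dots> \<le> 1 / (2 * real n + 1)" by (rule lazy_pmf_centre_le)
      also have "\<dots> \<le> inverse (real (Suc n))" by (simp add: field_simps)
      finally show "lazy_pmf n u * lazy_pmf n v \<le> inverse (real (Suc n))" .
    qed
    show "(\<lambda>n. inverse (real (Suc n))) \<longlonglongrightarrow> 0" by (rule LIMSEQ_inverse_real_of_nat)
  qed
  then have "(\<lambda>n. lazy_pmf n u * lazy_pmf n v - lazy_pmf (Suc n) u * lazy_pmf (Suc n) v) sums
      (lazy_pmf 0 u * lazy_pmf 0 v - 0)"
    by (rule telescope_sums')
  from sums_add [OF S [of u v] this]
  have "(\<lambda>n. (lazy_pmf n 0)\<^sup>2 - lazy_pmf (Suc n) u * lazy_pmf (Suc n) v) sums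
      (diag_kernel u v + (lazy_pmf 0 u * lazy_pmf 0 v - 0))"
    by simp
  with 1 have "?R = diag_kernel u v + (lazy_pmf 0 u * lazy_pmf 0 v - 0)"
    by (rule sums_unique2)
  then show ?thesis by simp
qed

text \<open>
Before time \<open>max \<bar>u\<bar> \<bar>v\<bar>\<close> the walk cannot be at \<open>(u, v)\<close>, so the kernel exceeds a long partial sum
of the divergent series of return probabilities.
\<close>

lemma diag_kernel_unbounded: "\<exists>N. \<forall>u v. N \<le> max \<bar>u\<bar> \<bar>v\<bar> \<longrightarrow> K \<le> diag_kernel u v"
proof -
  have "\<not> summable (\<lambda>n. (lazy_pmf (Suc n) 0)\<^sup>2)"
  proof
    assume "summable (\<lambda>n. (lazy_pmf (Suc n) 0)\<^sup>2)"
    then have "summable (\<lambda>n. 1 / (4 * (real n + 1)))"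
      by (rule summable_comparison_test' [where N = 0])
        (use lazy_pmf_centre_ge in \<open>simp del: lazy_pmf.simps\<close>)
    then have "summable (\<lambda>n. 4 * (1 / (4 * (real n + 1))))" by (rule summable_mult)
    moreover have "4 * (1 / (4 * (real n + 1))) = inverse (of_nat (Suc n))" for n
      by (simp add: field_simps)
    ultimately have "summable (\<lambda>n. inverse (of_nat (Suc n)) :: real)" by simp
    then show False
      using not_summable_harmonic [where 'a = real] by (subst (asm) summable_Suc_iff) simp
  qed
  then have ns: "\<not> summable (\<lambda>n. (lazy_pmf n 0)\<^sup>2)" by (subst (asm) summable_Suc_iff)
  have "\<exists>m. K \<le> (\<Sum>n<m. (lazy_pmf n 0)\<^sup>2)"
  proof (rule ccontr)
    assume "\<nexists>m. K \<le> (\<Sum>n<m. (lazy_pmf n 0)\<^sup>2)"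
    then have "summable (\<lambda>n. (lazy_pmf n 0)\<^sup>2)"
      by (intro bounded_imp_summable [of _ K])
        (auto simp: not_le lessThan_Suc_atMost [symmetric] simp del: sum.lessThan_Suc intro: less_imp_le)
    with ns show False ..
  qed
  then obtain m where m: "K \<le> (\<Sum>n<m. (lazy_pmf n 0)\<^sup>2)" ..
  show ?thesis
  proof (intro exI [of _ "int m"] allI impI)
    fix u v :: int assume uv: "int m \<le> max \<bar>u\<bar> \<bar>v\<bar>"
    have "lazy_pmf n u * lazy_pmf n v = 0" if "n < m" for n
      using uv that lazy_pmf_zero [of n u] lazy_pmf_zero [of n v] by (auto simp: le_max_iff_disj)
    then have "(\<Sum>n<m. (lazy_pmf n 0)\<^sup>2 - lazy_pmf n u * lazy_pmf n v) = (\<Sum>n<m. (lazy_pmf n 0)\<^sup>2)"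
      by (intro sum.cong) (simp_all only: lessThan_iff diff_zero)
    with m have "K \<le> (\<Sum>n<m. (lazy_pmf n 0)\<^sup>2 - lazy_pmf n u * lazy_pmf n v)"
      by simp
    also have "\<dots> \<le> diag_kernel u v"
      unfolding diag_kernel_def
      by (rule sum_le_suminf [OF summable_diag_kernel finite_lessThan diag_kernel_term_nonneg])
    finally show "K \<le> diag_kernel u v" .
  qed
qed

text \<open>
Far from the origin the first terms of the increment vanish, and the others are dominated by the tail of a
convergent series.
\<close>

lemma diag_kernel_step_small:
  assumes "0 < e"
  shows "\<exists>N. \<forall>u v. N \<le> max \<bar>u\<bar> \<bar>v\<bar> \<longrightarrow>
      \<bar>diag_kernel (u + 1) v - diag_kernel u v\<bar> < e \<and> \<bar>diag_kernel u (v + 1) - diag_kernel u v\<bar> < e"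
proof -
  have "(\<lambda>m. \<Sum>n. step_bound (n + m)) \<longlonglongrightarrow> 0"
    by (rule suminf_exist_split2 [OF summable_step_bound])
  then obtain m where m: "\<bar>\<Sum>n. step_bound (n + m)\<bar> < e"
    using assms by (auto dest!: LIMSEQ_D)
  have key: "\<bar>\<Sum>n. f n\<bar> < e"
    if z: "\<And>n. n < m \<Longrightarrow> f n = 0" and b: "\<And>n. \<bar>f n\<bar> \<le> step_bound n" for f :: "nat \<Rightarrow> real"
  proof -
    have sf: "summable f"
      by (rule summable_comparison_test [OF _ summable_step_bound]) (use b in auto)
    have sb: "summable (\<lambda>n. step_bound (n + m))"
      using summable_step_bound by (subst summable_iff_shift)
    have sa: "summable (\<lambda>n. \<bar>f (n + m)\<bar>)"
      by (rule summable_comparison_test [OF _ sb]) (use b in auto)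
    have "(\<Sum>n. f n) = (\<Sum>n. f (n + m))"
      using suminf_split_initial_segment [OF sf, of m] z by simp
    also have "\<bar>\<dots>\<bar> \<le> (\<Sum>n. \<bar>f (n + m)\<bar>)" by (rule summable_rabs [OF sa])
    also have "\<dots> \<le> (\<Sum>n. step_bound (n + m))" by (intro suminf_le sa sb b)
    finally show ?thesis using m by linarith
  qed
  show ?thesis
  proof (intro exI [of _ "int m + 1"] allI impI conjI)
    fix u v :: int assume uv: "int m + 1 \<le> max \<bar>u\<bar> \<bar>v\<bar>"
    have z: "lazy_pmf n u * lazy_pmf n v = 0" "lazy_pmf n (u + 1) * lazy_pmf n v = 0"
      "lazy_pmf n u * lazy_pmf n (v + 1) = 0" if "n < m" for n
    proof -
      have "int n < \<bar>u\<bar> \<and> int n < \<bar>u + 1\<bar> \<or> int n < \<bar>v\<bar> \<and> int n < \<bar>v + 1\<bar>"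
        using uv that by linarith
      then have "lazy_pmf n u = 0 \<and> lazy_pmf n (u + 1) = 0 \<or> lazy_pmf n v = 0 \<and> lazy_pmf n (v + 1) = 0"
        using lazy_pmf_zero by metis
      then show "lazy_pmf n u * lazy_pmf n v = 0" "lazy_pmf n (u + 1) * lazy_pmf n v = 0"
        "lazy_pmf n u * lazy_pmf n (v + 1) = 0" by auto
    qed
    have "diag_kernel (u + 1) v - diag_kernel u v =
        (\<Sum>n. lazy_pmf n u * lazy_pmf n v - lazy_pmf n (u + 1) * lazy_pmf n v)"
      unfolding diag_kernel_def by (subst suminf_diff [OF summable_diag_kernel summable_diag_kernel]) simp
    also have "\<bar>\<dots>\<bar> < e"
      using lazy_pmf_product_step [of _ u v] z by (intro key) (simp_all only: abs_minus_commute diff_self)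
    finally show "\<bar>diag_kernel (u + 1) v - diag_kernel u v\<bar> < e" .
    have "diag_kernel u (v + 1) - diag_kernel u v =
        (\<Sum>n. lazy_pmf n u * lazy_pmf n v - lazy_pmf n u * lazy_pmf n (v + 1))"
      unfolding diag_kernel_def by (subst suminf_diff [OF summable_diag_kernel summable_diag_kernel]) simp
    also have "\<bar>\<dots>\<bar> < e"
      using lazy_pmf_product_step_right [of _ u v] z by (intro key) (simp_all only: abs_minus_commute diff_self)
    finally show "\<bar>diag_kernel u (v + 1) - diag_kernel u v\<bar> < e" .
  qed
qed

definition l1 :: "pt \<Rightarrow> int" where
  "l1 p = \<bar>fst p\<bar> + \<bar>snd p\<bar>"

lemma l1_nonneg: "0 \<le> l1 p" by (simp add: l1_def)

lemma l1_0: "l1 0 = 0" by (simp add: l1_def)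

lemma l1_eq_0: "l1 p = 0 \<longleftrightarrow> p = 0"
proof
  assume "l1 p = 0"
  then have "fst p = 0" "snd p = 0" unfolding l1_def by linarith+
  then show "p = 0" by (simp add: prod_eq_iff)
qed (simp add: l1_0)

lemma l1_commute: "l1 (p - q) = l1 (q - p)" by (simp add: l1_def abs_minus_commute)

lemma l1_triangle: "l1 (p - r) \<le> l1 (p - q) + l1 (q - r)" by (simp add: l1_def)

abbreviation unit_steps :: "pt set" where
  "unit_steps \<equiv> {(1, 0), (-1, 0), (0, 1), (0, -1)}"

definition avg :: "(pt \<Rightarrow> real) \<Rightarrow> pt \<Rightarrow> real" where
  "avg f p = (f (p + (1, 0)) + f (p + (-1, 0)) + f (p + (0, 1)) + f (p + (0, -1))) / 4"

definition even_kernel :: "pt \<Rightarrow> real" where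
  "even_kernel p = diag_kernel ((fst p + snd p) div 2) ((fst p - snd p) div 2)"

text \<open>
From an odd site the walk is on the even sublattice after one step, so harmonicity at odd sites
forces this extension.
\<close>

definition potential_kernel :: "pt \<Rightarrow> real" where
  "potential_kernel p = (if even (fst p + snd p) then even_kernel p else avg even_kernel p)"

lemma even_kernel_eq: "x + y = 2 * u \<Longrightarrow> x - y = 2 * v \<Longrightarrow> even_kernel (x, y) = diag_kernel u v"
  by (simp add: even_kernel_def)

lemma even_pointE:
  fixes p :: pt
  assumes "even (fst p + snd p)"
  obtains u v where "p = (u + v, u - v)"
proof -
  have "even (fst p - snd p)" using assms by simp
  then obtain v where v: "fst p - snd p = 2 * v" by (rule evenE)
  obtain u where "fst p + snd p = 2 * u" using assms by (rule evenE)
  then have "p = (u + v, u - v)" using v by (simp add: prod_eq_iff)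
  then show thesis by (rule that)
qed

lemma avg_potential_kernel: "avg potential_kernel p = potential_kernel p + (if p = 0 then 1 else 0)"
proof (cases "even (fst p + snd p)")
  case False
  then have "avg potential_kernel p = avg even_kernel p"
    by (simp add: avg_def potential_kernel_def)
  moreover have "p \<noteq> 0" using False by auto
  ultimately show ?thesis using False by (simp add: potential_kernel_def)
next
  case True
  then obtain u v where p: "p = (u + v, u - v)" by (rule even_pointE)
  have "avg potential_kernel p = avg (avg even_kernel) p"
    using True by (simp add: avg_def potential_kernel_def)
  also have "\<dots> = (diag_kernel (u-1) (v-1) + 2 * diag_kernel (u-1) v + diag_kernel (u-1) (v+1)
    + 2 * diag_kernel u (v-1) + 4 * diag_kernel u v + 2 * diag_kernel u (v+1)
    + diag_kernel (u+1) (v-1) + 2 * diag_kernel (u+1) v + diag_kernel (u+1) (v+1)) / 16"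
  proof -
    have "even_kernel (u + v + 2, u - v) = diag_kernel (u+1) (v+1)"
      "even_kernel (2 + (u + v), u - v) = diag_kernel (u+1) (v+1)"
      "even_kernel (u + v, 2 + (u - v)) = diag_kernel (u+1) (v-1)"
      "even_kernel (u + v, u - v) = diag_kernel u v"
      "even_kernel (u + v + 1, u - v + 1) = diag_kernel (u+1) v"
      "even_kernel (u + v + 1, u - v - 1) = diag_kernel u (v+1)"
      "even_kernel (u + v - 2, u - v) = diag_kernel (u-1) (v-1)"
      "even_kernel (u + v - 1, u - v + 1) = diag_kernel u (v-1)"
      "even_kernel (u + v - 1, u - v - 1) = diag_kernel (u-1) v"
      "even_kernel (u + v, u - v + 2) = diag_kernel (u+1) (v-1)"
      "even_kernel (u + v, u - v - 2) = diag_kernel (u-1) (v+1)"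
      by (rule even_kernel_eq; simp)+
    then show ?thesis by (simp add: avg_def p add_divide_distrib)
  qed
  also have "\<dots> = diag_kernel u v + (if u = 0 \<and> v = 0 then 1 else 0)"
    by (rule diag_kernel_two_step)
  also have "diag_kernel u v = potential_kernel p"
    using True by (simp add: potential_kernel_def even_kernel_def p)
  also have "(u = 0 \<and> v = 0) = (p = 0)" by (auto simp: p zero_prod_def)
  finally show ?thesis .
qed

lemma potential_kernel_0: "potential_kernel 0 = 0"
  by (simp add: potential_kernel_def even_kernel_def diag_kernel_0)

lemma l1_even: "l1 (u + v, u - v) = 2 * max \<bar>u\<bar> \<bar>v\<bar>"
  unfolding l1_def fst_conv snd_conv by linarith

lemma finite_l1_less: "finite {p. l1 p < N}"
  by (rule finite_subset [of _ "{-N..N} \<times> {-N..N}"]) (auto simp: l1_def)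

lemma eventually_cofinite_l1: "(\<And>p. N \<le> l1 p \<Longrightarrow> P p) \<Longrightarrow> eventually P cofinite"
  unfolding eventually_cofinite by (rule finite_subset [OF _ finite_l1_less [of N]]) force

lemma potential_kernel_at_top: "filterlim potential_kernel at_top cofinite"
  unfolding filterlim_at_top
proof
  fix K
  obtain N where N: "N \<le> max \<bar>u\<bar> \<bar>v\<bar> \<Longrightarrow> K \<le> diag_kernel u v" for u v
    using diag_kernel_unbounded [of K] by auto
  have e: "K \<le> even_kernel p" if ev: "even (fst p + snd p)" and l: "2 * N \<le> l1 p" for p
  proof -
    from ev obtain u v where p: "p = (u + v, u - v)" by (rule even_pointE)
    with l have "N \<le> max \<bar>u\<bar> \<bar>v\<bar>" by (simp add: l1_even)
    then show ?thesis using N by (simp add: even_kernel_def p)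
  qed
  show "eventually (\<lambda>p. K \<le> potential_kernel p) cofinite"
  proof (rule eventually_cofinite_l1)
    fix p assume p: "2 * N + 1 \<le> l1 p"
    show "K \<le> potential_kernel p"
    proof (cases "even (fst p + snd p)")
      case True
      with p e show ?thesis by (simp add: potential_kernel_def)
    next
      case False
      have "K \<le> even_kernel (p + (1,0))" "K \<le> even_kernel (p + (-1,0))"
        "K \<le> even_kernel (p + (0,1))" "K \<le> even_kernel (p + (0,-1))"
        using False p by (auto intro!: e simp: l1_def)
      then show ?thesis using False by (simp add: potential_kernel_def avg_def field_simps)
    qed
  qed
qed

lemma diag_kernel_near:
  assumes "0 < e"
  obtains N where "\<And>u v i j. N \<le> max \<bar>u\<bar> \<bar>v\<bar> \<Longrightarrow> \<bar>i\<bar> \<le> 1 \<Longrightarrow> \<bar>j\<bar> \<le> 1 \<Longrightarrow>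
    \<bar>diag_kernel (u + i) (v + j) - diag_kernel u v\<bar> < e"
proof -
  obtain N where N: "\<forall>u v. N \<le> max \<bar>u\<bar> \<bar>v\<bar> \<longrightarrow>
      \<bar>diag_kernel (u + 1) v - diag_kernel u v\<bar> < e / 2 \<and> \<bar>diag_kernel u (v + 1) - diag_kernel u v\<bar> < e / 2"
    using diag_kernel_step_small [of "e / 2"] assms by (meson half_gt_zero)
  have one: "i = -1 \<or> i = 0 \<or> i = 1" if "\<bar>i\<bar> \<le> 1" for i :: int
    using that by linarith
  have 1: "\<bar>diag_kernel (u + i) v - diag_kernel u v\<bar> < e / 2"
    if uv: "N + 1 \<le> max \<bar>u\<bar> \<bar>v\<bar>" and i: "\<bar>i\<bar> \<le> 1" for u v i
  proof -
    have "N \<le> max \<bar>u\<bar> \<bar>v\<bar>" "N \<le> max \<bar>u - 1\<bar> \<bar>v\<bar>" using uv by linarith+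
    then have "\<bar>diag_kernel (u + 1) v - diag_kernel u v\<bar> < e / 2"
      "\<bar>diag_kernel (u - 1 + 1) v - diag_kernel (u - 1) v\<bar> < e / 2" using N by blast+
    with one [OF i] show ?thesis using assms
      by (elim disjE) (simp_all add: abs_minus_commute [of "diag_kernel (u - 1) v" "diag_kernel u v"])
  qed
  have 2: "\<bar>diag_kernel u (v + j) - diag_kernel u v\<bar> < e / 2"
    if uv: "N + 1 \<le> max \<bar>u\<bar> \<bar>v\<bar>" and j: "\<bar>j\<bar> \<le> 1" for u v j
  proof -
    have "N \<le> max \<bar>u\<bar> \<bar>v\<bar>" "N \<le> max \<bar>u\<bar> \<bar>v - 1\<bar>" using uv by linarith+
    then have "\<bar>diag_kernel u (v + 1) - diag_kernel u v\<bar> < e / 2"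
      "\<bar>diag_kernel u (v - 1 + 1) - diag_kernel u (v - 1)\<bar> < e / 2" using N by blast+
    with one [OF j] show ?thesis using assms
      by (elim disjE) (simp_all add: abs_minus_commute [of "diag_kernel u (v - 1)" "diag_kernel u v"])
  qed
  show thesis
  proof (rule that [of "N + 2"])
    fix u v i j :: int assume uv: "N + 2 \<le> max \<bar>u\<bar> \<bar>v\<bar>" and ij: "\<bar>i\<bar> \<le> 1" "\<bar>j\<bar> \<le> 1"
    have "N + 1 \<le> max \<bar>u\<bar> \<bar>v\<bar>" "N + 1 \<le> max \<bar>u + i\<bar> \<bar>v\<bar>" using uv ij by linarith+
    from 1 [OF this(1) ij(1)] 2 [OF this(2) ij(2)]
    show "\<bar>diag_kernel (u + i) (v + j) - diag_kernel u v\<bar> < e" by linarith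
  qed
qed

lemma filterlim_shift_cofinite: "filterlim (\<lambda>p :: pt. p + z) cofinite cofinite"
  unfolding filterlim_iff eventually_cofinite
proof (intro allI impI)
  fix P :: "pt \<Rightarrow> bool" assume "finite {x. \<not> P x}"
  then have "finite ((\<lambda>p. p + z) -` {x. \<not> P x})"
    by (rule finite_vimageI) (simp add: inj_on_def)
  then show "finite {x. \<not> P (x + z)}" by (simp add: vimage_def)
qed

text \<open>
One of two neighbours is even. The other one carries the average of the kernel over four even sites,
each within one diagonal step in either coordinate of the first.
\<close>

lemma potential_kernel_unit_shift:
  assumes d: "d \<in> unit_steps"
  shows "((\<lambda>p. potential_kernel (p + d) - potential_kernel p) \<longlongrightarrow> 0) cofinite"
  unfolding tendsto_iff dist_real_def
proof (intro allI impI)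
  fix e :: real assume "0 < e"
  then obtain N where N: "\<And>u v i j. N \<le> max \<bar>u\<bar> \<bar>v\<bar> \<Longrightarrow> \<bar>i\<bar> \<le> 1 \<Longrightarrow> \<bar>j\<bar> \<le> 1 \<Longrightarrow>
    \<bar>diag_kernel (u + i) (v + j) - diag_kernel u v\<bar> < e" by (rule diag_kernel_near) (metis)
  have key: "\<bar>potential_kernel (p + c) - potential_kernel p\<bar> < e"
    if ev: "even (fst p + snd p)" and l: "2 * N \<le> l1 p" and c: "c \<in> unit_steps" for p c
  proof -
    from ev obtain u v where p: "p = (u + v, u - v)" by (rule even_pointE)
    with l have uv: "N \<le> max \<bar>u\<bar> \<bar>v\<bar>" by (simp add: l1_even)
    have "even_kernel (u + v + 2, u - v) = diag_kernel (u+1) (v+1)"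
      "even_kernel (u + v, u - v) = diag_kernel (u + 0) (v + 0)"
      "even_kernel (u + v + 1, u - v + 1) = diag_kernel (u+1) (v+0)"
      "even_kernel (u + v + 1, u - v - 1) = diag_kernel (u+0) (v+1)"
      "even_kernel (u + v - 2, u - v) = diag_kernel (u+(-1)) (v+(-1))"
      "even_kernel (u + v - 1, u - v + 1) = diag_kernel (u+0) (v+(-1))"
      "even_kernel (u + v - 1, u - v - 1) = diag_kernel (u+(-1)) (v+0)"
      "even_kernel (u + v, u - v + 2) = diag_kernel (u+1) (v+(-1))"
      "even_kernel (u + v, u - v - 2) = diag_kernel (u+(-1)) (v+1)"
      by (rule even_kernel_eq; simp)+
    note ek = this
    have near: "\<bar>even_kernel q - diag_kernel u v\<bar> < e"
      if "q \<in> {(u+v+2,u-v), (u+v,u-v), (u+v+1,u-v+1), (u+v+1,u-v-1), (u+v-2,u-v), (u+v-1,u-v+1),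
        (u+v-1,u-v-1), (u+v,u-v+2), (u+v,u-v-2)}" for q
      using that by (elim insertE emptyE; hypsubst; unfold ek; intro N uv) auto
    have four: "\<bar>(x1 + x2 + x3 + x4) / 4 - y\<bar> < e"
      if "\<bar>x1 - y\<bar> < e" "\<bar>x2 - y\<bar> < e" "\<bar>x3 - y\<bar> < e" "\<bar>x4 - y\<bar> < e" for x1 x2 x3 x4 y :: real
      using that by (simp add: abs_less_iff field_simps)
    have pk: "potential_kernel p = diag_kernel u v"
      using ev by (simp add: potential_kernel_def even_kernel_def p)
    have od: "potential_kernel (p + c) = avg even_kernel (p + c)"
      using ev c by (auto simp: potential_kernel_def)
    show ?thesis
      unfolding pk od avg_def
      by (rule four; rule near) (use c in \<open>auto simp: p\<close>, simp_all add: zero_prod_def)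
  qed
  show "eventually (\<lambda>p. \<bar>potential_kernel (p + d) - potential_kernel p - 0\<bar> < e) cofinite"
  proof (rule eventually_cofinite_l1)
    fix p assume p: "2 * N + 1 \<le> l1 p"
    show "\<bar>potential_kernel (p + d) - potential_kernel p - 0\<bar> < e"
    proof (cases "even (fst p + snd p)")
      case True
      then show ?thesis using key [of p d] d p by simp
    next
      case False
      have "\<bar>potential_kernel (p + d + - d) - potential_kernel (p + d)\<bar> < e"
        by (rule key) (use False d p in \<open>auto simp: l1_def\<close>)
      then show ?thesis by (simp add: abs_minus_commute)
    qed
  qed
qed

lemma potential_kernel_shift: "((\<lambda>p. potential_kernel (p + z) - potential_kernel p) \<longlongrightarrow> 0) cofinite"
proof -
  let ?T = "\<lambda>z. ((\<lambda>p. potential_kernel (p + z) - potential_kernel p) \<longlongrightarrow> 0) cofinite"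
  have step: "?T (z + d)" if z: "?T z" and d: "d \<in> unit_steps" for z d
  proof -
    have "((\<lambda>p. potential_kernel ((p + z) + d) - potential_kernel (p + z)) \<longlongrightarrow> 0) cofinite"
      by (rule filterlim_compose [OF potential_kernel_unit_shift [OF d] filterlim_shift_cofinite])
    from tendsto_add [OF this z] show ?thesis by (simp add: add.assoc)
  qed
  have 1: "?T (i, 0)" for i
  proof (rule int_step_induct [of "\<lambda>i. ?T (i, 0)"])
    show "?T (u, 0) \<longleftrightarrow> ?T (u + 1, 0)" for u
      using step [of "(u, 0)" "(1, 0)"] step [of "(u + 1, 0)" "(-1, 0)"] by auto
  qed (simp add: zero_prod_def [symmetric])
  have "?T (i, j)" for i j
  proof (rule int_step_induct [of "\<lambda>j. ?T (i, j)"])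
    show "?T (i, u) \<longleftrightarrow> ?T (i, u + 1)" for u
      using step [of "(i, u)" "(0, 1)"] step [of "(i, u + 1)" "(0, -1)"] by auto
  qed (rule 1)
  from this [of "fst z" "snd z"] show ?thesis by simp
qed

section \<open>Superharmonic functions and limits at infinity\<close>

text \<open>
From a point where a negative minimum is attained, the minimum propagates to all neighbours, hence along
a horizontal ray, which leaves the finite set.
\<close>

lemma minimum_principle:
  assumes F: "finite F" and sup: "\<And>p. p \<in> F \<Longrightarrow> avg f p \<le> f p" and out: "\<And>p. p \<notin> F \<Longrightarrow> 0 \<le> f p"
  shows "0 \<le> f p"
proof (rule ccontr)
  assume neg: "\<not> 0 \<le> f p"
  define m where "m = Min (f ` F)"
  have pF: "p \<in> F" using neg out by blast
  have mle: "m \<le> f q" if "q \<in> F" for q using that F by (simp add: m_def)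
  have m0: "m < 0" using mle [OF pF] neg by simp
  have mall: "m \<le> f q" for q using mle [of q] out [of q] m0 by fastforce
  have "m \<in> f ` F" unfolding m_def using F pF by (intro Min_in) auto
  then obtain q where q: "q \<in> F" "f q = m" by auto
  have "f (q + (int n, 0)) = m" for n
  proof (induction n)
    case 0 then show ?case using q by (simp add: zero_prod_def [symmetric])
  next
    case (Suc n)
    let ?r = "q + (int n, 0)"
    have "?r \<in> F" by (rule ccontr) (use Suc m0 out [of ?r] in auto)
    then have "avg f ?r \<le> m" using sup [of ?r] Suc by simp
    then have "f (?r + (1, 0)) + f (?r + (-1, 0)) + f (?r + (0, 1)) + f (?r + (0, -1)) \<le> m * 4"
      unfolding avg_def by (subst (asm) divide_le_eq) simp
    with mall [of "?r + (-1,0)"] mall [of "?r + (0,1)"] mall [of "?r + (0,-1)"]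
    have "f (?r + (1, 0)) \<le> m" by linarith
    with mall [of "?r + (1,0)"] have "f (?r + (1, 0)) = m" by simp
    moreover have "?r + (1, 0) = q + (int (Suc n), 0)" by (simp add: prod_eq_iff)
    ultimately show ?case by simp
  qed
  then have "\<not> 0 \<le> f (q + (int n, 0))" for n using m0 by simp
  then have "q + (int n, 0) \<in> F" for n using out by blast
  then have "range (\<lambda>n. q + (int n, 0)) \<subseteq> F" by auto
  then have "finite (range (\<lambda>n. q + (int n, 0)))" using F finite_subset by blast
  moreover have "inj (\<lambda>n. q + (int n, 0))" by (simp add: inj_on_def)
  ultimately show False using finite_imageD by fastforce
qed

lemma avg_diff: "avg (\<lambda>p. f p - g p) p = avg f p - avg g p"
  and avg_cmult: "avg (\<lambda>p. c * f p) p = c * avg f p"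
  and avg_const: "avg (\<lambda>p. c) p = c"
  by (simp_all add: avg_def field_simps)

lemma avg_shift: "avg (\<lambda>p. f (p - z)) p = avg f (p - z)"
  by (simp add: avg_def algebra_simps)

lemma avg_sum: "avg (\<lambda>p. \<Sum>i\<in>I. f i p) p = (\<Sum>i\<in>I. avg (f i) p)"
  by (simp add: avg_def sum.distrib sum_divide_distrib add_divide_distrib)

lemma avg_mono: "(\<And>q. f q \<le> g q) \<Longrightarrow> avg f p \<le> avg g p"
  unfolding avg_def by (intro divide_right_mono add_mono) auto

text \<open>
This is recurrence of the planar walk. The function \<open>1 - potential_kernel (p - z) / K\<close> is harmonic
off \<open>z\<close>, equals 1 at \<open>z\<close> and is at most 0 outside a finite set; by the minimum principle \<open>w\<close> dominates
its multiple by \<open>w z\<close>. Letting \<open>K\<close> tend to infinity gives the claim.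
\<close>

lemma superharmonic_nonneg_le:
  assumes nn: "\<And>p. 0 \<le> w p" and sup: "\<And>p. avg w p \<le> w p"
  shows "w z \<le> w y"
proof -
  have bound: "w z - w z / K * potential_kernel (y - z) \<le> w y" if K: "0 < K" for K
  proof -
    define f where "f = (\<lambda>p. w p - (w z - w z / K * potential_kernel (p - z)))"
    have "0 \<le> f y"
    proof (rule minimum_principle [where F = "{p. potential_kernel (p - z) < K} - {z}"])
      have "eventually (\<lambda>p. K \<le> potential_kernel (p + - z)) cofinite"
        using filterlim_compose [OF potential_kernel_at_top filterlim_shift_cofinite]
        unfolding filterlim_at_top by blast
      then show "finite ({p. potential_kernel (p - z) < K} - {z})"
        by (simp add: eventually_cofinite not_le)
    next
      fix p assume p: "p \<in> {p. potential_kernel (p - z) < K} - {z}"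
      have "avg f p = avg w p - (w z - w z / K * avg potential_kernel (p - z))"
        unfolding f_def by (simp only: avg_diff avg_const avg_cmult avg_shift)
      then show "avg f p \<le> f p" using sup [of p] p by (simp add: f_def avg_potential_kernel)
    next
      fix p assume p: "p \<notin> {p. potential_kernel (p - z) < K} - {z}"
      show "0 \<le> f p"
      proof (cases "p = z")
        case True then show ?thesis by (simp add: f_def potential_kernel_0)
      next
        case False
        with p K have "1 - potential_kernel (p - z) / K \<le> 0" by simp
        then have "w z * (1 - potential_kernel (p - z) / K) \<le> 0"
          using nn [of z] by (simp add: mult_nonneg_nonpos)
        then have "w z - w z / K * potential_kernel (p - z) \<le> 0" by (simp add: algebra_simps)
        then show ?thesis using nn [of p] by (simp add: f_def)
      qed
    qed
    then show ?thesis by (simp add: f_def)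
  qed
  have "((\<lambda>K. w z - w z / K * potential_kernel (y - z)) \<longlongrightarrow> w z - 0 * potential_kernel (y - z)) at_top"
    by (intro tendsto_intros tendsto_divide_0 [OF tendsto_const] filterlim_at_top_imp_at_infinity filterlim_ident)
  moreover have "eventually (\<lambda>K. w z - w z / K * potential_kernel (y - z) \<le> w y) at_top"
    using eventually_gt_at_top [of 0] by eventually_elim (rule bound)
  ultimately have "w z - 0 * potential_kernel (y - z) \<le> w y" by (rule tendsto_upperbound) simp
  then show ?thesis by simp
qed

lemma superharmonic_constant:
  assumes b: "\<And>p. c \<le> w p" and sup: "\<And>p. avg w p \<le> w p"
  shows "w y = w z"
proof -
  have "w z' - c \<le> w y' - c" for y' z'
    by (rule superharmonic_nonneg_le [of "\<lambda>p. w p - c"])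
      (use b sup in \<open>auto simp: avg_diff avg_const\<close>)
  from this [of y z] this [of z y] show ?thesis by simp
qed

text \<open>
The minimum of \<open>f\<close> and 0 is superharmonic on the whole lattice, hence constant, and it is 0 on \<open>B\<close>.
\<close>

lemma comparison_principle:
  assumes b: "\<And>p. c \<le> f p" and B: "B \<noteq> {}" and sup: "\<And>p. p \<notin> B \<Longrightarrow> avg f p \<le> f p"
    and nn: "\<And>p. p \<in> B \<Longrightarrow> 0 \<le> f p"
  shows "0 \<le> f p"
proof -
  define g where "g = (\<lambda>p. min (f p) 0)"
  obtain z where z: "z \<in> B" using B by auto
  have "g p = g z"
  proof (rule superharmonic_constant)
    show "min c 0 \<le> g q" for q using b [of q] by (auto simp: g_def min_def)
    show "avg g q \<le> g q" for q
    proof (cases "q \<in> B")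
      case True
      have "avg g q \<le> avg (\<lambda>_. 0) q" by (rule avg_mono) (simp add: g_def)
      then show ?thesis using nn [OF True] by (simp add: g_def avg_const)
    next
      case False
      have "avg g q \<le> avg f q" "avg g q \<le> avg (\<lambda>_. 0) q" by (rule avg_mono, simp add: g_def)+
      then show ?thesis using sup [OF False] by (simp add: g_def avg_const)
    qed
  qed
  also have "g z = 0" using nn [OF z] by (simp add: g_def)
  finally show ?thesis by (simp add: g_def min_def split: if_splits)
qed

text \<open>
The main tool for identities between hitting probabilities: two expressions agree as soon as both are
bounded, harmonic off \<open>B\<close>, and equal on \<open>B\<close>.
\<close>

lemma harmonic_unique:
  assumes "\<And>p. \<bar>f p\<bar> \<le> c" "\<And>p. \<bar>g p\<bar> \<le> c" "B \<noteq> {}"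
    and "\<And>p. p \<notin> B \<Longrightarrow> avg f p = f p" "\<And>p. p \<notin> B \<Longrightarrow> avg g p = g p" "\<And>p. p \<in> B \<Longrightarrow> f p = g p"
  shows "f p = g p"
proof -
  have fc: "- c \<le> f p" "f p \<le> c" "- c \<le> g p" "g p \<le> c" for p
    using assms(1,2) [of p] by auto
  have bd: "- 2 * c \<le> f p - g p" "- 2 * c \<le> g p - f p" for p
    using fc [of p] by linarith+
  have "0 \<le> f p - g p"
    by (rule comparison_principle [OF bd(1) assms(3)]) (simp_all add: avg_diff assms)
  moreover have "0 \<le> g p - f p"
    by (rule comparison_principle [OF bd(2) assms(3)]) (simp_all add: avg_diff assms)
  ultimately show ?thesis by simp
qed

text \<open>
Subtracting from \<open>u\<close> translates of the kernel, weighted by the charges of \<open>u\<close> on \<open>B\<close>, gives a function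
\<open>w\<close> harmonic everywhere. If the total charge were not 0, then \<open>w\<close> would tend to plus or minus
infinity, against the Liouville theorem. So the total charge is 0, the sum of the kernels is a combination of
increments that vanish at infinity, and \<open>w\<close> is bounded below and therefore constant.
\<close>

lemma limit_at_infinity:
  assumes B: "finite B" and u: "\<And>p. \<bar>u p\<bar> \<le> c" and h: "\<And>p. p \<notin> B \<Longrightarrow> avg u p = u p"
  shows "\<exists>l. (u \<longlongrightarrow> l) cofinite"
proof -
  \<comment> \<open>the charge of \<open>u\<close>, which vanishes off \<open>B\<close>\<close>
  define \<gamma> where "\<gamma> = (\<lambda>b. avg u b - u b)"
  define s where "s = (\<lambda>p. \<Sum>b\<in>B. \<gamma> b * potential_kernel (p - b))"
  define w where "w = (\<lambda>p. u p - s p)"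
  have avg_s: "avg s p = s p + (if p \<in> B then \<gamma> p else 0)" for p
  proof -
    have "avg s p = (\<Sum>b\<in>B. \<gamma> b * avg potential_kernel (p - b))"
      unfolding s_def avg_sum avg_cmult avg_shift ..
    also have "\<dots> = s p + (\<Sum>b\<in>B. if p = b then \<gamma> b else 0)"
      unfolding s_def sum.distrib [symmetric] by (rule sum.cong) (auto simp: avg_potential_kernel algebra_simps)
    finally show ?thesis using B by (simp add: sum.delta)
  qed
  have harm: "avg w p = w p" for p
    using h [of p] by (auto simp: w_def avg_diff avg_s \<gamma>_def)
  define C where "C = sum \<gamma> B"
  have s_eq: "s p = C * potential_kernel p + (\<Sum>b\<in>B. \<gamma> b * (potential_kernel (p + - b) - potential_kernel p))" for p
    by (simp add: s_def C_def sum_distrib_right right_diff_distrib sum_subtractf)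
  have rest: "((\<lambda>p. \<Sum>b\<in>B. \<gamma> b * (potential_kernel (p + - b) - potential_kernel p)) \<longlongrightarrow> 0) cofinite"
  proof -
    have "((\<lambda>p. \<Sum>b\<in>B. \<gamma> b * (potential_kernel (p + - b) - potential_kernel p)) \<longlongrightarrow> (\<Sum>b\<in>B. \<gamma> b * 0)) cofinite"
      by (intro tendsto_sum tendsto_mult_left potential_kernel_shift)
    then show ?thesis by simp
  qed
  \<comment> \<open>a one-sided bound outside a finite set is a one-sided bound everywhere\<close>
  have ext: "\<exists>m. \<forall>p. m \<le> f p" if ev: "eventually (\<lambda>p. m0 \<le> f p) cofinite" for f :: "pt \<Rightarrow> real" and m0
  proof -
    have fin: "finite {p. \<not> m0 \<le> f p}" using ev by (simp add: eventually_cofinite)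
    let ?m = "Min (insert m0 (f ` {p. \<not> m0 \<le> f p}))"
    have "?m \<le> f p" for p
    proof (cases "m0 \<le> f p")
      case True
      moreover have "?m \<le> m0" using fin by simp
      ultimately show ?thesis by (rule order_trans [rotated])
    qed (use fin in simp)
    then show ?thesis by blast
  qed
  have infinite_pt: "\<not> finite (UNIV :: pt set)" by (simp add: finite_prod infinite_UNIV_int)
  have rest_ev: "eventually (\<lambda>p. \<bar>\<Sum>b\<in>B. \<gamma> b * (potential_kernel (p + - b) - potential_kernel p)\<bar> < 1) cofinite"
    using tendstoD [OF rest, of 1] by simp
  \<comment> \<open>the two signs of the total charge are treated together\<close>
  have big: "False" if C: "\<sigma> * C > 0" and \<sigma>: "\<sigma> = 1 \<or> \<sigma> = - 1" for \<sigma> :: real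
  proof -
    have top: "filterlim (\<lambda>p. (\<sigma> * C) * potential_kernel p) at_top cofinite"
      by (rule filterlim_tendsto_pos_mult_at_top [OF tendsto_const C potential_kernel_at_top])
    have lower: "eventually (\<lambda>p. K \<le> - \<sigma> * w p) cofinite" for K
    proof -
      have "eventually (\<lambda>p. K + 1 + c \<le> (\<sigma> * C) * potential_kernel p) cofinite"
        using top unfolding filterlim_at_top by blast
      with rest_ev show ?thesis
      proof eventually_elim
        case (elim p)
        let ?r = "\<Sum>b\<in>B. \<gamma> b * (potential_kernel (p + - b) - potential_kernel p)"
        have "\<bar>u p\<bar> \<le> c" by (rule u)
        moreover have "- \<sigma> * w p = (\<sigma> * C) * potential_kernel p + \<sigma> * ?r - \<sigma> * u p"
          unfolding w_def s_eq by (simp add: algebra_simps)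
        moreover have "\<bar>\<sigma> * ?r\<bar> < 1" "\<bar>\<sigma> * u p\<bar> = \<bar>u p\<bar>"
          using elim(1) \<sigma> by (auto simp: abs_mult)
        ultimately show ?case using elim(2) by linarith
      qed
    qed
    then obtain m where m: "\<And>p. m \<le> - \<sigma> * w p" using ext [OF lower [of 0]] by blast
    have const: "- \<sigma> * w p = - \<sigma> * w 0" for p
      by (rule superharmonic_constant [of m]) (simp_all only: m avg_cmult harm order_refl)
    have "eventually (\<lambda>p :: pt. - \<sigma> * w 0 + 1 \<le> - \<sigma> * w 0) cofinite"
      using lower [of "- \<sigma> * w 0 + 1"]
    proof eventually_elim
      case (elim p)
      then show ?case using const [of p] by linarith
    qed
    then show False using infinite_pt by (simp add: eventually_cofinite)
  qed
  have C0: "C = 0"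
  proof (cases C "0 :: real" rule: linorder_cases)
    case less
    then show ?thesis using big [of "- 1"] by simp
  next
    case greater
    then show ?thesis using big [of 1] by simp
  qed
  have "eventually (\<lambda>p. - c - 1 \<le> w p) cofinite"
    using rest_ev
  proof eventually_elim
    case (elim p)
    have "w p = u p - (\<Sum>b\<in>B. \<gamma> b * (potential_kernel (p + - b) - potential_kernel p))"
      unfolding w_def s_eq C0 by simp
    then show ?case using u [of p] elim by linarith
  qed
  then obtain m where m: "\<And>p. m \<le> w p" using ext by blast
  have const: "w p = w 0" for p
    by (rule superharmonic_constant [of m]) (simp_all only: m harm order_refl)
  have "u p = w 0 + (\<Sum>b\<in>B. \<gamma> b * (potential_kernel (p + - b) - potential_kernel p))" for p
    using const [of p] s_eq [of p] unfolding w_def C0 by simp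
  then have "u = (\<lambda>p. w 0 + (\<Sum>b\<in>B. \<gamma> b * (potential_kernel (p + - b) - potential_kernel p)))" by blast
  moreover have "((\<lambda>p. w 0 + (\<Sum>b\<in>B. \<gamma> b * (potential_kernel (p + - b) - potential_kernel p))) \<longlongrightarrow> w 0 + 0) cofinite"
    by (intro tendsto_add tendsto_const rest)
  ultimately show ?thesis by (intro exI [of _ "w 0 + 0"]) simp
qed

section \<open>Hitting probabilities and harmonic measure\<close>

interpretation srw: sequence_space "measure_pmf srw_step"
  unfolding sequence_space_def
  by (intro product_prob_spaceI prob_space_measure_pmf)

lemma measurable_walk: "(\<lambda>\<xi>. walk y \<xi> n) \<in> measurable srw_steps (count_space UNIV)"
proof (induction n)
  case (Suc n)
  have "(\<lambda>\<xi>. \<xi> n) \<in> measurable srw_steps (measure_pmf srw_step)"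
    unfolding srw_steps_def by simp
  then have c: "(\<lambda>\<xi>. \<xi> n) \<in> measurable srw_steps (count_space UNIV)"
    by (simp add: measurable_def)
  have "(\<lambda>\<xi>. walk y \<xi> n + \<xi> n) \<in> measurable srw_steps (count_space UNIV)"
    by (rule measurable_compose_countable [OF _ Suc], rule measurable_compose [OF c]) simp
  then show ?case by (simp add: walk_def add.assoc)
qed (simp add: walk_def)

text \<open>
The hitting event of \<open>hitting_prob\<close> without the least hitting time: a countable combination of
conditions on single positions, hence measurable, and compatible with dropping the first step.
\<close>

definition hit_event :: "pt set \<Rightarrow> pt \<Rightarrow> pt \<Rightarrow> (nat \<Rightarrow> pt) set" where
  "hit_event B y x = {\<xi> \<in> space srw_steps. \<exists>n. walk y \<xi> n = x \<and> x \<in> B \<and> (\<forall>m<n. walk y \<xi> m \<notin> B)}"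

lemma space_srw_steps: "space srw_steps = UNIV"
  by (auto simp: srw_steps_def space_PiM)

lemma hitting_prob_eq: "hitting_prob B y x = measure srw_steps (hit_event B y x)"
proof -
  have "((\<exists>n. walk y \<xi> n \<in> B) \<and> walk y \<xi> (hitting_time B (walk y \<xi>)) = x) \<longleftrightarrow>
     (\<exists>n. walk y \<xi> n = x \<and> x \<in> B \<and> (\<forall>m<n. walk y \<xi> m \<notin> B))" (is "?L \<longleftrightarrow> ?R") for \<xi>
  proof
    assume ?L
    then have ex: "\<exists>n. walk y \<xi> n \<in> B" and x: "walk y \<xi> (hitting_time B (walk y \<xi>)) = x" by auto
    have "x \<in> B" using LeastI_ex [OF ex] x by (simp add: hitting_time_def)
    moreover have "\<forall>m<hitting_time B (walk y \<xi>). walk y \<xi> m \<notin> B"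
      using not_less_Least by (auto simp: hitting_time_def)
    ultimately show ?R using x by blast
  next
    assume ?R
    then obtain n where n: "walk y \<xi> n = x" "x \<in> B" "\<forall>m<n. walk y \<xi> m \<notin> B" by blast
    have "hitting_time B (walk y \<xi>) = n"
      unfolding hitting_time_def by (rule Least_equality) (use n in \<open>auto simp: not_less [symmetric]\<close>)
    with n show ?L by auto
  qed
  then show ?thesis by (simp add: hitting_prob_def hit_event_def)
qed

lemma sets_hit_event: "hit_event B y x \<in> sets srw_steps"
proof -
  have W: "{\<xi> \<in> space srw_steps. walk y \<xi> n \<in> X} \<in> sets srw_steps" for n X
    using measurable_sets [OF measurable_walk [of y n], of X]
    by (simp add: vimage_def Int_def conj_commute)
  have "{\<xi> \<in> space srw_steps. \<exists>n. walk y \<xi> n \<in> {x} \<and> x \<in> B \<and> (\<forall>m\<in>{..<n}. walk y \<xi> m \<in> - B)} \<in> sets srw_steps"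
    by (intro sets.sets_Collect_countable_Ex sets.sets_Collect_conj sets.sets_Collect_const
        sets.sets_Collect_countable_Ball W)
  then show ?thesis by (simp add: hit_event_def Ball_def)
qed

lemma prob_space_srw_steps: "prob_space srw_steps"
  unfolding srw_steps_def by (rule srw.prob_space_axioms)

lemma hitting_prob_nonneg: "0 \<le> hitting_prob B y x"
  by (simp add: hitting_prob_eq)

lemma hitting_prob_le_1: "hitting_prob B y x \<le> 1"
  unfolding hitting_prob_eq by (rule prob_space.prob_le_1 [OF prob_space_srw_steps])

lemma hitting_prob_on:
  assumes "y \<in> B" shows "hitting_prob B y x = (if x = y then 1 else 0)"
proof -
  have "walk y \<xi> 0 = y" for \<xi> by (simp add: walk_def)
  then have "(\<exists>n. walk y \<xi> n = x \<and> x \<in> B \<and> (\<forall>m<n. walk y \<xi> m \<notin> B)) \<longleftrightarrow> x = y" for \<xi>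
    using assms by (metis gr0I not_less0)
  then have "hit_event B y x = (if x = y then space srw_steps else {})"
    by (simp add: hit_event_def)
  then show ?thesis
    using prob_space.prob_space [OF prob_space_srw_steps] by (simp add: hitting_prob_eq)
qed

lemma hitting_prob_out: "x \<notin> B \<Longrightarrow> hitting_prob B y x = 0"
  by (simp add: hitting_prob_eq hit_event_def)

lemma walk_case_nat: "walk y (case_nat s \<xi>) (Suc n) = walk (y + s) \<xi> n"
  unfolding walk_def by (subst sum.lessThan_Suc_shift) (simp add: add.assoc)

lemma hit_event_case_nat:
  assumes "y \<notin> B"
  shows "case_nat s \<xi> \<in> hit_event B y x \<longleftrightarrow> \<xi> \<in> hit_event B (y + s) x"
proof -
  have 0: "walk y \<zeta> 0 = y" for \<zeta> by (simp add: walk_def)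
  have all: "(\<forall>m<Suc n. walk y (case_nat s \<xi>) m \<notin> B) \<longleftrightarrow> (\<forall>m<n. walk (y + s) \<xi> m \<notin> B)" for n
    using assms by (auto simp: All_less_Suc2 0 walk_case_nat)
  have "(\<exists>n. walk y (case_nat s \<xi>) n = x \<and> x \<in> B \<and> (\<forall>m<n. walk y (case_nat s \<xi>) m \<notin> B)) \<longleftrightarrow>
     (\<exists>n. walk y (case_nat s \<xi>) (Suc n) = x \<and> x \<in> B \<and> (\<forall>m<Suc n. walk y (case_nat s \<xi>) m \<notin> B))"
    using assms 0 by (metis not0_implies_Suc)
  then show ?thesis unfolding all by (simp add: hit_event_def space_srw_steps walk_case_nat)
qed

text \<open>
The Markov property at time 1: a sequence of independent steps is a first step followed by
an independent sequence with the same law.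
\<close>

lemma hitting_prob_step:
  assumes y: "y \<notin> B"
  shows "hitting_prob B y x = avg (\<lambda>y. hitting_prob B y x) y"
proof -
  let ?M = "measure_pmf srw_step"
  let ?D = "{(1, 0), (-1, 0), (0, 1), (0, -1)} :: pt set"
  have S: "srw_steps = srw.S" by (simp add: srw_steps_def)
  let ?c = "\<lambda>(s, \<omega>). case_nat s \<omega> :: nat \<Rightarrow> pt"
  interpret pp: prob_space srw_steps by (rule prob_space_srw_steps)
  have mc: "?c \<in> measurable (?M \<Otimes>\<^sub>M srw_steps) srw_steps"
    unfolding srw_steps_def by measurable
  have "emeasure srw_steps (hit_event B y x) = emeasure (distr (?M \<Otimes>\<^sub>M srw_steps) srw_steps ?c) (hit_event B y x)"
    using srw.PiM_iter by (simp add: S)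
  also have "\<dots> = emeasure (?M \<Otimes>\<^sub>M srw_steps) (?c -` hit_event B y x \<inter> space (?M \<Otimes>\<^sub>M srw_steps))"
    by (rule emeasure_distr [OF mc sets_hit_event])
  also have "\<dots> = (\<integral>\<^sup>+s. emeasure srw_steps (Pair s -` (?c -` hit_event B y x \<inter> space (?M \<Otimes>\<^sub>M srw_steps))) \<partial>?M)"
    by (rule pp.emeasure_pair_measure_alt) (rule measurable_sets [OF mc sets_hit_event])
  also have "\<dots> = (\<integral>\<^sup>+s. emeasure srw_steps (hit_event B (y + s) x) \<partial>?M)"
  proof -
    have "Pair s -` (?c -` hit_event B y x \<inter> space (?M \<Otimes>\<^sub>M srw_steps)) = hit_event B (y + s) x" for s
    proof (rule set_eqI)
      fix \<xi>
      have "\<xi> \<in> Pair s -` (?c -` hit_event B y x \<inter> space (?M \<Otimes>\<^sub>M srw_steps)) \<longleftrightarrow> case_nat s \<xi> \<in> hit_event B y x"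
        by (simp only: vimage_eq Int_iff prod.case space_pair_measure space_srw_steps space_measure_pmf mem_Sigma_iff UNIV_I simp_thms)
      then show "\<xi> \<in> Pair s -` (?c -` hit_event B y x \<inter> space (?M \<Otimes>\<^sub>M srw_steps)) \<longleftrightarrow> \<xi> \<in> hit_event B (y + s) x"
        by (simp only: hit_event_case_nat [OF y])
    qed
    then show ?thesis by (simp only:)
  qed
  also have "\<dots> = (\<integral>\<^sup>+s. ennreal (hitting_prob B (y + s) x) \<partial>?M)"
    by (simp add: hitting_prob_eq pp.emeasure_eq_measure)
  also have "\<dots> = (\<Sum>s\<in>?D. ennreal (hitting_prob B (y + s) x)) / card ?D"
    unfolding srw_step_def by (rule nn_integral_pmf_of_set) auto
  also have "\<dots> = ennreal ((\<Sum>s\<in>?D. hitting_prob B (y + s) x) / 4)"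
    by (simp add: sum_ennreal hitting_prob_nonneg ennreal_plus [symmetric] divide_ennreal [symmetric] del: ennreal_plus)
  finally have "ennreal (hitting_prob B y x) = ennreal ((\<Sum>s\<in>?D. hitting_prob B (y + s) x) / 4)"
    by (simp add: hitting_prob_eq pp.emeasure_eq_measure)
  then have "hitting_prob B y x = (\<Sum>s\<in>?D. hitting_prob B (y + s) x) / 4"
    by (subst (asm) ennreal_inj) (auto intro!: divide_nonneg_nonneg sum_nonneg hitting_prob_nonneg add_nonneg_nonneg)
  then show ?thesis by (simp add: avg_def add.assoc)
qed

lemma avg_hitting_prob: "y \<notin> B \<Longrightarrow> avg (\<lambda>y. hitting_prob B y x) y = hitting_prob B y x"
  using hitting_prob_step by simp

lemma abs_hitting_prob_le_1: "\<bar>hitting_prob B y x\<bar> \<le> 1"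
  using hitting_prob_nonneg [of B y x] hitting_prob_le_1 [of B y x] by simp

text \<open>
The walk hits \<open>B\<close> with probability 1, because the total hitting probability is harmonic off \<open>B\<close> and
equal to 1 on \<open>B\<close>.
\<close>

lemma sum_hitting_prob:
  assumes B: "finite B" "B \<noteq> {}" shows "(\<Sum>x\<in>B. hitting_prob B y x) = 1"
proof -
  have "\<bar>\<Sum>x\<in>B. hitting_prob B p x\<bar> \<le> max 1 (real (card B))" for p
    by (rule order_trans [OF sum_abs], rule order_trans [OF sum_bounded_above [of _ _ 1]])
      (use abs_hitting_prob_le_1 in auto)
  then show ?thesis
    by (rule harmonic_unique [where g = "\<lambda>_. 1" and B = B])
      (use B in \<open>auto simp: avg_sum avg_hitting_prob avg_const hitting_prob_on sum.delta\<close>)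
qed

text \<open>
The strong Markov property at the hitting time of \<open>C\<close>: both sides are harmonic off \<open>C\<close> and agree
on \<open>C\<close>.
\<close>

lemma hitting_prob_nested:
  assumes C: "finite C" and B: "B \<noteq> {}" "B \<subseteq> C"
  shows "hitting_prob B y x = (\<Sum>e\<in>C. hitting_prob C y e * hitting_prob B e x)"
proof -
  have "\<bar>\<Sum>e\<in>C. hitting_prob C p e * hitting_prob B e x\<bar> \<le> max 1 (real (card C))" for p
    by (rule order_trans [OF sum_abs], rule order_trans [OF sum_bounded_above [of _ _ 1]])
      (auto simp: abs_mult abs_hitting_prob_le_1 intro!: mult_le_one)
  then show ?thesis
  proof (rule harmonic_unique [where B = C, rotated])
    show "\<bar>hitting_prob B p x\<bar> \<le> max 1 (real (card C))" for p
      using abs_hitting_prob_le_1 [of B p x] by simp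
    show "C \<noteq> {}" using B by auto
  next
    fix p assume p: "p \<notin> C"
    then show "avg (\<lambda>p. hitting_prob B p x) p = hitting_prob B p x"
      using B by (intro avg_hitting_prob) auto
    show "avg (\<lambda>p. \<Sum>e\<in>C. hitting_prob C p e * hitting_prob B e x) p = (\<Sum>e\<in>C. hitting_prob C p e * hitting_prob B e x)"
      using p by (simp add: avg_sum mult.commute [of "hitting_prob C _ _"] avg_cmult avg_hitting_prob)
  next
    fix p assume "p \<in> C"
    then show "hitting_prob B p x = (\<Sum>e\<in>C. hitting_prob C p e * hitting_prob B e x)"
      using C by (simp add: hitting_prob_on if_distrib [of "\<lambda>z. z * _"] sum.delta cong: if_cong)
  qed
qed

lemma eucl_norm_ge_l1: "real_of_int (l1 p) \<le> 2 * eucl_norm p"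
proof -
  have "\<bar>real_of_int (fst p)\<bar> \<le> eucl_norm p" "\<bar>real_of_int (snd p)\<bar> \<le> eucl_norm p"
    unfolding eucl_norm_def norm_Pair by (rule real_le_rsqrt, simp)+
  then show ?thesis by (simp add: l1_def)
qed

text \<open>
Bounded subsets of the lattice are finite, so tending to infinity may be expressed by cofinite sets.
\<close>

lemma far_filter_eq: "filtercomap eucl_norm at_top = cofinite"
proof (rule filter_eqI)
  fix P :: "pt \<Rightarrow> bool"
  show "eventually P (filtercomap eucl_norm at_top) \<longleftrightarrow> eventually P cofinite"
  proof
    assume "eventually P (filtercomap eucl_norm at_top)"
    then obtain N where N: "\<And>p. N \<le> eucl_norm p \<Longrightarrow> P p"
      by (auto simp: eventually_filtercomap_at_top_linorder)
    show "eventually P cofinite"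
    proof (rule eventually_cofinite_l1)
      fix p assume "\<lceil>2 * N\<rceil> \<le> l1 p"
      then show "P p" using eucl_norm_ge_l1 [of p] by (intro N) linarith
    qed
  next
    assume "eventually P cofinite"
    then have fin: "finite {p. \<not> P p}" by (simp add: eventually_cofinite)
    define N where "N = Max (insert 0 (eucl_norm ` {p. \<not> P p})) + 1"
    have "P p" if "N \<le> eucl_norm p" for p
    proof (rule ccontr)
      assume "\<not> P p"
      then have "eucl_norm p \<le> Max (insert 0 (eucl_norm ` {p. \<not> P p}))"
        using fin by (intro Max_ge) auto
      then show False using that by (simp add: N_def)
    qed
    then show "eventually P (filtercomap eucl_norm at_top)"
      by (auto simp: eventually_filtercomap_at_top_linorder)
  qed
qed

lemma cofinite_pt_neq_bot: "(cofinite :: pt filter) \<noteq> bot"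
  using filtercomap_eucl_norm_neq_bot by (simp add: far_filter_eq)

lemma tendsto_harmonic_measure:
  assumes "finite B"
  shows "((\<lambda>y. hitting_prob B y x) \<longlongrightarrow> harmonic_measure B x) cofinite"
proof -
  obtain l where l: "((\<lambda>y. hitting_prob B y x) \<longlongrightarrow> l) cofinite"
    using limit_at_infinity [OF assms abs_hitting_prob_le_1 avg_hitting_prob] by blast
  then have "harmonic_measure B x = l"
    unfolding harmonic_measure_def far_filter_eq by (rule tendsto_Lim [OF cofinite_pt_neq_bot])
  with l show ?thesis by simp
qed

lemma harmonic_measure_nonneg:
  assumes "finite B" shows "0 \<le> harmonic_measure B x"
  by (rule tendsto_lowerbound [OF tendsto_harmonic_measure [OF assms] _ cofinite_pt_neq_bot])
    (simp add: hitting_prob_nonneg)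

lemma harmonic_measure_eqI:
  assumes "finite B" "((\<lambda>y. hitting_prob B y x) \<longlongrightarrow> l) cofinite"
  shows "harmonic_measure B x = l"
  by (rule tendsto_unique [OF cofinite_pt_neq_bot tendsto_harmonic_measure [OF assms(1)] assms(2)])

lemma sum_harmonic_measure:
  assumes "finite B" "B \<noteq> {}" shows "(\<Sum>x\<in>B. harmonic_measure B x) = 1"
proof -
  have "((\<lambda>y. \<Sum>x\<in>B. hitting_prob B y x) \<longlongrightarrow> (\<Sum>x\<in>B. harmonic_measure B x)) cofinite"
    by (intro tendsto_sum tendsto_harmonic_measure assms)
  then have "((\<lambda>y :: pt. 1 :: real) \<longlongrightarrow> (\<Sum>x\<in>B. harmonic_measure B x)) cofinite"
    by (simp add: sum_hitting_prob assms)
  then show ?thesis by (rule tendsto_unique [OF cofinite_pt_neq_bot _ tendsto_const])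
qed

lemma harmonic_measure_out:
  assumes "finite B" "x \<notin> B" shows "harmonic_measure B x = 0"
  by (rule harmonic_measure_eqI) (use assms in \<open>auto simp: hitting_prob_out\<close>)

text \<open>
A walker from infinity reaches \<open>C\<close> before or when it reaches the subset \<open>B\<close>. Most
comparisons of harmonic measures below are instances of this identity.
\<close>

lemma harmonic_measure_nested:
  assumes C: "finite C" and B: "B \<noteq> {}" "B \<subseteq> C"
  shows "harmonic_measure B x = (\<Sum>e\<in>C. harmonic_measure C e * hitting_prob B e x)"
proof (rule harmonic_measure_eqI)
  show "finite B" using B C finite_subset by blast
  have eq: "(\<lambda>y. hitting_prob B y x) = (\<lambda>y. \<Sum>e\<in>C. hitting_prob C y e * hitting_prob B e x)"
    by (rule ext, rule hitting_prob_nested [OF C B])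
  show "((\<lambda>y. hitting_prob B y x) \<longlongrightarrow> (\<Sum>e\<in>C. harmonic_measure C e * hitting_prob B e x)) cofinite"
    by (subst eq) (intro tendsto_sum tendsto_mult_right tendsto_harmonic_measure C)
qed

lemma harmonic_measure_mono:
  assumes C: "finite C" and B: "B \<subseteq> C" and x: "x \<in> B"
  shows "harmonic_measure C x \<le> harmonic_measure B x"
proof -
  have "harmonic_measure C x * hitting_prob B x x \<le> (\<Sum>e\<in>C. harmonic_measure C e * hitting_prob B e x)"
    using B x by (intro member_le_sum C mult_nonneg_nonneg harmonic_measure_nonneg hitting_prob_nonneg) auto
  also have "\<dots> = harmonic_measure B x"
    by (rule harmonic_measure_nested [symmetric]) (use assms in auto)
  finally show ?thesis using x by (simp add: hitting_prob_on)
qed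

text \<open>
A walker started off \<open>C\<close> meets a neighbour of \<open>x\<close> before \<open>x\<close>, so the probability of hitting \<open>C\<close> at \<open>x\<close>
vanishes there.
\<close>

lemma harmonic_measure_interior_steps:
  assumes C: "finite C" "x \<in> C"
    and nb: "\<And>d. d \<in> unit_steps \<Longrightarrow> x + d \<in> C"
  shows "harmonic_measure C x = 0"
proof (rule harmonic_measure_eqI [OF C(1)])
  have eq: "hitting_prob C y x = (if y = x then 1 else 0)" for y
  proof (rule harmonic_unique [where c = 1 and B = C and f = "\<lambda>y. hitting_prob C y x"
        and g = "\<lambda>y. if y = x then 1 else 0"])
    show "\<bar>hitting_prob C p x\<bar> \<le> 1" for p by (rule abs_hitting_prob_le_1)
  next
    fix p assume p: "p \<notin> C"
    have "p + d \<noteq> x" if "d \<in> unit_steps" for d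
    proof
      assume "p + d = x"
      then have "p = x + - d" by (metis add_uminus_conv_diff add_diff_cancel_right')
      moreover have "- d \<in> unit_steps" using that by auto
      ultimately show False using nb p by blast
    qed
    then show "avg (\<lambda>y. if y = x then 1 else 0) p = (if p = x then 1 else 0)"
      using p C by (auto simp: avg_def)
  next
    show "C \<noteq> {}" using C by blast
  qed (auto simp: hitting_prob_on avg_hitting_prob)
  have "eventually (\<lambda>y. y \<noteq> x) (cofinite :: pt filter)"
    by (simp add: eventually_cofinite)
  then have "eventually (\<lambda>y. hitting_prob C y x = 0) cofinite"
    by eventually_elim (subst eq, simp)
  then show "((\<lambda>y. hitting_prob C y x) \<longlongrightarrow> 0) cofinite" by (rule tendsto_eventually)
qed

section \<open>Boundaries and holes\<close>

lemma l1_unit: "l1 z = 1 \<longleftrightarrow> z \<in> unit_steps"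
proof -
  obtain i j where z: "z = (i, j)" by (cases z)
  have "\<bar>i\<bar> + \<bar>j\<bar> = 1 \<longleftrightarrow> (i = 1 \<and> j = 0) \<or> (i = -1 \<and> j = 0) \<or> (i = 0 \<and> j = 1) \<or> (i = 0 \<and> j = -1)"
    by linarith
  then show ?thesis by (simp add: z l1_def)
qed

lemma adjacent_iff: "adjacent p q \<longleftrightarrow> l1 (p - q) = 1"
proof -
  obtain i j where z: "p - q = (i, j)" by (cases "p - q")
  have "eucl_norm (p - q) = 1 \<longleftrightarrow> (real_of_int i)\<^sup>2 + (real_of_int j)\<^sup>2 = 1"
    by (simp add: eucl_norm_def z norm_Pair real_sqrt_eq_1_iff)
  also have "(real_of_int i)\<^sup>2 + (real_of_int j)\<^sup>2 = real_of_int (i\<^sup>2 + j\<^sup>2)" by simp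
  also have "\<dots> = 1 \<longleftrightarrow> i\<^sup>2 + j\<^sup>2 = 1" by linarith
  also have "\<dots> \<longleftrightarrow> \<bar>i\<bar> + \<bar>j\<bar> = 1"
  proof
    assume s: "i\<^sup>2 + j\<^sup>2 = 1"
    have "\<bar>k\<bar> \<le> k\<^sup>2" for k :: int
    proof (cases "k = 0")
      case False
      then have "\<bar>k\<bar> * 1 \<le> \<bar>k\<bar> * \<bar>k\<bar>" by (intro mult_left_mono) auto
      then show ?thesis by (simp add: power2_eq_square)
    qed simp
    from this [of i] this [of j] have "\<bar>i\<bar> \<le> i\<^sup>2" "\<bar>j\<bar> \<le> j\<^sup>2" .
    moreover have "i \<noteq> 0 \<or> j \<noteq> 0" using s by auto
    ultimately show "\<bar>i\<bar> + \<bar>j\<bar> = 1" using s by linarith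
  next
    assume "\<bar>i\<bar> + \<bar>j\<bar> = 1"
    then have "(i, j) \<in> unit_steps" using l1_unit [of "(i, j)"] by (simp add: l1_def)
    then show "i\<^sup>2 + j\<^sup>2 = 1" by auto
  qed
  finally show ?thesis unfolding adjacent_def by (simp add: l1_def z)
qed

lemma adjacent_sym: "adjacent p q \<longleftrightarrow> adjacent q p"
  unfolding adjacent_iff by (simp add: l1_def abs_minus_commute)

lemma adjacent_unit: "adjacent p q \<longleftrightarrow> (\<exists>d\<in>unit_steps. q = p + d)"
proof -
  have "adjacent p q \<longleftrightarrow> q - p \<in> unit_steps"
    using adjacent_sym [of p q] adjacent_iff [of q p] l1_unit [of "q - p"] by simp
  also have "\<dots> \<longleftrightarrow> (\<exists>d\<in>unit_steps. q = p + d)"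
    by (metis add_diff_cancel_left' diff_add_cancel add.commute)
  finally show ?thesis .
qed

lemma avg_cong: "(\<And>q. adjacent p q \<Longrightarrow> f q = g q) \<Longrightarrow> avg f p = avg g p"
  unfolding avg_def by (auto simp: adjacent_unit)

lemma boundary_iff: "x \<in> boundary b \<longleftrightarrow> x \<notin> b \<and> (\<exists>y\<in>b. adjacent x y)"
  by (simp add: boundary_def)

lemma finite_boundary: "finite b \<Longrightarrow> finite (boundary b)"
proof -
  assume b: "finite b"
  have "boundary b \<subseteq> (\<Union>y\<in>b. (\<lambda>d. y + d) ` unit_steps)"
  proof
    fix x assume "x \<in> boundary b"
    then obtain y where y: "y \<in> b" "adjacent y x" using adjacent_sym by (auto simp: boundary_iff)
    then obtain d where "d \<in> unit_steps" "x = y + d" unfolding adjacent_unit by blast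
    with y show "x \<in> (\<Union>y\<in>b. (\<lambda>d. y + d) ` unit_steps)" by blast
  qed
  then show "finite (boundary b)" by (rule finite_subset) (use b in simp)
qed

lemma rightmost_point:
  fixes h :: "pt set"
  assumes "finite h" "h \<noteq> {}"
  obtains p where "p \<in> h" "p + (1, 0) \<notin> h"
proof -
  obtain p where p: "p \<in> h" "fst p = Max (fst ` h)"
    using Max_in [of "fst ` h"] assms by fastforce
  have "p + (1, 0) \<notin> h"
  proof
    assume "p + (1, 0) \<in> h"
    then have "fst (p + (1, 0)) \<le> Max (fst ` h)" using assms by (intro Max_ge imageI finite_imageI)
    then show False using p by simp
  qed
  with p show thesis using that by blast
qed

lemma boundary_nonempty:
  assumes "finite b" "b \<noteq> {}" shows "boundary b \<noteq> {}"
proof -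
  obtain p where "p \<in> b" "p + (1, 0) \<notin> b" by (rule rightmost_point [OF assms])
  moreover have "adjacent (p + (1, 0)) p" unfolding adjacent_iff l1_unit by simp
  ultimately have "p + (1, 0) \<in> boundary b" unfolding boundary_iff by blast
  then show ?thesis by blast
qed

lemma lattice_connected_union:
  assumes A: "lattice_connected A" and B: "lattice_connected B" and "r \<in> A" "r \<in> B"
  shows "lattice_connected (A \<union> B)"
  unfolding lattice_connected_def
proof (intro ballI)
  let ?R = "\<lambda>X u v. u \<in> X \<and> v \<in> X \<and> adjacent u v"
  have mono: "(?R X)\<^sup>*\<^sup>* p q \<Longrightarrow> X \<subseteq> A \<union> B \<Longrightarrow> (?R (A \<union> B))\<^sup>*\<^sup>* p q" for X p q
    by (rule rtranclp_mono [THEN predicate2D]) auto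
  have "(?R (A \<union> B))\<^sup>*\<^sup>* p r \<and> (?R (A \<union> B))\<^sup>*\<^sup>* r p" if "p \<in> A \<union> B" for p
    using that
  proof
    assume "p \<in> A"
    then show ?thesis using A assms(3) mono [of A] unfolding lattice_connected_def by blast
  next
    assume "p \<in> B"
    then show ?thesis using B assms(4) mono [of B] unfolding lattice_connected_def by blast
  qed
  then show "(?R (A \<union> B))\<^sup>*\<^sup>* p q" if "p \<in> A \<union> B" "q \<in> A \<union> B" for p q
    using that by (meson rtranclp_trans)
qed

lemma lattice_connected_insert:
  assumes A: "lattice_connected A" "p \<in> A" and pq: "adjacent p q"
  shows "lattice_connected (insert q A)"
proof -
  have "lattice_connected {p, q}"
    using pq adjacent_sym [of p q] unfolding lattice_connected_def by (auto intro: r_into_rtranclp)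
  from lattice_connected_union [OF A(1) this A(2)] A(2) show ?thesis
    by (simp add: insert_absorb insert_commute)
qed

lemma hole_disjoint:
  assumes "is_hole b h" "is_hole b h'" "r \<in> h" "r \<in> h'"
  shows "h = h'"
proof -
  have "lattice_connected (h \<union> h')" "h \<union> h' \<subseteq> - b"
    using assms by (auto simp: is_hole_def intro: lattice_connected_union)
  with assms(1,2) have "h \<union> h' = h" "h \<union> h' = h'" unfolding is_hole_def by auto
  then show ?thesis by simp
qed

lemma hole_neighbour:
  assumes h: "is_hole b h" and "p \<in> h" "adjacent p q" "q \<notin> b"
  shows "q \<in> h"
proof -
  have "lattice_connected (insert q h)"
    using assms by (intro lattice_connected_insert) (auto simp: is_hole_def)
  with assms have "insert q h = h" unfolding is_hole_def by blast
  then show ?thesis by blast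
qed

text \<open>
The rightmost points of a hole lie on the boundary of \<open>b\<close>, and distinct holes are disjoint.
\<close>

lemma finite_holes:
  assumes b: "finite b" shows "finite {h. is_hole b h}"
proof -
  have "\<exists>p. p \<in> h \<and> p \<in> boundary b" if h: "is_hole b h" for h
  proof -
    obtain p where p: "p \<in> h" "p + (1, 0) \<notin> h"
      using rightmost_point [of h] h by (auto simp: is_hole_def)
    have a: "adjacent p (p + (1, 0))" unfolding adjacent_unit by blast
    then have "p + (1, 0) \<in> b" using hole_neighbour [OF h p(1)] p by blast
    then have "p \<in> boundary b" using a h p by (auto simp: boundary_iff is_hole_def)
    with p show ?thesis by blast
  qed
  then obtain f where f: "\<And>h. is_hole b h \<Longrightarrow> f h \<in> h \<and> f h \<in> boundary b" by metis
  have "inj_on f {h. is_hole b h}"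
    by (rule inj_onI) (metis f hole_disjoint mem_Collect_eq)
  moreover have "finite (f ` {h. is_hole b h})"
    by (rule finite_subset [OF _ finite_boundary [OF b]]) (use f in auto)
  ultimately show ?thesis by (rule finite_imageD [rotated])
qed

text \<open>
A walker from outside cannot cross \<open>b\<close> without landing. In terms of functions: replacing the
probability of landing at \<open>x\<close> by 0 off \<open>h \<union> b\<close> keeps it harmonic off the boundary, so by uniqueness it
was 0 there before.
\<close>

lemma landing_outside_holes:
  assumes b: "finite b" and h: "is_hole b h" and x: "x \<in> h"
  shows "harmonic_measure (boundary b) x = 0"
proof (cases "x \<in> boundary b")
  case False
  then show ?thesis by (intro harmonic_measure_out finite_boundary b)
next
  case True
  have eq: "hitting_prob (boundary b) y x = (if y \<in> h \<union> b then hitting_prob (boundary b) y x else 0)" for y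
  proof (rule harmonic_unique [where c = 1 and B = "boundary b"
        and f = "\<lambda>y. hitting_prob (boundary b) y x"
        and g = "\<lambda>y. if y \<in> h \<union> b then hitting_prob (boundary b) y x else 0"])
    show "boundary b \<noteq> {}" using True by blast
    show "avg (\<lambda>y. if y \<in> h \<union> b then hitting_prob (boundary b) y x else 0) p =
        (if p \<in> h \<union> b then hitting_prob (boundary b) p x else 0)" if p: "p \<notin> boundary b" for p
    proof (cases "p \<in> h \<union> b")
      case True
      have on: "(if q \<in> h \<union> b then hitting_prob (boundary b) q x else 0) = hitting_prob (boundary b) q x"
        if pq: "adjacent p q" for q
      proof (cases "q \<in> h \<union> b")
        case out: False
        have "q \<in> boundary b"
          using True
        proof
          assume "p \<in> h"
          then show ?thesis using hole_neighbour [OF h _ pq] out by blast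
        next
          assume "p \<in> b"
          then show ?thesis using pq out adjacent_sym by (auto simp: boundary_iff)
        qed
        then show ?thesis using out x by (auto simp: hitting_prob_on)
      qed simp
      have "avg (\<lambda>y. if y \<in> h \<union> b then hitting_prob (boundary b) y x else 0) p =
          avg (\<lambda>y. hitting_prob (boundary b) y x) p"
        by (rule avg_cong) (rule on)
      then show ?thesis using True by (simp only: avg_hitting_prob [OF p] if_True)
    next
      case out: False
      have "q \<notin> h \<union> b" if pq: "adjacent p q" for q
      proof -
        have "adjacent q p" using pq adjacent_sym by blast
        then show ?thesis using hole_neighbour [OF h, of q p] out p pq unfolding boundary_iff by blast
      qed
      then have "avg (\<lambda>y. if y \<in> h \<union> b then hitting_prob (boundary b) y x else 0) p = avg (\<lambda>_. 0) p"
        by (intro avg_cong) auto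
      then show ?thesis using out by (simp add: avg_const)
    qed
  next
    show "hitting_prob (boundary b) p x = (if p \<in> h \<union> b then hitting_prob (boundary b) p x else 0)"
      if "p \<in> boundary b" for p
      using that x by (auto simp: hitting_prob_on)
  next
    show "\<bar>if p \<in> h \<union> b then hitting_prob (boundary b) p x else 0\<bar> \<le> 1" for p
      by (simp add: abs_hitting_prob_le_1)
  qed (simp_all only: abs_hitting_prob_le_1 avg_hitting_prob not_False_eq_True)
  have "eventually (\<lambda>y. y \<notin> h \<union> b) cofinite"
    using b h by (simp add: eventually_cofinite is_hole_def)
  then have "eventually (\<lambda>y. hitting_prob (boundary b) y x = 0) cofinite"
    by eventually_elim (subst eq, simp)
  then show ?thesis
    by (intro harmonic_measure_eqI finite_boundary b tendsto_eventually)
qed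

lemma hole_persists: "is_hole b h \<Longrightarrow> x \<notin> h \<Longrightarrow> is_hole (insert x b) h"
  unfolding is_hole_def by blast

lemma singleton_hole:
  assumes v: "v \<notin> b" and nb: "\<And>q. adjacent v q \<Longrightarrow> q \<in> b"
  shows "is_hole b {v}"
  unfolding is_hole_def
proof (intro conjI allI impI)
  fix k assume k: "{v} \<subseteq> k \<and> k \<subseteq> - b \<and> lattice_connected k"
  have "w = v" if "w \<in> k" for w
  proof -
    have "(\<lambda>u v. u \<in> k \<and> v \<in> k \<and> adjacent u v)\<^sup>*\<^sup>* v w"
      using k that unfolding lattice_connected_def by blast
    then show ?thesis
    proof (cases rule: converse_rtranclpE)
      case (step u)
      then show ?thesis using nb k by blast
    qed simp
  qed
  then show "k = {v}" using k by blast
qed (use v in \<open>auto simp: lattice_connected_def\<close>)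

lemma singleton_not_hole: "adjacent v q \<Longrightarrow> q \<notin> b \<Longrightarrow> \<not> is_hole b {v}"
  using hole_neighbour [of b "{v}" v q] by (auto simp: adjacent_iff l1_def)

section \<open>Finite-time events of the growing cluster\<close>

lemma pmf_dla_step_insert:
  assumes b: "finite b" "b \<noteq> {}" and x: "x \<in> boundary b"
  shows "pmf (dla_step b) (insert x b) = harmonic_measure (boundary b) x"
proof -
  note fb = finite_boundary [OF b(1)]
  have "(\<integral>\<^sup>+x. ennreal (harmonic_measure (boundary b) x) \<partial>count_space UNIV) =
      (\<Sum>x\<in>boundary b. ennreal (harmonic_measure (boundary b) x))"
    by (rule nn_integral_count_space' [OF fb]) (auto simp: harmonic_measure_out fb)
  also have "\<dots> = 1"
    by (simp add: sum_ennreal harmonic_measure_nonneg fb sum_harmonic_measure boundary_nonempty b)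
  finally have "pmf (dla_step b) (b \<union> {x}) = harmonic_measure (boundary b) x"
    by (intro pmf_dla_step harmonic_measure_nonneg fb x)
  then show ?thesis by simp
qed

text \<open>
The probability that the cluster started at \<open>b\<close> satisfies \<open>Q\<close> after \<open>n\<close> landings, computed by
conditioning on the first landing. The whole argument is by induction along this finite recursion; path
space enters only in \<open>growth_prob_le_dla\<close>.
\<close>

fun growth_prob :: "(pt set \<Rightarrow> bool) \<Rightarrow> nat \<Rightarrow> pt set \<Rightarrow> real" where
  "growth_prob Q 0 b = of_bool (Q b)"
| "growth_prob Q (Suc n) b =
     (\<Sum>x\<in>boundary b. harmonic_measure (boundary b) x * growth_prob Q n (insert x b))"

fun histories :: "nat \<Rightarrow> pt set \<Rightarrow> pt list set" where
  "histories 0 b = {[]}"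
| "histories (Suc n) b = (\<Union>x\<in>boundary b. (#) x ` histories n (insert x b))"

fun history_weight :: "pt set \<Rightarrow> pt list \<Rightarrow> real" where
  "history_weight b [] = 1"
| "history_weight b (x # xs) = harmonic_measure (boundary b) x * history_weight (insert x b) xs"

lemma finite_histories: "finite b \<Longrightarrow> finite (histories n b)"
  by (induction n arbitrary: b) (auto simp: finite_boundary)

lemma growth_prob_histories:
  "finite b \<Longrightarrow> growth_prob Q n b = (\<Sum>xs\<in>histories n b. history_weight b xs * of_bool (Q (b \<union> set xs)))"
proof (induction n arbitrary: b)
  case (Suc n)
  have "(\<Sum>xs\<in>histories (Suc n) b. history_weight b xs * of_bool (Q (b \<union> set xs))) =
      (\<Sum>x\<in>boundary b. \<Sum>xs\<in>(#) x ` histories n (insert x b). history_weight b xs * of_bool (Q (b \<union> set xs)))"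
    unfolding histories.simps
    by (rule sum.UNION_disjoint) (auto intro!: finite_boundary finite_histories Suc.prems)
  also have "\<dots> = (\<Sum>x\<in>boundary b. harmonic_measure (boundary b) x * growth_prob Q n (insert x b))"
  proof (rule sum.cong [OF refl])
    fix x
    have "growth_prob Q n (insert x b) =
        (\<Sum>xs\<in>histories n (insert x b). history_weight (insert x b) xs * of_bool (Q (insert x b \<union> set xs)))"
      by (rule Suc.IH) (simp add: Suc.prems)
    then show "(\<Sum>xs\<in>(#) x ` histories n (insert x b). history_weight b xs * of_bool (Q (b \<union> set xs))) =
        harmonic_measure (boundary b) x * growth_prob Q n (insert x b)"
      by (simp only:) (simp add: sum.reindex sum_distrib_left mult.assoc)
  qed
  finally show ?case by (simp only: growth_prob.simps)
qed simp

text \<open>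
The clusters along the way determine the landings, so different histories give disjoint events on path
space.
\<close>

lemma history_determined:
  assumes "xs \<in> histories n b" "ys \<in> histories n b"
    and "\<And>i. i \<le> n \<Longrightarrow> b \<union> set (take i xs) = b \<union> set (take i ys)"
  shows "xs = ys"
  using assms
proof (induction n arbitrary: b xs ys)
  case (Suc n)
  obtain x xs' y ys' where xy: "xs = x # xs'" "ys = y # ys'" "x \<in> boundary b" "y \<in> boundary b"
    "xs' \<in> histories n (insert x b)" "ys' \<in> histories n (insert y b)"
    using Suc.prems(1,2) by auto
  have "insert x b = insert y b" using Suc.prems(3) [of 1] xy by simp
  then have [simp]: "x = y" using xy by (auto simp: boundary_iff)
  have "insert x b \<union> set (take i xs') = insert x b \<union> set (take i ys')" if "i \<le> n" for i
    using Suc.prems(3) [of "Suc i"] that xy by simp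
  then show ?case using Suc.IH [of xs' "insert x b" ys'] xy by simp
qed simp

lemma history_weight_eq:
  assumes "finite b" "b \<noteq> {}" "xs \<in> histories n b"
  shows "(\<Prod>i<n. pmf (dla_step (b \<union> set (take i xs))) (b \<union> set (take (Suc i) xs))) = history_weight b xs"
  using assms
proof (induction n arbitrary: b xs)
  case (Suc n)
  then obtain x ys where xs: "xs = x # ys" "x \<in> boundary b" "ys \<in> histories n (insert x b)" by auto
  have "(\<Prod>i<n. pmf (dla_step (insert x b \<union> set (take i ys))) (insert x b \<union> set (take (Suc i) ys))) =
      history_weight (insert x b) ys"
    using Suc.IH [OF _ _ xs(3)] Suc.prems by blast
  then show ?case
    using Suc.prems xs by (simp add: prod.lessThan_Suc_shift pmf_dla_step_insert del: prod.lessThan_Suc)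
qed simp

lemma sets_dla_coordinate: "{A \<in> space (dla b). A i \<in> X} \<in> sets (dla b)"
proof -
  have "(\<lambda>A. A i) \<in> measurable (dla b) (count_space UNIV)"
    unfolding measurable_cong_sets [OF sets_dla refl] by (rule measurable_component_singleton) simp
  moreover have "(\<lambda>A. A i) -` X \<inter> space (dla b) = {A \<in> space (dla b). A i \<in> X}" by blast
  ultimately show ?thesis using measurable_sets [of "\<lambda>A. A i" "dla b" "count_space UNIV" X] by simp
qed

text \<open>
The sum over landing histories is a sum of probabilities of disjoint cylinder events, and on each of them
\<open>Q\<close> holds at time \<open>n\<close>.
\<close>

lemma growth_prob_le_dla:
  assumes b: "finite b" "b \<noteq> {}"
  shows "growth_prob Q n b \<le> \<P>(A in dla b. Q (A n))"
proof -
  interpret prob_space "dla b" by (rule prob_space_dla)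
  define E where "E = (\<lambda>xs. {A \<in> space (dla b). \<forall>i\<le>n. A i = b \<union> set (take i xs)})"
  have E_sets: "E xs \<in> sets (dla b)" for xs
  proof -
    have "{A \<in> space (dla b). \<forall>i\<in>{..n}. A i \<in> {b \<union> set (take i xs)}} \<in> sets (dla b)"
      by (intro sets.sets_Collect_countable_Ball sets_dla_coordinate)
    moreover have "E xs = {A \<in> space (dla b). \<forall>i\<in>{..n}. A i \<in> {b \<union> set (take i xs)}}"
      unfolding E_def by blast
    ultimately show ?thesis by simp
  qed
  have Q_sets: "{A \<in> space (dla b). Q (A n)} \<in> sets (dla b)"
    using sets_dla_coordinate [of b n "Collect Q"] by simp
  have P_E: "prob (E xs) = history_weight b xs" if "xs \<in> histories n b" for xs
  proof -
    have "prob (E xs) = (if b \<union> set (take 0 xs) = b then 1 else 0) *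
        (\<Prod>i<n. pmf (dla_step (b \<union> set (take i xs))) (b \<union> set (take (Suc i) xs)))"
      unfolding E_def by (rule dla_cylinder)
    then show ?thesis unfolding history_weight_eq [OF b that] by simp
  qed
  let ?H = "{xs \<in> histories n b. Q (b \<union> set xs)}"
  have len: "length xs = n" if "xs \<in> histories n b" for xs
    using that by (induction n arbitrary: b xs) auto
  have "growth_prob Q n b = (\<Sum>xs\<in>?H. history_weight b xs)"
    unfolding growth_prob_histories [OF b(1)] using finite_histories [OF b(1)]
    by (intro sum.mono_neutral_cong_right) simp_all
  also have "\<dots> = (\<Sum>xs\<in>?H. prob (E xs))" by (intro sum.cong) (auto simp: P_E)
  also have "\<dots> = prob (\<Union>xs\<in>?H. E xs)"
  proof (rule finite_measure_finite_Union [symmetric])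
    show "finite ?H" using finite_histories [OF b(1)] by simp
    show "E ` ?H \<subseteq> sets (dla b)" using E_sets by blast
    show "disjoint_family_on E ?H"
      unfolding disjoint_family_on_def
    proof (intro ballI impI)
      fix xs ys assume xy: "xs \<in> ?H" "ys \<in> ?H" "xs \<noteq> ys"
      show "E xs \<inter> E ys = {}"
      proof (rule ccontr)
        assume "E xs \<inter> E ys \<noteq> {}"
        then obtain A where A: "A \<in> E xs" "A \<in> E ys" by blast
        have "b \<union> set (take i xs) = b \<union> set (take i ys)" if "i \<le> n" for i
        proof -
          have "A i = b \<union> set (take i xs)" using A(1) that unfolding E_def by blast
          moreover have "A i = b \<union> set (take i ys)" using A(2) that unfolding E_def by blast
          ultimately show ?thesis by (rule trans [OF sym])
        qed
        then have "xs = ys" using xy by (intro history_determined [of xs n b ys]) blast+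
        then show False using xy by blast
      qed
    qed
  qed
  also have "\<dots> \<le> prob {A \<in> space (dla b). Q (A n)}"
  proof (rule finite_measure_mono [OF _ Q_sets])
    show "(\<Union>xs\<in>?H. E xs) \<subseteq> {A \<in> space (dla b). Q (A n)}"
    proof
      fix A assume "A \<in> (\<Union>xs\<in>?H. E xs)"
      then obtain xs where xs: "xs \<in> histories n b" "Q (b \<union> set xs)" "A \<in> E xs" by blast
      then have "A n = b \<union> set (take n xs)" "A \<in> space (dla b)" unfolding E_def by blast+
      then show "A \<in> {A \<in> space (dla b). Q (A n)}" using xs len [OF xs(1)] by simp
    qed
  qed
  finally show ?thesis .
qed

section \<open>Discs touching the cluster\<close>

lemma adjacent_l1: "adjacent p q \<Longrightarrow> l1 (p - q) = 1" by (simp add: adjacent_iff)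

text \<open>
Discs are taken in the \<open>l1\<close>-metric, for which the lattice is a geodesic space. The radius 30 leaves
room for the ring built later: its sites lie within distance 9 of a point of the cluster and
inside the disc, while a walker after a clean entry can reach the centre without coming closer than
16 to the cluster.
\<close>

definition disc :: "pt \<Rightarrow> pt set" where
  "disc w = {z. l1 (z - w) \<le> 30}"

definition near :: "pt set \<Rightarrow> pt set" where
  "near A = (\<Union>p\<in>A. disc p)"

text \<open>
The distance from \<open>w\<close> to \<open>A\<close> is exactly 30, so the disc meets \<open>A\<close> only along its rim.
\<close>

definition touching :: "pt set \<Rightarrow> pt \<Rightarrow> bool" where
  "touching A w \<longleftrightarrow> disc w \<inter> A \<noteq> {} \<and> (\<forall>p\<in>A. 30 \<le> l1 (p - w))"

text \<open>
The set on which an arriving walker is first observed: it has then landed, or it has entered the disc. The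
points of the cluster carry no mass, since its boundary shields them.
\<close>

definition barrier :: "pt set \<Rightarrow> pt \<Rightarrow> pt set" where
  "barrier A w = disc w \<union> A \<union> boundary A"

text \<open>
The probability that a walker enters the disc before landing, at a point farther than 30 from the cluster.
\<close>

definition clean_entry :: "pt set \<Rightarrow> pt \<Rightarrow> real" where
  "clean_entry A w = (\<Sum>e\<in>disc w - near A. harmonic_measure (barrier A w) e)"

definition visit :: "pt set \<Rightarrow> pt \<Rightarrow> real" where
  "visit A w = (\<Sum>e\<in>disc w. harmonic_measure (barrier A w) e)"

lemma mem_disc: "z \<in> disc w \<longleftrightarrow> l1 (z - w) \<le> 30" by (simp add: disc_def)

lemma disc_commute: "z \<in> disc w \<longleftrightarrow> w \<in> disc z"
  using l1_commute [of z w] by (simp add: mem_disc)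

lemma disc_eq: "disc w = (\<lambda>z. z + w) ` disc 0"
proof (rule set_eqI)
  fix z
  have "z \<in> disc w \<longleftrightarrow> z - w \<in> disc 0" by (simp add: mem_disc)
  also have "\<dots> \<longleftrightarrow> z \<in> (\<lambda>z. z + w) ` disc 0" by (metis (no_types, lifting) add_diff_cancel_right' diff_add_cancel image_iff)
  finally show "z \<in> disc w \<longleftrightarrow> z \<in> (\<lambda>z. z + w) ` disc 0" .
qed

lemma finite_disc: "finite (disc w)"
proof -
  have "finite (disc 0)"
    by (rule finite_subset [OF _ finite_l1_less [of 31]]) (auto simp: disc_def)
  then show ?thesis by (subst disc_eq) simp
qed

lemma card_disc: "card (disc w) = card (disc 0)"
  by (subst disc_eq) (simp add: card_image inj_on_def)

lemma card_disc_pos: "0 < card (disc 0)"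
proof -
  have "0 \<in> disc 0" by (simp add: mem_disc l1_0)
  then show ?thesis using finite_disc card_gt_0_iff by blast
qed

lemma self_disc: "w \<in> disc w" by (simp add: mem_disc l1_0)

lemma adjacent_disc: "adjacent w z \<Longrightarrow> z \<in> disc w"
  using adjacent_l1 [of w z] l1_commute [of w z] by (simp add: mem_disc)

lemma near_iff: "z \<in> near A \<longleftrightarrow> (\<exists>p\<in>A. l1 (z - p) \<le> 30)"
  by (simp add: near_def mem_disc)

lemma finite_near: "finite A \<Longrightarrow> finite (near A)"
  by (simp add: near_def finite_disc)

lemma subset_near: "A \<subseteq> near A"
  using self_disc by (auto simp: near_def)

lemma boundary_subset_near: "boundary A \<subseteq> near A"
proof
  fix x assume "x \<in> boundary A"
  then obtain y where "y \<in> A" "adjacent x y" by (auto simp: boundary_iff)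
  then show "x \<in> near A" unfolding near_iff using adjacent_l1 [of x y] by (intro bexI [of _ y]) simp_all
qed

lemma finite_barrier: "finite A \<Longrightarrow> finite (barrier A w)"
  by (simp add: barrier_def finite_disc finite_boundary)

lemma touching_near: "touching A w \<Longrightarrow> w \<in> near A"
  using disc_commute by (auto simp: touching_def near_def)

lemma finite_touching: "finite A \<Longrightarrow> finite {w. touching A w}"
  by (rule finite_subset [OF _ finite_near]) (auto dest: touching_near)

lemma harmonic_measure_interior:
  assumes "finite C" "x \<in> C" "\<And>y. adjacent x y \<Longrightarrow> y \<in> C"
  shows "harmonic_measure C x = 0"
  by (rule harmonic_measure_interior_steps [OF assms(1,2)], rule assms(3)) (simp only: adjacent_unit, blast)

lemma harmonic_measure_barrier_cluster:
  assumes A: "finite A" and x: "x \<in> A"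
  shows "harmonic_measure (barrier A w) x = 0"
proof (rule harmonic_measure_interior [OF finite_barrier [OF A]])
  show "x \<in> barrier A w" using x by (simp add: barrier_def)
  fix y assume "adjacent x y"
  then have "adjacent y x" using adjacent_sym by blast
  then show "y \<in> barrier A w" using x by (auto simp: barrier_def boundary_iff)
qed

lemma clean_entry_nonneg: "finite A \<Longrightarrow> 0 \<le> clean_entry A w"
  unfolding clean_entry_def by (intro sum_nonneg harmonic_measure_nonneg finite_barrier)

lemma visit_nonneg: "finite A \<Longrightarrow> 0 \<le> visit A w"
  unfolding visit_def by (intro sum_nonneg harmonic_measure_nonneg finite_barrier)

text \<open>
A walker that lands at \<open>x\<close> either meets the barrier there, or it enters the disc first.
\<close>

lemma landing_decomposition:
  assumes A: "finite A" "A \<noteq> {}" and x: "x \<in> boundary A"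
  shows "harmonic_measure (boundary A) x =
    (if x \<in> disc w then 0 else harmonic_measure (barrier A w) x) +
    (\<Sum>e\<in>disc w. harmonic_measure (barrier A w) e * hitting_prob (boundary A) e x)"
proof -
  let ?C = "barrier A w" and ?B = "boundary A"
  let ?f = "\<lambda>e. harmonic_measure ?C e * hitting_prob ?B e x"
  have C: "finite ?C" by (rule finite_barrier [OF A(1)])
  have split: "?C = disc w \<union> (?C - disc w)" by (auto simp: barrier_def)
  have "harmonic_measure ?B x = (\<Sum>e\<in>?C. ?f e)"
    by (rule harmonic_measure_nested [OF C]) (use x in \<open>auto simp: barrier_def\<close>)
  also have "\<dots> = (\<Sum>e\<in>disc w. ?f e) + (\<Sum>e\<in>?C - disc w. ?f e)"
    by (subst split, rule sum.union_disjoint) (use C finite_disc in auto)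
  also have "(\<Sum>e\<in>?C - disc w. ?f e) = (\<Sum>e\<in>?C - disc w. if e = x then harmonic_measure ?C x else 0)"
  proof (rule sum.cong [OF refl])
    fix e assume "e \<in> ?C - disc w"
    then have "e \<in> A \<or> e \<in> ?B" by (auto simp: barrier_def)
    then show "?f e = (if e = x then harmonic_measure ?C x else 0)"
    proof
      assume "e \<in> A"
      moreover have "e \<noteq> x" using x \<open>e \<in> A\<close> by (auto simp: boundary_iff)
      ultimately show ?thesis using harmonic_measure_barrier_cluster [OF A(1)] by simp
    next
      assume "e \<in> ?B"
      then show ?thesis by (simp add: hitting_prob_on)
    qed
  qed
  also have "\<dots> = (if x \<in> ?C - disc w then harmonic_measure ?C x else 0)"
    using C by (simp add: sum.delta')
  also have "\<dots> = (if x \<in> disc w then 0 else harmonic_measure ?C x)"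
    using x by (auto simp: barrier_def)
  finally show ?thesis by simp
qed

lemma sum_pass_visit:
  assumes A: "finite A" "A \<noteq> {}"
  shows "(\<Sum>y\<in>boundary A - disc w. harmonic_measure (barrier A w) y) + visit A w = 1"
proof -
  have C: "finite (barrier A w)" "barrier A w \<noteq> {}" using finite_barrier A by (auto simp: barrier_def)
  have "(\<Sum>y\<in>boundary A - disc w. harmonic_measure (barrier A w) y) + visit A w =
      (\<Sum>y\<in>(boundary A - disc w) \<union> disc w. harmonic_measure (barrier A w) y)"
    unfolding visit_def by (rule sum.union_disjoint [symmetric]) (use finite_boundary A finite_disc in auto)
  also have "\<dots> = (\<Sum>y\<in>barrier A w. harmonic_measure (barrier A w) y)"
  proof (rule sum.mono_neutral_left [OF C(1)])
    show "\<forall>y\<in>barrier A w - ((boundary A - disc w) \<union> disc w). harmonic_measure (barrier A w) y = 0"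
    proof
      fix y assume "y \<in> barrier A w - ((boundary A - disc w) \<union> disc w)"
      then have "y \<in> A" unfolding barrier_def by blast
      then show "harmonic_measure (barrier A w) y = 0" by (rule harmonic_measure_barrier_cluster [OF A(1)])
    qed
  qed (auto simp: barrier_def)
  also have "\<dots> = 1" by (rule sum_harmonic_measure [OF C])
  finally show ?thesis .
qed

text \<open>
The walker has to enter the set \<open>near A\<close>, at a site \<open>w\<close> at distance exactly 30 from \<open>A\<close>. Just before, it
was next to \<open>w\<close>, hence inside the disc around \<open>w\<close>, so it had entered this disc earlier and at a
point that is not near \<open>A\<close>. Hence the harmonic measure of \<open>near A\<close> at \<open>w\<close>, which has total mass 1, is at most
the probability of a clean entry.
\<close>

lemma sum_clean_entry_ge_1:
  assumes A: "finite A" "A \<noteq> {}"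
  shows "1 \<le> (\<Sum>w | touching A w. clean_entry A w)"
proof -
  let ?K = "near A"
  have K: "finite ?K" "?K \<noteq> {}" using finite_near A subset_near by auto
  have zero: "harmonic_measure ?K w = 0" if w: "w \<in> ?K" "\<not> touching A w" for w
  proof (rule harmonic_measure_interior [OF K(1) w(1)])
    have "disc w \<inter> A \<noteq> {}" using w(1) disc_commute by (auto simp: near_def)
    then obtain p where p: "p \<in> A" "l1 (p - w) < 30" using w(2) by (auto simp: touching_def not_le)
    fix y assume "adjacent w y"
    then have "l1 (y - p) \<le> 30"
      using p adjacent_l1 [of w y] l1_commute [of w y] l1_commute [of w p] l1_triangle [of y p w] by linarith
    then show "y \<in> ?K" using p(1) by (auto simp: near_iff)
  qed
  have le: "harmonic_measure ?K w \<le> clean_entry A w" if w: "touching A w" for w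
  proof -
    let ?C = "barrier A w" and ?D = "barrier A w \<union> near A"
    have C: "finite ?C" by (rule finite_barrier [OF A(1)])
    then have D: "finite ?D" using K by simp
    \<comment> \<open>all neighbours of \<open>w\<close> are in the disc, so the walker meets the disc before \<open>w\<close>\<close>
    have D0: "harmonic_measure ?D w = 0"
      by (rule harmonic_measure_interior [OF D]) (use self_disc adjacent_disc in \<open>auto simp: barrier_def\<close>)
    have "harmonic_measure ?K w = (\<Sum>e\<in>?D. harmonic_measure ?D e * hitting_prob ?K e w)"
      by (rule harmonic_measure_nested [OF D K(2)]) simp
    also have "\<dots> = (\<Sum>e\<in>?D - ?K. harmonic_measure ?D e * hitting_prob ?K e w)"
    proof (rule sum.mono_neutral_right [OF D])
      show "\<forall>e\<in>?D - (?D - ?K). harmonic_measure ?D e * hitting_prob ?K e w = 0"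
      proof
        fix e assume "e \<in> ?D - (?D - ?K)"
        then have "e \<in> ?K" by blast
        then show "harmonic_measure ?D e * hitting_prob ?K e w = 0"
          using D0 by (cases "w = e") (simp_all add: hitting_prob_on)
      qed
    qed simp
    also have "\<dots> \<le> (\<Sum>e\<in>?D - ?K. harmonic_measure ?D e * 1)"
      by (intro sum_mono mult_left_mono hitting_prob_le_1 harmonic_measure_nonneg D)
    also have "\<dots> \<le> (\<Sum>e\<in>?D - ?K. harmonic_measure ?C e)"
      unfolding mult_1_right by (intro sum_mono harmonic_measure_mono D) auto
    also have "?D - ?K = disc w - near A"
      using subset_near [of A] boundary_subset_near [of A] by (auto simp: barrier_def)
    finally show ?thesis by (simp add: clean_entry_def)
  qed
  have "1 = (\<Sum>w\<in>?K. harmonic_measure ?K w)" by (rule sum_harmonic_measure [OF K, symmetric])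
  also have "\<dots> = (\<Sum>w | touching A w. harmonic_measure ?K w)"
    by (rule sum.mono_neutral_right [OF K(1)]) (use zero touching_near in auto)
  also have "\<dots> \<le> (\<Sum>w | touching A w. clean_entry A w)"
    by (rule sum_mono) (use le in auto)
  finally show ?thesis .
qed

section \<open>Steering a walker along a path\<close>

text \<open>
Lattice paths of length \<open>n\<close> from \<open>p\<close> to \<open>q\<close> whose sites other than the last lie in \<open>S\<close>: with \<open>S\<close>
the complement of a target set and \<open>q\<close> in this set, the path avoids the set before its end.
\<close>

inductive route :: "pt set \<Rightarrow> nat \<Rightarrow> pt \<Rightarrow> pt \<Rightarrow> bool" for S where
  route_refl: "route S 0 p p"
| route_step: "p \<in> S \<Longrightarrow> adjacent p q \<Longrightarrow> route S n q r \<Longrightarrow> route S (Suc n) p r"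

lemma route_trans: "route S n p q \<Longrightarrow> route S m q r \<Longrightarrow> route S (n + m) p r"
  by (induction rule: route.induct) (auto intro: route.intros)

lemma route_mono: "route S n p q \<Longrightarrow> S \<subseteq> S' \<Longrightarrow> route S' n p q"
  by (induction rule: route.induct) (auto intro: route.intros)

lemma avg_ge_quarter:
  assumes "adjacent p q" and nn: "\<And>z. 0 \<le> u z"
  shows "u q / 4 \<le> avg u p"
proof -
  obtain d where "d \<in> unit_steps" "q = p + d" using assms(1) unfolding adjacent_unit by blast
  then show ?thesis
    using nn [of "p + (1,0)"] nn [of "p + (-1,0)"] nn [of "p + (0,1)"] nn [of "p + (0,-1)"]
    by (auto simp: avg_def)
qed

text \<open>
Along each edge a nonnegative superharmonic function loses at most a factor 4.
\<close>

lemma route_bound: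
  assumes "route S n p q" and nn: "\<And>z. 0 \<le> u z" and h: "\<And>z. z \<in> S \<Longrightarrow> avg u z \<le> u z"
  shows "(1 / 4) ^ n * u q \<le> u p"
  using assms(1)
proof (induction rule: route.induct)
  case (route_step p q n r)
  have "(1 / 4) ^ Suc n * u r = ((1 / 4) ^ n * u r) / 4" by simp
  also have "\<dots> \<le> u q / 4" using route_step by simp
  also have "\<dots> \<le> avg u p" by (rule avg_ge_quarter [OF route_step(2) nn])
  also have "\<dots> \<le> u p" by (rule h [OF route_step(1)])
  finally show ?case .
qed simp

lemma route_hits_boundary:
  assumes "route S n p q" "p \<notin> A" "q \<in> A"
  shows "\<exists>m\<le>n. \<exists>z. z \<in> S \<inter> boundary A \<and> route (- boundary A) m p z"
  using assms
proof (induction rule: route.induct)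
  case (route_step p q n r)
  show ?case
  proof (cases "p \<in> boundary A")
    case True
    then show ?thesis using route_step(1) route_refl by blast
  next
    case False
    then have "q \<notin> A" using route_step by (auto simp: boundary_iff)
    then obtain m z where "m \<le> n" "z \<in> S \<inter> boundary A" "route (- boundary A) m q z"
      using route_step by blast
    moreover from this have "route (- boundary A) (Suc m) p z"
      using False route_step(2) by (intro route.route_step) auto
    ultimately show ?thesis by (meson Suc_le_mono)
  qed
qed simp

lemma geodesic_route: "l1 (q - p) = int n \<Longrightarrow> route {z. l1 (z - p) + l1 (q - z) = l1 (q - p)} n p q"
proof (induction n arbitrary: p)
  case 0
  then have "p = q" using l1_eq_0 [of "q - p"] by simp
  then show ?case using route_refl by simp
next
  case (Suc n)
  obtain i j where ij: "q - p = (i, j)" by (cases "q - p")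
  have ne: "\<bar>i\<bar> + \<bar>j\<bar> = int (Suc n)" using Suc.prems by (simp add: ij l1_def)
  obtain d where d: "d \<in> unit_steps" "l1 (q - (p + d)) = int n"
  proof -
    have e: "q - (p + d) = (i, j) - d" for d using ij by (simp add: algebra_simps)
    have "i > 0 \<or> i < 0 \<or> j > 0 \<or> j < 0" using ne by linarith
    then show thesis
    proof (elim disjE)
      assume "i > 0" then show thesis by (intro that [of "(1, 0)"]) (use ne in \<open>auto simp: e l1_def\<close>)
    next
      assume "i < 0" then show thesis by (intro that [of "(-1, 0)"]) (use ne in \<open>auto simp: e l1_def\<close>)
    next
      assume "j > 0" then show thesis by (intro that [of "(0, 1)"]) (use ne in \<open>auto simp: e l1_def\<close>)
    next
      assume "j < 0" then show thesis by (intro that [of "(0, -1)"]) (use ne in \<open>auto simp: e l1_def\<close>)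
    qed
  qed
  have d1: "l1 (p + d - p) = 1" using d(1) l1_unit [of d] by simp
  have "route {z. l1 (z - (p + d)) + l1 (q - z) = l1 (q - (p + d))} n (p + d) q"
    by (rule Suc.IH [OF d(2)])
  then have "route {z. l1 (z - p) + l1 (q - z) = l1 (q - p)} n (p + d) q"
  proof (rule route_mono, intro subsetI CollectI)
    fix z assume "z \<in> {z. l1 (z - (p + d)) + l1 (q - z) = l1 (q - (p + d))}"
    then have z: "l1 (z - (p + d)) + l1 (q - z) = int n" using d(2) by simp
    have "l1 (z - p) \<le> l1 (z - (p + d)) + 1" using l1_triangle [of z p "p + d"] d1 by simp
    moreover have "l1 (q - p) \<le> l1 (z - p) + l1 (q - z)" using l1_triangle [of q p z] by simp
    ultimately show "l1 (z - p) + l1 (q - z) = l1 (q - p)" using z Suc.prems by simp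
  qed
  then show ?case
    using d(1) by (intro route_step [of p _ "p + d"]) (auto simp: adjacent_unit l1_0)
qed

text \<open>
The paths below have at most 100 steps, and each prescribed step costs a factor \<open>1 / 4\<close>.
\<close>

definition kappa :: real where "kappa = (1 / 4) ^ 100"

lemma kappa_pos: "0 < kappa"
  by (simp add: kappa_def)

lemma kappa_le_power: "n \<le> 100 \<Longrightarrow> kappa \<le> (1 / 4) ^ n"
  unfolding kappa_def by (rule power_decreasing) auto

lemma route_hitting_prob:
  assumes "route (- B) n p z" "n \<le> 100" "z \<in> B"
  shows "kappa \<le> hitting_prob B p z"
proof -
  have "(1 / 4) ^ n * hitting_prob B z z \<le> hitting_prob B p z"
    by (rule route_bound [OF assms(1), where u = "\<lambda>y. hitting_prob B y z"])
      (simp_all add: hitting_prob_nonneg avg_hitting_prob)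
  then show ?thesis using kappa_le_power [OF assms(2)] assms(3) by (simp add: hitting_prob_on)
qed

lemma route_to_centre:
  assumes "e \<in> disc w" obtains n where "n \<le> 30" "route {z. l1 (z - e) + l1 (w - z) = l1 (w - e)} n e w"
proof -
  have "l1 (w - e) = int (nat (l1 (w - e)))" using l1_nonneg by simp
  moreover have "nat (l1 (w - e)) \<le> 30" using assms l1_commute [of e w] by (simp add: mem_disc)
  ultimately show thesis using geodesic_route that by blast
qed

text \<open>
From any point of the disc around \<open>w\<close> one can walk to \<open>w\<close> and on to the cluster point at distance
30 without leaving the disc, and this path meets the boundary of the cluster inside the disc.
\<close>

lemma visit_lands:
  assumes A: "finite A" "A \<noteq> {}" and t: "touching A w"
  shows "kappa * visit A w \<le> (\<Sum>x\<in>boundary A \<inter> disc w. harmonic_measure (boundary A) x)"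
proof -
  let ?C = "barrier A w" and ?B = "boundary A"
  have C: "finite ?C" by (rule finite_barrier [OF A(1)])
  obtain q where q: "q \<in> A" "q \<in> disc w" using t by (auto simp: touching_def)
  have e: "harmonic_measure ?C e * kappa \<le> harmonic_measure ?C e * (\<Sum>x\<in>?B \<inter> disc w. hitting_prob ?B e x)"
    if e: "e \<in> disc w" for e
  proof (cases "e \<in> A")
    case True
    then show ?thesis using harmonic_measure_barrier_cluster [OF A(1)] by simp
  next
    case False
    obtain n where n: "n \<le> 30" "route {z. l1 (z - e) + l1 (w - z) = l1 (w - e)} n e w"
      by (rule route_to_centre [OF e])
    have "w \<in> disc q" using q disc_commute by blast
    then obtain m where m: "m \<le> 30" "route {z. l1 (z - w) + l1 (q - z) = l1 (q - w)} m w q"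
    proof -
      have "l1 (q - w) = int (nat (l1 (q - w)))" using l1_nonneg by simp
      moreover have "nat (l1 (q - w)) \<le> 30" using q(2) by (simp add: mem_disc)
      ultimately show thesis using geodesic_route that by blast
    qed
    have s1: "{z. l1 (z - e) + l1 (w - z) = l1 (w - e)} \<subseteq> disc w"
    proof
      fix z assume "z \<in> {z. l1 (z - e) + l1 (w - z) = l1 (w - e)}"
      then have "l1 (w - z) \<le> l1 (w - e)" using l1_nonneg [of "z - e"] by simp
      then show "z \<in> disc w" using e l1_commute [of e w] l1_commute [of z w] by (simp add: mem_disc)
    qed
    have s2: "{z. l1 (z - w) + l1 (q - z) = l1 (q - w)} \<subseteq> disc w"
    proof
      fix z assume "z \<in> {z. l1 (z - w) + l1 (q - z) = l1 (q - w)}"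
      then have "l1 (z - w) \<le> l1 (q - w)" using l1_nonneg [of "q - z"] by simp
      then show "z \<in> disc w" using q(2) by (simp add: mem_disc)
    qed
    have "route (disc w) (n + m) e q"
      by (rule route_trans [OF route_mono [OF n(2) s1] route_mono [OF m(2) s2]])
    then obtain k z where k: "k \<le> n + m" "z \<in> disc w \<inter> ?B" "route (- ?B) k e z"
      using route_hits_boundary False q(1) by blast
    have "kappa \<le> hitting_prob ?B e z"
      by (rule route_hitting_prob [OF k(3)]) (use k n m in auto)
    also have "\<dots> \<le> (\<Sum>x\<in>?B \<inter> disc w. hitting_prob ?B e x)"
      by (rule member_le_sum) (use k finite_disc hitting_prob_nonneg in auto)
    finally show ?thesis by (rule mult_left_mono [OF _ harmonic_measure_nonneg [OF C]])
  qed
  have "kappa * visit A w = (\<Sum>e\<in>disc w. harmonic_measure ?C e * kappa)"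
    by (simp add: visit_def sum_distrib_left mult.commute)
  also have "\<dots> \<le> (\<Sum>e\<in>disc w. harmonic_measure ?C e * (\<Sum>x\<in>?B \<inter> disc w. hitting_prob ?B e x))"
    by (rule sum_mono) (rule e)
  also have "\<dots> = (\<Sum>x\<in>?B \<inter> disc w. \<Sum>e\<in>disc w. harmonic_measure ?C e * hitting_prob ?B e x)"
    unfolding sum_distrib_left by (rule sum.swap)
  also have "\<dots> = (\<Sum>x\<in>?B \<inter> disc w. harmonic_measure ?B x)"
  proof (rule sum.cong [OF refl])
    fix x assume "x \<in> ?B \<inter> disc w"
    then show "(\<Sum>e\<in>disc w. harmonic_measure ?C e * hitting_prob ?B e x) = harmonic_measure ?B x"
      using landing_decomposition [OF A, of x w] by simp
  qed
  finally show ?thesis .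
qed

section \<open>Repeated clean entries\<close>

text \<open>
The probability that, among \<open>n\<close> walkers arriving one after the other, \<open>k\<close> make a clean entry into the disc
around \<open>w\<close>, and each walker before the last of these either makes one as well or lands without
visiting the disc. A walker that makes a clean entry is removed and does not change the cluster: what
happens to it afterwards is decided separately, when it is led to a prescribed site.
\<close>

fun clean_visits :: "pt \<Rightarrow> nat \<Rightarrow> nat \<Rightarrow> pt set \<Rightarrow> real" where
  "clean_visits w 0 n A = 1"
| "clean_visits w (Suc k) 0 A = 0"
| "clean_visits w (Suc k) (Suc n) A =
     clean_entry A w * clean_visits w k n A +
     (\<Sum>y\<in>boundary A - disc w. harmonic_measure (barrier A w) y * clean_visits w (Suc k) n (insert y A))"

lemma clean_visits_nonneg: "finite A \<Longrightarrow> 0 \<le> clean_visits w k n A"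
proof (induction w k n A rule: clean_visits.induct)
  case (3 w k n A)
  then show ?case
    by (auto intro!: add_nonneg_nonneg mult_nonneg_nonneg sum_nonneg clean_entry_nonneg
        harmonic_measure_nonneg finite_barrier simp del: insert_is_Un)
qed simp_all

lemma clean_visits_Suc_horizon: "finite A \<Longrightarrow> clean_visits w k n A \<le> clean_visits w k (Suc n) A"
proof (induction w k n A rule: clean_visits.induct)
  case (2 w k A)
  then show ?case using clean_visits_nonneg [of A w "Suc k" "Suc 0"] by simp
next
  case (3 w k n A)
  have "clean_entry A w * clean_visits w k n A \<le> clean_entry A w * clean_visits w k (Suc n) A"
    by (intro mult_left_mono 3 clean_entry_nonneg)
  moreover have "(\<Sum>y\<in>boundary A - disc w. harmonic_measure (barrier A w) y * clean_visits w (Suc k) n (insert y A))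
      \<le> (\<Sum>y\<in>boundary A - disc w. harmonic_measure (barrier A w) y * clean_visits w (Suc k) (Suc n) (insert y A))"
  proof (rule sum_mono)
    fix y assume y: "y \<in> boundary A - disc w"
    have "clean_visits w (Suc k) n (insert y A) \<le> clean_visits w (Suc k) (Suc n) (insert y A)"
      by (rule 3(2) [OF y]) (use 3 in simp)
    then show "harmonic_measure (barrier A w) y * clean_visits w (Suc k) n (insert y A)
      \<le> harmonic_measure (barrier A w) y * clean_visits w (Suc k) (Suc n) (insert y A)"
      by (rule mult_left_mono) (use 3 harmonic_measure_nonneg finite_barrier in blast)
  qed
  ultimately show ?case unfolding clean_visits.simps by (rule add_mono)
qed simp

lemma clean_visits_horizon_mono:
  assumes "finite A" "n \<le> m"
  shows "clean_visits w k n A \<le> clean_visits w k m A"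
  by (rule lift_Suc_mono_le [of "\<lambda>n. clean_visits w k n A"])
    (use assms clean_visits_Suc_horizon in auto)

lemma power_tangent:
  fixes a x :: real
  assumes "0 \<le> a" "0 \<le> x"
  shows "a ^ Suc k + real (Suc k) * a ^ k * (x - a) \<le> x ^ Suc k"
proof (induction k)
  case (Suc k)
  have "0 \<le> real (Suc k) * a ^ k * (x - a)\<^sup>2" using assms by simp
  also have "\<dots> = x * (a ^ Suc k + real (Suc k) * a ^ k * (x - a)) -
      (a ^ Suc (Suc k) + real (Suc (Suc k)) * a ^ Suc k * (x - a))"
    by (simp add: algebra_simps power2_eq_square)
  also have "\<dots> \<le> x * x ^ Suc k - (a ^ Suc (Suc k) + real (Suc (Suc k)) * a ^ Suc k * (x - a))"
    using mult_left_mono [OF Suc assms(2)] by simp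
  finally show ?case by simp
qed simp

text \<open>
Jensen's inequality for a measure of total mass at most 1; the missing mass does no harm, since the power
vanishes at 0.
\<close>

lemma power_sum_le_sum_power:
  fixes p x :: "'a \<Rightarrow> real"
  assumes p: "\<And>y. y \<in> I \<Longrightarrow> 0 \<le> p y" "(\<Sum>y\<in>I. p y) \<le> 1" and x: "\<And>y. y \<in> I \<Longrightarrow> 0 \<le> x y"
  shows "(\<Sum>y\<in>I. p y * x y) ^ Suc k \<le> (\<Sum>y\<in>I. p y * x y ^ Suc k)"
proof -
  let ?X = "\<Sum>y\<in>I. p y * x y" and ?s = "\<Sum>y\<in>I. p y"
  have X: "0 \<le> ?X" by (intro sum_nonneg mult_nonneg_nonneg p x)
  have "?X ^ Suc k \<le> ?X ^ Suc k + real k * ?X ^ Suc k * (1 - ?s)" using X p(2) by simp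
  also have "\<dots> = ?s * (?X ^ Suc k - real (Suc k) * ?X ^ k * ?X) + real (Suc k) * ?X ^ k * ?X"
    by (simp add: algebra_simps)
  also have "\<dots> = (\<Sum>y\<in>I. p y * (?X ^ Suc k + real (Suc k) * ?X ^ k * (x y - ?X)))"
  proof -
    have "(\<Sum>y\<in>I. p y * (c + d * (x y - e))) = ?s * (c - d * e) + d * ?X" for c d e :: real
      by (simp add: algebra_simps sum.distrib sum_subtractf sum_distrib_left sum_distrib_right)
    then show ?thesis by simp
  qed
  also have "\<dots> \<le> (\<Sum>y\<in>I. p y * x y ^ Suc k)"
    by (intro sum_mono mult_left_mono power_tangent X x p)
  finally show ?thesis .
qed

lemma sum_pass_le_1:
  assumes "finite A" "A \<noteq> {}"
  shows "(\<Sum>y\<in>boundary A - disc w. harmonic_measure (barrier A w) y) \<le> 1"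
  using sum_pass_visit [OF assms, of w] visit_nonneg [OF assms(1), of w] by linarith

text \<open>
Write \<open>g\<close> for the chance of an immediate clean entry and \<open>X\<close> for that of a first clean entry later. The
induction reduces to \<open>(g + X) ^ K \<le> K * g * (g + X) ^ (K - 1) + X ^ K\<close>, which is the tangent of the power
at \<open>g + X\<close>, together with Jensen's inequality for the landings outside the disc. Each additional
entry is granted \<open>M\<close> further walkers.
\<close>

lemma clean_visits_power_bound:
  assumes "n \<le> M" "finite A" "A \<noteq> {}"
  shows "clean_visits w 1 n A ^ Suc k / fact (Suc k) \<le> clean_visits w (Suc k) (n + k * M) A"
  using assms
proof (induction k arbitrary: n A)
  case (Suc k)
  note IHk = Suc.IH
  show ?case using Suc.prems
  proof (induction n arbitrary: A)
    case 0
    then show ?case using clean_visits_nonneg by simp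
  next
    case (Suc n)
    let ?I = "boundary A - disc w"
    define g where "g = clean_entry A w"
    define p where "p = harmonic_measure (barrier A w)"
    define x where "x = (\<lambda>y. clean_visits w 1 n (insert y A))"
    define X where "X = (\<Sum>y\<in>?I. p y * x y)"
    have g: "0 \<le> g" unfolding g_def by (rule clean_entry_nonneg [OF Suc.prems(2)])
    have p: "0 \<le> p y" for y unfolding p_def by (rule harmonic_measure_nonneg [OF finite_barrier [OF Suc.prems(2)]])
    have x: "0 \<le> x y" for y unfolding x_def by (rule clean_visits_nonneg) (use Suc.prems in simp)
    have X: "0 \<le> X" unfolding X_def by (intro sum_nonneg mult_nonneg_nonneg p x)
    have one: "clean_visits w 1 (Suc n) A = g + X" by (simp add: g_def p_def x_def X_def)
    \<comment> \<open>for the landings outside the disc\<close>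
    have conv: "X ^ Suc (Suc k) \<le> (\<Sum>y\<in>?I. p y * x y ^ Suc (Suc k))"
      unfolding X_def
      by (rule power_sum_le_sum_power) (use p x sum_pass_le_1 [OF Suc.prems(2,3)] in \<open>auto simp: p_def\<close>)
    have first: "(g + X) ^ Suc k / fact (Suc k) \<le> clean_visits w (Suc k) (n + Suc k * M) A"
    proof -
      have "(g + X) ^ Suc k / fact (Suc k) \<le> clean_visits w (Suc k) (Suc n + k * M) A"
        unfolding one [symmetric] by (rule IHk [OF Suc.prems])
      also have "\<dots> \<le> clean_visits w (Suc k) (n + Suc k * M) A"
        by (rule clean_visits_horizon_mono) (use Suc.prems in auto)
      finally show ?thesis .
    qed
    have rest: "X ^ Suc (Suc k) / fact (Suc (Suc k)) \<le>
        (\<Sum>y\<in>?I. p y * clean_visits w (Suc (Suc k)) (n + Suc k * M) (insert y A))"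
    proof -
      have "X ^ Suc (Suc k) / fact (Suc (Suc k)) \<le> (\<Sum>y\<in>?I. p y * x y ^ Suc (Suc k)) / fact (Suc (Suc k))"
        by (rule divide_right_mono [OF conv]) simp
      also have "\<dots> = (\<Sum>y\<in>?I. p y * (x y ^ Suc (Suc k) / fact (Suc (Suc k))))"
        unfolding sum_divide_distrib by (intro sum.cong refl) (simp only: times_divide_eq_right)
      also have "\<dots> \<le> (\<Sum>y\<in>?I. p y * clean_visits w (Suc (Suc k)) (n + Suc k * M) (insert y A))"
        unfolding x_def by (intro sum_mono mult_left_mono p Suc.IH) (use Suc.prems in auto)
      finally show ?thesis .
    qed
    have tangent: "(g + X) ^ Suc (Suc k) \<le> real (Suc (Suc k)) * (g + X) ^ Suc k * g + X ^ Suc (Suc k)"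
      using power_tangent [of "g + X" X "Suc k"] g X by (simp add: algebra_simps)
    have "(g + X) ^ Suc (Suc k) / fact (Suc (Suc k)) \<le>
        (real (Suc (Suc k)) * (g + X) ^ Suc k * g + X ^ Suc (Suc k)) / fact (Suc (Suc k))"
      by (rule divide_right_mono [OF tangent]) simp
    also have "\<dots> = g * ((g + X) ^ Suc k / fact (Suc k)) + X ^ Suc (Suc k) / fact (Suc (Suc k))"
    proof -
      have f: "fact (Suc (Suc k)) = real (Suc (Suc k)) * fact (Suc k)" by simp
      have "(r * t * g + u) / (r * v) = g * (t / v) + u / (r * v)" if "r \<noteq> 0" "v \<noteq> 0" for r t u v :: real
        using that by (simp add: field_simps)
      then show ?thesis unfolding f by (metis fact_nonzero of_nat_neq_0)
    qed
    also have "\<dots> \<le> g * clean_visits w (Suc k) (n + Suc k * M) A +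
        (\<Sum>y\<in>?I. p y * clean_visits w (Suc (Suc k)) (n + Suc k * M) (insert y A))"
      by (intro add_mono mult_left_mono first rest g)
    also have "\<dots> = clean_visits w (Suc (Suc k)) (Suc n + Suc k * M) A"
      by (simp add: g_def p_def)
    finally show ?case unfolding one .
  qed
qed simp

section \<open>Twelve landings that close a hole\<close>

text \<open>
Coordinates centred at \<open>w\<close> in which a chosen cluster point at distance 30 is \<open>(a, b)\<close> and lies in the first
octant. They remove the eight symmetric cases; note \<open>15 \<le> a\<close>.
\<close>

locale approach =
  fixes w :: pt and \<phi> :: "int \<Rightarrow> int \<Rightarrow> pt" and a b :: int
  assumes origin: "\<phi> 0 0 = w"
    and isometry: "l1 (\<phi> i k - \<phi> i' k') = \<bar>i - i'\<bar> + \<bar>k - k'\<bar>"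
    and onto: "\<exists>i k. z = \<phi> i k"
    and octant: "0 \<le> b" "b \<le> a" "a + b = 30"

lemma approach_exists:
  assumes "l1 (q - w) = 30"
  obtains \<phi> a b where "approach w \<phi> a b" "\<phi> a b = q"
proof -
  obtain i j where ij: "q = w + (i, j)" by (metis add.commute diff_add_cancel surj_pair)
  have sum: "\<bar>i\<bar> + \<bar>j\<bar> = 30" using assms by (simp add: ij l1_def)
  define s where "s = (\<lambda>i::int. if i < 0 then -1 else (1::int))"
  have s: "s x * s x = 1" "s x * \<bar>x\<bar> = x" "\<bar>s x\<bar> = 1" for x by (auto simp: s_def)
  have d: "\<bar>s x * y - s x * z\<bar> = \<bar>y - z\<bar>" for x y z
    by (simp flip: right_diff_distrib add: abs_mult s)
  have c: "s x * (s x * y) = y" for x y by (simp add: s flip: mult.assoc)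
  obtain p1 p2 where w: "w = (p1, p2)" by (cases w)
  show thesis
  proof (cases "\<bar>j\<bar> \<le> \<bar>i\<bar>")
    case True
    let ?\<phi> = "\<lambda>x y. w + (s i * x, s j * y)"
    have "approach w ?\<phi> \<bar>i\<bar> \<bar>j\<bar>"
    proof
      fix z :: pt
      have "z = ?\<phi> (s i * (fst z - p1)) (s j * (snd z - p2))" by (simp add: w c prod_eq_iff)
      then show "\<exists>i' k'. z = ?\<phi> i' k'" by blast
    qed (use True sum d in \<open>simp_all add: l1_def w zero_prod_def\<close>)
    then show thesis by (rule that) (simp add: ij s)
  next
    case False
    let ?\<phi> = "\<lambda>x y. w + (s i * y, s j * x)"
    have "approach w ?\<phi> \<bar>j\<bar> \<bar>i\<bar>"
    proof
      fix z :: pt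
      have "z = ?\<phi> (s j * (snd z - p2)) (s i * (fst z - p1))" by (simp add: w c prod_eq_iff)
      then show "\<exists>i' k'. z = ?\<phi> i' k'" by blast
    qed (use False sum d in \<open>simp_all add: l1_def w zero_prod_def\<close>)
    then show thesis by (rule that) (simp add: ij s)
  qed
qed

text \<open>
The sites to be occupied, in order, as offsets \<open>(c, d)\<close> from the cluster point \<open>(a, b)\<close> back towards \<open>w\<close>. A
straight arm of five sites is continued to a ring around the offset \<open>(6, 1)\<close>; the arm moves the ring
away from the rim of the disc, so that all sites are at distance less than 30 from \<open>w\<close> even if
\<open>b = 0\<close>. The walker arrives along
the row of its site, from the side of larger \<open>c\<close>, and the order is such that the row is still
open there (\<open>offset_exposed\<close>).
\<close>

definition offsets :: "(int \<times> int) list" where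
  "offsets = [(1,0),(2,0),(3,0),(4,0),(5,0),(5,1),(5,2),(6,0),(7,0),(6,2),(7,2),(7,1)]"

lemma length_offsets: "length offsets = 12" by (simp add: offsets_def)

lemma offset_range:
  "(c, d) \<in> set offsets \<Longrightarrow> 1 \<le> c \<and> c \<le> 7 \<and> 0 \<le> d \<and> d \<le> 2 \<and> (0 < d \<longrightarrow> 5 \<le> c)"
  by (auto simp: offsets_def)

lemma less_12_cases: "i < (12::nat) \<Longrightarrow> i \<in> {0,1,2,3,4,5,6,7,8,9,10,11}"
  by (simp, presburger)

lemma offset_attached:
  assumes "i < 12"
  shows "\<exists>(c, d)\<in>insert (0, 0) (set (take i offsets)).
    \<bar>fst (offsets ! i) - c\<bar> + \<bar>snd (offsets ! i) - d\<bar> = 1"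
  using less_12_cases [OF assms] by (elim insertE emptyE) (simp_all add: offsets_def)

text \<open>
The part of the row on the side of larger \<open>c\<close> is not adjacent to any site occupied earlier.
\<close>

lemma offset_exposed:
  assumes "i < 12" "(c, d) \<in> set (take i offsets)" "fst (offsets ! i) < m"
  shows "\<bar>m - c\<bar> + \<bar>snd (offsets ! i) - d\<bar> \<noteq> 1"
  using less_12_cases [OF assms(1)] assms(2,3) by (elim insertE emptyE) (auto simp: offsets_def)

lemma offset_fresh:
  assumes "i < 12"
  shows "offsets ! i \<notin> set (take i offsets)"
  using less_12_cases [OF assms] by (elim insertE emptyE) (simp_all add: offsets_def)

context approach
begin

definition site :: "int \<times> int \<Rightarrow> pt" where
  "site u = \<phi> (a - fst u) (b - snd u)"

definition sites :: "nat \<Rightarrow> pt set" where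
  "sites i = site ` set (take i offsets)"

lemma adjacent_\<phi>: "adjacent (\<phi> i k) (\<phi> i' k') \<longleftrightarrow> \<bar>i - i'\<bar> + \<bar>k - k'\<bar> = 1"
  by (simp add: adjacent_iff isometry)

lemma \<phi>_eq_iff: "\<phi> i k = \<phi> i' k' \<longleftrightarrow> i = i' \<and> k = k'"
  using l1_eq_0 [of "\<phi> i k - \<phi> i' k'"] by (auto simp: isometry)

lemma l1_site: "u \<in> set offsets \<Longrightarrow> l1 (site u - w) < 30"
  using offset_range [of "fst u" "snd u"] octant
  by (simp add: site_def isometry flip: origin) linarith

lemma site_near_target: "u \<in> set offsets \<Longrightarrow> l1 (site u - \<phi> a b) \<le> 9"
  using offset_range [of "fst u" "snd u"] by (simp add: site_def isometry)

lemma inj_site: "inj site"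
proof (rule injI)
  fix u v assume "site u = site v"
  then show "u = v" unfolding site_def \<phi>_eq_iff by (simp add: prod_eq_iff)
qed

lemma site_mem_sites: "site u \<in> sites i \<longleftrightarrow> u \<in> set (take i offsets)"
  unfolding sites_def by (rule inj_image_mem_iff [OF inj_site])

lemma sites_subset: "sites i \<subseteq> site ` set offsets"
  unfolding sites_def using set_take_subset by fast

lemma sites_Suc: "i < 12 \<Longrightarrow> sites (Suc i) = insert (site (offsets ! i)) (sites i)"
  by (simp add: sites_def take_Suc_conv_app_nth length_offsets)

lemma offset_mem: "i < 12 \<Longrightarrow> offsets ! i \<in> set offsets"
  by (simp add: length_offsets)

lemma site_disc: "u \<in> set offsets \<Longrightarrow> z = site u \<or> adjacent (site u) z \<Longrightarrow> z \<in> disc w"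
  using l1_site [of u] l1_triangle [of z w "site u"] adjacent_l1 [of "site u" z] l1_commute [of "site u" z]
  by (auto simp: mem_disc)

lemma finite_sites: "finite (sites i)" by (simp add: sites_def)

lemma site_fresh:
  assumes "i < 12" "touching \<omega> w"
  shows "site (offsets ! i) \<notin> \<omega> \<union> sites i"
proof -
  have "site (offsets ! i) \<notin> \<omega>"
    using assms l1_site [OF offset_mem [OF assms(1)]] by (auto simp: touching_def)
  moreover have "site (offsets ! i) \<notin> sites i"
    using offset_fresh [OF assms(1)] unfolding site_mem_sites .
  ultimately show ?thesis by blast
qed

lemma site_attached:
  assumes "i < 12" "touching \<omega> w" "\<phi> a b \<in> \<omega>"
  shows "site (offsets ! i) \<in> boundary (\<omega> \<union> sites i)"
proof -
  obtain c d where cd: "(c, d) \<in> insert (0, 0) (set (take i offsets))"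
    "\<bar>fst (offsets ! i) - c\<bar> + \<bar>snd (offsets ! i) - d\<bar> = 1"
    using offset_attached [OF assms(1)] by blast
  have "site (c, d) \<in> \<omega> \<union> sites i"
  proof (cases "(c, d) = (0, 0)")
    case True
    then show ?thesis using assms(3) by (simp add: site_def)
  next
    case False
    then show ?thesis using cd(1) site_mem_sites by blast
  qed
  moreover have "adjacent (site (offsets ! i)) (site (c, d))"
    using cd(2) unfolding site_def adjacent_\<phi> by simp
  ultimately show ?thesis
    using site_fresh [OF assms(1,2)] unfolding boundary_iff by blast
qed

lemma far_not_boundary:
  assumes "touching \<omega> w" "l1 (z - w) \<le> 28" "\<And>s. s \<in> sites i \<Longrightarrow> \<not> adjacent z s"
  shows "z \<notin> boundary (\<omega> \<union> sites i)"
proof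
  assume "z \<in> boundary (\<omega> \<union> sites i)"
  then obtain p where p: "p \<in> \<omega> \<union> sites i" "adjacent z p" unfolding boundary_iff by blast
  then have "p \<in> \<omega>" using assms(3) by blast
  then have "30 \<le> l1 (p - w)" using assms(1) unfolding touching_def by blast
  moreover have "l1 (p - z) = 1" using adjacent_l1 [OF p(2)] l1_commute [of z p] by simp
  ultimately show False using assms(2) l1_triangle [of p w z] by linarith
qed

lemma route_column:
  assumes "\<And>y. \<bar>y\<bar> \<le> \<bar>r\<bar> \<Longrightarrow> \<phi> x y \<in> S"
  shows "route S (nat \<bar>r\<bar>) (\<phi> x 0) (\<phi> x r)"
proof -
  have "route {z. l1 (z - \<phi> x 0) + l1 (\<phi> x r - z) = l1 (\<phi> x r - \<phi> x 0)} (nat \<bar>r\<bar>) (\<phi> x 0) (\<phi> x r)"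
    by (rule geodesic_route) (simp add: isometry)
  then show ?thesis
  proof (rule route_mono, intro subsetI)
    fix z assume z: "z \<in> {z. l1 (z - \<phi> x 0) + l1 (\<phi> x r - z) = l1 (\<phi> x r - \<phi> x 0)}"
    obtain i k where ik: "z = \<phi> i k" using onto by blast
    have "i = x" "\<bar>k\<bar> \<le> \<bar>r\<bar>" using z unfolding ik by (simp_all add: isometry)
    then show "z \<in> S" unfolding ik using assms by simp
  qed
qed

lemma route_row:
  assumes "\<And>x. 0 \<le> x \<Longrightarrow> x < int n \<Longrightarrow> \<phi> (l - int n + x) y \<in> S"
  shows "route S n (\<phi> (l - int n) y) (\<phi> l y)"
  using assms
proof (induction n)
  case 0
  then show ?case by (simp add: route_refl)
next
  case (Suc n)
  have "route S n (\<phi> (l - int n) y) (\<phi> l y)"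
  proof (rule Suc.IH)
    fix x assume "0 \<le> x" "x < int n"
    then show "\<phi> (l - int n + x) y \<in> S" using Suc.prems [of "x + 1"] by (simp add: algebra_simps)
  qed
  moreover have "\<phi> (l - int (Suc n)) y \<in> S" using Suc.prems [of 0] by simp
  moreover have "adjacent (\<phi> (l - int (Suc n)) y) (\<phi> (l - int n) y)"
    by (simp add: adjacent_\<phi>)
  ultimately show ?case by (intro route_step)
qed

text \<open>
Three legs. On a geodesic from \<open>e\<close> to \<open>w\<close> the walker is at distance at least 16 from the cluster, because
\<open>e\<close> is at distance at least 31, \<open>w\<close> at distance at least 30, and the leg has length at most 30. From \<open>w\<close>
it follows the column through \<open>w\<close> to the row of the site, and then this row; on these two legs it is within
distance 28 of \<open>w\<close>, hence not next to the cluster. The sites occupied earlier are far from the first two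
legs, and the row avoids their neighbours by \<open>offset_exposed\<close>.
\<close>

lemma route_to_site:
  assumes i: "i < 12" and t: "touching \<omega> w" "\<phi> a b \<in> \<omega>" and e: "e \<in> disc w - near \<omega>"
  obtains n where "n \<le> 100" "route (- boundary (\<omega> \<union> sites i)) n e (site (offsets ! i))"
proof -
  let ?S = "- boundary (\<omega> \<union> sites i)"
  obtain c d where cd: "offsets ! i = (c, d)" by (cases "offsets ! i")
  have r: "1 \<le> c" "c \<le> 7" "0 \<le> d" "d \<le> 2" "0 < d \<Longrightarrow> 5 \<le> c"
    using offset_range [of c d] offset_mem [OF i] by (simp_all add: cd)
  obtain n where n: "n \<le> 30" "route {z. l1 (z - e) + l1 (w - z) = l1 (w - e)} n e w"
    by (rule route_to_centre [of e w]) (use e in auto)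
  have far: "16 \<le> l1 (z - p)" if z: "l1 (z - e) + l1 (w - z) = l1 (w - e)" and p: "p \<in> \<omega>" for z p
  proof -
    have "30 < l1 (e - p)" using e p by (auto simp: near_iff)
    moreover have "30 \<le> l1 (p - w)" using t(1) p unfolding touching_def by blast
    moreover have "l1 (w - e) \<le> 30" using e l1_commute [of w e] by (simp add: mem_disc)
    ultimately show ?thesis
      using z l1_triangle [of e p z] l1_triangle [of p w z] l1_commute [of e z] l1_commute [of p z] l1_commute [of w z]
      by linarith
  qed
  have 1: "route ?S n e w"
  proof (rule route_mono [OF n(2)], intro subsetI ComplI)
    fix z assume "z \<in> {z. l1 (z - e) + l1 (w - z) = l1 (w - e)}" "z \<in> boundary (\<omega> \<union> sites i)"
    then obtain p where z: "l1 (z - e) + l1 (w - z) = l1 (w - e)" and p: "p \<in> \<omega> \<union> sites i" "adjacent z p"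
      unfolding boundary_iff by blast
    have zp: "l1 (z - p) = 1" by (rule adjacent_l1 [OF p(2)])
    show False using p(1)
    proof
      assume "p \<in> \<omega>" then show False using far [OF z] zp by fastforce
    next
      assume "p \<in> sites i"
      then have "l1 (p - \<phi> a b) \<le> 9" using sites_subset site_near_target by blast
      then show False using far [OF z t(2)] zp l1_triangle [of z "\<phi> a b" p] by linarith
    qed
  qed
  have 2: "route ?S (nat \<bar>b - d\<bar>) w (\<phi> 0 (b - d))"
    unfolding origin [symmetric]
  proof (rule route_column, rule ComplI)
    fix y assume y: "\<bar>y\<bar> \<le> \<bar>b - d\<bar>" and "\<phi> 0 y \<in> boundary (\<omega> \<union> sites i)"
    moreover have "\<phi> 0 y \<notin> boundary (\<omega> \<union> sites i)"
    proof (rule far_not_boundary [OF t(1)])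
      show "l1 (\<phi> 0 y - w) \<le> 28" unfolding origin [symmetric] isometry using y r octant by linarith
      fix s assume "s \<in> sites i"
      then obtain u where u: "u \<in> set offsets" "s = site u" using sites_subset by blast
      then have "fst u \<le> 7" using offset_range [of "fst u" "snd u"] by simp
      then show "\<not> adjacent (\<phi> 0 y) s" unfolding u(2) site_def adjacent_\<phi> using octant by linarith
    qed
    ultimately show False by blast
  qed
  have 3: "route ?S (nat (a - c)) (\<phi> 0 (b - d)) (\<phi> (a - c) (b - d))"
  proof -
    have "route ?S (nat (a - c)) (\<phi> (a - c - int (nat (a - c))) (b - d)) (\<phi> (a - c) (b - d))"
    proof (rule route_row, rule ComplI)
      fix x assume x: "0 \<le> x" "x < int (nat (a - c))"
      assume "\<phi> (a - c - int (nat (a - c)) + x) (b - d) \<in> boundary (\<omega> \<union> sites i)"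
      moreover have "a - c - int (nat (a - c)) + x = x" using octant r by simp
      moreover have "\<phi> x (b - d) \<notin> boundary (\<omega> \<union> sites i)"
      proof (rule far_not_boundary [OF t(1)])
        show "l1 (\<phi> x (b - d) - w) \<le> 28" unfolding origin [symmetric] isometry using x r octant by simp linarith
        fix s assume "s \<in> sites i"
        then obtain c' d' where u: "(c', d') \<in> set (take i offsets)" "s = site (c', d')" unfolding sites_def by auto
        have "fst (offsets ! i) < a - x" using x octant r by (simp add: cd split: if_splits)
        then have "\<bar>a - x - c'\<bar> + \<bar>snd (offsets ! i) - d'\<bar> \<noteq> 1" by (rule offset_exposed [OF i u(1)])
        then show "\<not> adjacent (\<phi> x (b - d)) s" unfolding u(2) site_def adjacent_\<phi> by (simp add: cd)
      qed
      ultimately show False by simp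
    qed
    then show ?thesis using octant r by simp
  qed
  have "route ?S (n + (nat \<bar>b - d\<bar> + nat (a - c))) e (site (offsets ! i))"
    using route_trans [OF 1 route_trans [OF 2 3]] by (simp add: site_def cd)
  moreover have "n + (nat \<bar>b - d\<bar> + nat (a - c)) \<le> 100" using n(1) r octant by linarith
  ultimately show thesis using that by blast
qed

lemma boundary_sites_subset_barrier: "boundary (\<omega> \<union> sites i) \<subseteq> barrier \<omega> w"
proof
  fix x assume "x \<in> boundary (\<omega> \<union> sites i)"
  then obtain p where p: "x \<notin> \<omega>" "p \<in> \<omega> \<union> sites i" "adjacent x p" unfolding boundary_iff by blast
  show "x \<in> barrier \<omega> w" using p(2)
  proof
    assume "p \<in> \<omega>"
    then have "x \<in> boundary \<omega>" using p unfolding boundary_iff by blast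
    then show ?thesis by (simp add: barrier_def)
  next
    assume "p \<in> sites i"
    then obtain u where "u \<in> set offsets" "p = site u" using sites_subset by blast
    moreover have "adjacent p x" using p(3) adjacent_sym by blast
    ultimately have "x \<in> disc w" using site_disc by blast
    then show ?thesis by (simp add: barrier_def)
  qed
qed

lemma boundary_pass:
  assumes "y \<in> boundary \<omega> - disc w"
  shows "y \<in> boundary (\<omega> \<union> sites i)"
proof -
  have "y \<notin> sites i" using assms sites_subset site_disc by blast
  then show ?thesis using assms by (auto simp: boundary_iff)
qed

text \<open>
Every clean entry point contributes its mass times the probability of the prescribed path.
\<close>

lemma harmonic_measure_site:
  assumes i: "i < 12" and t: "touching \<omega> w" "\<phi> a b \<in> \<omega>" and f: "finite \<omega>"
  shows "kappa * clean_entry \<omega> w \<le> harmonic_measure (boundary (\<omega> \<union> sites i)) (site (offsets ! i))"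
proof -
  let ?B = "boundary (\<omega> \<union> sites i)" and ?C = "barrier \<omega> w" and ?s = "site (offsets ! i)"
  have C: "finite ?C" by (rule finite_barrier [OF f])
  have s: "?s \<in> ?B" by (rule site_attached [OF i t])
  have "kappa * clean_entry \<omega> w = (\<Sum>e\<in>disc w - near \<omega>. harmonic_measure ?C e * kappa)"
    by (simp add: clean_entry_def sum_distrib_left mult.commute)
  also have "\<dots> \<le> (\<Sum>e\<in>disc w - near \<omega>. harmonic_measure ?C e * hitting_prob ?B e ?s)"
  proof (rule sum_mono)
    fix e assume e: "e \<in> disc w - near \<omega>"
    obtain n where n: "n \<le> 100" "route (- ?B) n e ?s" by (rule route_to_site [OF i t e])
    show "harmonic_measure ?C e * kappa \<le> harmonic_measure ?C e * hitting_prob ?B e ?s"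
      by (intro mult_left_mono route_hitting_prob [OF n(2,1) s] harmonic_measure_nonneg C)
  qed
  also have "\<dots> \<le> (\<Sum>e\<in>?C. harmonic_measure ?C e * hitting_prob ?B e ?s)"
    by (intro sum_mono2 C mult_nonneg_nonneg harmonic_measure_nonneg hitting_prob_nonneg)
      (auto simp: barrier_def)
  also have "\<dots> = harmonic_measure ?B ?s"
    by (rule harmonic_measure_nested [OF C _ boundary_sites_subset_barrier, symmetric]) (use s in blast)
  finally show ?thesis .
qed

lemma enclosed_site:
  assumes "\<phi> a b \<in> \<omega>" "touching \<omega> w"
  shows "is_hole (\<omega> \<union> sites 12) {site (6, 1)}"
proof (rule singleton_hole)
  have "(6, 1) \<notin> set (take 12 offsets)" by (simp add: offsets_def)
  then have "site (6, 1) \<notin> sites 12" unfolding site_mem_sites .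
  moreover have "l1 (site (6, 1) - w) < 30"
    unfolding site_def origin [symmetric] isometry using octant by simp
  then have "site (6, 1) \<notin> \<omega>" using assms(2) by (auto simp: touching_def)
  ultimately show "site (6, 1) \<notin> \<omega> \<union> sites 12" by blast
next
  fix p assume p: "adjacent (site (6, 1)) p"
  obtain i k where ik: "p = \<phi> i k" using onto by blast
  define c d where "c = a - i" and "d = b - k"
  have pcd: "p = site (c, d)" by (simp add: ik site_def c_def d_def)
  have "\<bar>c - 6\<bar> + \<bar>d - 1\<bar> = 1"
    using p unfolding ik site_def adjacent_\<phi> by (simp add: c_def d_def algebra_simps)
  then have "(c, d) \<in> {(5, 1), (7, 1), (6, 0), (6, 2)}" by (simp, presburger)
  then have "(c, d) \<in> set (take 12 offsets)" by (auto simp: offsets_def)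
  then show "p \<in> \<omega> \<union> sites 12" unfolding pcd sites_def by blast
qed

lemma enclosed_site_new:
  assumes "touching \<omega> w" "a0 \<subseteq> \<omega>"
  shows "\<not> is_hole a0 {site (6, 1)}"
proof (rule singleton_not_hole)
  show "adjacent (site (6, 1)) (site (6, 0))" by (simp add: site_def adjacent_\<phi>)
  have "l1 (site (6, 0) - w) < 30" by (rule l1_site) (simp add: offsets_def)
  then show "site (6, 0) \<notin> a0" using assms unfolding touching_def by (metis not_le subsetD)
qed

end

section \<open>Clean entries produce a new hole\<close>

text \<open>
Strict inclusion of the sets of holes is more convenient than comparing their numbers, since it is kept
by each landing that has positive probability.
\<close>

definition gained :: "pt set \<Rightarrow> pt set \<Rightarrow> bool" where
  "gained a b \<longleftrightarrow> {h. is_hole a h} \<subset> {h. is_hole b h}"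

definition kept :: "pt set \<Rightarrow> pt set \<Rightarrow> bool" where
  "kept a b \<longleftrightarrow> {h. is_hole a h} \<subseteq> {h. is_hole b h}"

lemma kept_insert:
  assumes "finite b" "kept a b" "harmonic_measure (boundary b) x \<noteq> 0"
  shows "kept a (insert x b)"
  unfolding kept_def
proof (intro subsetI CollectI)
  fix h assume "h \<in> {h. is_hole a h}"
  then have h: "is_hole b h" using assms(2) unfolding kept_def by blast
  have "x \<notin> h" using landing_outside_holes [OF assms(1) h] assms(3) by blast
  then show "is_hole (insert x b) h" by (rule hole_persists [OF h])
qed

lemma gained_insert:
  assumes "finite b" "gained a b" "harmonic_measure (boundary b) x \<noteq> 0"
  shows "gained a (insert x b)"
proof -
  have "kept b b" by (simp add: kept_def)
  then have "kept b (insert x b)" by (rule kept_insert [OF assms(1) _ assms(3)])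
  then show ?thesis using assms(2) unfolding kept_def gained_def by blast
qed

lemma growth_prob_nonneg: "finite b \<Longrightarrow> 0 \<le> growth_prob Q n b"
  by (induction n arbitrary: b)
    (auto intro!: sum_nonneg mult_nonneg_nonneg harmonic_measure_nonneg finite_boundary)

lemma growth_prob_gained:
  "finite b \<Longrightarrow> b \<noteq> {} \<Longrightarrow> gained a b \<Longrightarrow> growth_prob (gained a) n b = 1"
proof (induction n arbitrary: b)
  case (Suc n)
  have "growth_prob (gained a) (Suc n) b = (\<Sum>x\<in>boundary b. harmonic_measure (boundary b) x)"
    unfolding growth_prob.simps
  proof (rule sum.cong [OF refl])
    fix x
    show "harmonic_measure (boundary b) x * growth_prob (gained a) n (insert x b) = harmonic_measure (boundary b) x"
    proof (cases "harmonic_measure (boundary b) x = 0")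
      case False
      then have "growth_prob (gained a) n (insert x b) = 1"
        using Suc gained_insert by blast
      then show ?thesis by simp
    qed simp
  qed
  also have "\<dots> = 1"
    by (rule sum_harmonic_measure) (use Suc finite_boundary boundary_nonempty in auto)
  finally show ?case .
qed simp

lemma touching_insert: "touching \<omega> w \<Longrightarrow> y \<notin> disc w \<Longrightarrow> touching (insert y \<omega>) w"
  by (auto simp: touching_def mem_disc)

context approach
begin

text \<open>
The occupied sites inside the disc are added to the cluster \<open>\<omega>\<close> on the right-hand side only. This loses
nothing: the new sites are inside the disc, so the barrier of \<open>\<omega>\<close> still contains the boundary of
the larger cluster, and a landing outside the disc is at least as likely for the larger cluster as for a
walker stopped at that barrier. A clean entry is converted into the landing at the next site at cost
\<open>kappa\<close>.
\<close>

lemma growth_prob_ge_clean_visits: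
  assumes "i + k = 12" "finite \<omega>" "touching \<omega> w" "\<phi> a b \<in> \<omega>" "a0 \<subseteq> \<omega>" "kept a0 (\<omega> \<union> sites i)"
  shows "kappa ^ k * clean_visits w k n \<omega> \<le> growth_prob (gained a0) n (\<omega> \<union> sites i)"
  using assms
proof (induction n arbitrary: i k \<omega>)
  case (0 i k \<omega>)
  show ?case
  proof (cases k)
    case 0
    then have "sites i = sites 12" using "0.prems" by simp
    then have "gained a0 (\<omega> \<union> sites i)"
      using enclosed_site [OF "0.prems"(4,3)] enclosed_site_new [OF "0.prems"(3,5)] "0.prems"(6)
      unfolding gained_def kept_def by auto
    then show ?thesis using 0 by simp
  next
    case (Suc k')
    then show ?thesis by simp
  qed
next
  case (Suc n i k \<omega>)
  let ?b = "\<omega> \<union> sites i"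
  let ?hm = "harmonic_measure (boundary ?b)" and ?gp = "growth_prob (gained a0)"
  have b: "finite ?b" "?b \<noteq> {}" using Suc.prems finite_sites by auto
  have B: "finite (boundary ?b)" by (rule finite_boundary [OF b(1)])
  have C: "finite (barrier \<omega> w)" by (rule finite_barrier [OF Suc.prems(2)])
  show ?case
  proof (cases k)
    case 0
    then have "sites i = sites 12" using Suc.prems by simp
    then have "gained a0 ?b"
      using enclosed_site [OF Suc.prems(4,3)] enclosed_site_new [OF Suc.prems(3,5)] Suc.prems(6)
      unfolding gained_def kept_def by auto
    then show ?thesis using 0 growth_prob_gained [OF b, of a0 "Suc n"] by simp
  next
    case k: (Suc k')
    then have i: "i < 12" using Suc.prems(1) by simp
    let ?s = "site (offsets ! i)" and ?I = "boundary \<omega> - disc w"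
    have s: "?s \<in> boundary ?b" by (rule site_attached [OF i Suc.prems(3,4)])
    have sI: "?s \<notin> ?I" using site_disc [OF offset_mem [OF i]] by blast
    \<comment> \<open>the next walker makes a clean entry and is led to the next site; a site inside an old hole
      would have harmonic measure 0, and then there is no clean entry at all\<close>
    have land: "kappa ^ k * (clean_entry \<omega> w * clean_visits w k' n \<omega>) \<le> ?hm ?s * ?gp n (insert ?s ?b)"
    proof (cases "?hm ?s = 0")
      case True
      then have "clean_entry \<omega> w \<le> 0"
        using harmonic_measure_site [OF i Suc.prems(3,4,2)] kappa_pos by (simp add: mult_le_0_iff)
      then have "clean_entry \<omega> w = 0" using clean_entry_nonneg [OF Suc.prems(2), of w] by simp
      then show ?thesis using True by simp
    next
      case False
      have "kept a0 (insert ?s ?b)" by (rule kept_insert [OF b(1) Suc.prems(6) False])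
      then have "kappa ^ k' * clean_visits w k' n \<omega> \<le> ?gp n (\<omega> \<union> sites (Suc i))"
        by (intro Suc.IH) (use Suc.prems k in \<open>simp_all add: sites_Suc [OF i]\<close>)
      then have IH: "kappa ^ k' * clean_visits w k' n \<omega> \<le> ?gp n (insert ?s ?b)"
        by (simp add: sites_Suc [OF i])
      have "kappa ^ k * (clean_entry \<omega> w * clean_visits w k' n \<omega>) =
          (kappa * clean_entry \<omega> w) * (kappa ^ k' * clean_visits w k' n \<omega>)"
        by (simp add: k)
      also have "\<dots> \<le> ?hm ?s * ?gp n (insert ?s ?b)"
        by (intro mult_mono IH harmonic_measure_site [OF i Suc.prems(3,4,2)] harmonic_measure_nonneg [OF B]
            mult_nonneg_nonneg clean_visits_nonneg Suc.prems) (use kappa_pos in auto)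
      finally show ?thesis .
    qed
    have pass: "kappa ^ k * (harmonic_measure (barrier \<omega> w) y * clean_visits w k n (insert y \<omega>)) \<le>
        ?hm y * ?gp n (insert y ?b)" if y: "y \<in> ?I" for y
    proof -
      have yB: "y \<in> boundary ?b" by (rule boundary_pass [OF y])
      have le: "harmonic_measure (barrier \<omega> w) y \<le> ?hm y"
        by (rule harmonic_measure_mono [OF C boundary_sites_subset_barrier yB])
      show ?thesis
      proof (cases "?hm y = 0")
        case True
        then have "harmonic_measure (barrier \<omega> w) y = 0"
          using le harmonic_measure_nonneg [OF C, of y] by simp
        then show ?thesis using True by simp
      next
        case False
        have "kept a0 (insert y ?b)" by (rule kept_insert [OF b(1) Suc.prems(6) False])
        then have "kappa ^ k * clean_visits w k n (insert y \<omega>) \<le> ?gp n (insert y \<omega> \<union> sites i)"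
          by (intro Suc.IH) (use Suc.prems y touching_insert in auto)
        then have IH: "kappa ^ k * clean_visits w k n (insert y \<omega>) \<le> ?gp n (insert y ?b)" by simp
        have "harmonic_measure (barrier \<omega> w) y * (kappa ^ k * clean_visits w k n (insert y \<omega>)) \<le>
            ?hm y * ?gp n (insert y ?b)"
          by (intro mult_mono le IH harmonic_measure_nonneg [OF B] mult_nonneg_nonneg clean_visits_nonneg)
            (use kappa_pos Suc.prems in auto)
        then show ?thesis by (simp add: mult.left_commute)
      qed
    qed
    have "kappa ^ k * clean_visits w k (Suc n) \<omega> =
        kappa ^ k * (clean_entry \<omega> w * clean_visits w k' n \<omega>) +
        (\<Sum>y\<in>?I. kappa ^ k * (harmonic_measure (barrier \<omega> w) y * clean_visits w k n (insert y \<omega>)))"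
      unfolding k clean_visits.simps distrib_left sum_distrib_left by simp
    also have "\<dots> \<le> ?hm ?s * ?gp n (insert ?s ?b) + (\<Sum>y\<in>?I. ?hm y * ?gp n (insert y ?b))"
      by (intro add_mono land sum_mono pass)
    also have "\<dots> = (\<Sum>y\<in>insert ?s ?I. ?hm y * ?gp n (insert y ?b))"
      by (rule sum.insert [symmetric]) (use sI finite_boundary [OF Suc.prems(2)] in auto)
    also have "\<dots> \<le> (\<Sum>y\<in>boundary ?b. ?hm y * ?gp n (insert y ?b))"
      by (intro sum_mono2 B mult_nonneg_nonneg harmonic_measure_nonneg [OF B] growth_prob_nonneg)
        (use s boundary_pass b(1) in auto)
    finally show ?thesis by simp
  qed
qed

end

lemma clean_visits_gain:
  assumes "finite b" "touching b w" "a \<subseteq> b" "kept a b"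
  shows "kappa ^ 12 * clean_visits w 12 n b \<le> growth_prob (gained a) n b"
proof -
  obtain q where q: "q \<in> b" "q \<in> disc w" using assms(2) unfolding touching_def by blast
  then have "l1 (q - w) = 30" using assms(2) unfolding touching_def mem_disc by (metis order_antisym)
  then obtain \<phi> a' b' where A: "approach w \<phi> a' b'" "\<phi> a' b' = q" by (rule approach_exists)
  interpret approach w \<phi> a' b' by (rule A(1))
  have "sites 0 = {}" by (simp add: sites_def)
  then show ?thesis
    using growth_prob_ge_clean_visits [of 0 12 b a n] assms q(1) A(2) by simp
qed

section \<open>Waiting for a ripe cluster\<close>

definition ripe :: "real \<Rightarrow> nat \<Rightarrow> pt set \<Rightarrow> bool" where
  "ripe \<epsilon> N A \<longleftrightarrow> (\<exists>w. touching A w \<and> \<epsilon> \<le> clean_visits w 1 N A)"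

text \<open>
The expectation of \<open>min T n\<close>, where \<open>T\<close> is the number of landings until \<open>X\<close> holds.
\<close>

fun idle :: "(pt set \<Rightarrow> bool) \<Rightarrow> nat \<Rightarrow> pt set \<Rightarrow> real" where
  "idle X 0 A = 0"
| "idle X (Suc n) A =
     (if X A then 0 else 1 + (\<Sum>x\<in>boundary A. harmonic_measure (boundary A) x * idle X n (insert x A)))"

text \<open>
The weight \<open>\<epsilon> / kappa\<close> of a vacant site is chosen so that the vacant sites lost through visits pay for
a contribution of \<open>\<epsilon>\<close> per visit in the first term.
\<close>

definition exposure :: "real \<Rightarrow> nat \<Rightarrow> pt set \<Rightarrow> pt \<Rightarrow> real" where
  "exposure \<epsilon> n A w = clean_visits w 1 n A + \<epsilon> / kappa * real (card (disc w - A))"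

lemma exposure_nonneg: "finite A \<Longrightarrow> 0 < \<epsilon> \<Longrightarrow> 0 \<le> exposure \<epsilon> n A w"
  unfolding exposure_def by (intro add_nonneg_nonneg clean_visits_nonneg) (use kappa_pos in auto)

text \<open>
The bound for the exposure of a single disc while the cluster is not ripe.
\<close>

definition quota :: "real \<Rightarrow> real" where
  "quota \<epsilon> = \<epsilon> * (1 + real (card (disc 0)) / kappa)"

lemma exposure_le_quota:
  assumes "0 < \<epsilon>" "\<not> ripe \<epsilon> N A" "touching A w" "finite A" "n \<le> N"
  shows "exposure \<epsilon> n A w \<le> quota \<epsilon>"
proof -
  have "clean_visits w 1 n A \<le> clean_visits w 1 N A"
    by (rule clean_visits_horizon_mono) (use assms in auto)
  also have "\<dots> \<le> \<epsilon>" using assms unfolding ripe_def by (meson not_le less_imp_le)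
  finally have 1: "clean_visits w 1 n A \<le> \<epsilon>" .
  have "card (disc w - A) \<le> card (disc 0)"
    using card_mono [OF finite_disc, of "disc w - A" w] card_disc [of w] by auto
  then have "\<epsilon> / kappa * real (card (disc w - A)) \<le> \<epsilon> / kappa * real (card (disc 0))"
    by (intro mult_left_mono) (use assms kappa_pos in auto)
  with 1 show ?thesis by (simp add: exposure_def quota_def algebra_simps)
qed

text \<open>
The recursion for \<open>clean_visits\<close> only follows walkers that avoid the disc. The other ones, whose
probability is \<open>visit A w\<close>, can contribute at most \<open>\<epsilon>\<close> each to the first term, and a fraction of at
least \<open>kappa\<close> of them lands inside the disc, which lowers the second term by \<open>\<epsilon> / kappa\<close>. The two effects
balance. Clusters that have become ripe and discs that no longer touch are counted as 0.
\<close>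

lemma exposure_descent:
  assumes \<epsilon>: "0 < \<epsilon>" and A: "finite A" "A \<noteq> {}" and w: "touching A w" and n: "n \<le> N"
  shows "(\<Sum>y\<in>boundary A. harmonic_measure (boundary A) y *
      (if ripe \<epsilon> N (insert y A) \<or> \<not> touching (insert y A) w then 0 else exposure \<epsilon> n (insert y A) w))
    \<le> exposure \<epsilon> (Suc n) A w - clean_entry A w"
proof -
  let ?I = "boundary A" and ?h = "harmonic_measure (boundary A)" and ?o = "harmonic_measure (barrier A w)"
  let ?D = "disc w" and ?c = "real (card (disc w - A))"
  define \<delta> where "\<delta> = \<epsilon> / kappa"
  define v where "v = (\<lambda>y. clean_visits w 1 n (insert y A))"
  define t where "t = (\<lambda>y. if ripe \<epsilon> N (insert y A) \<or> \<not> touching (insert y A) w then 0 else exposure \<epsilon> n (insert y A) w)"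
  have \<delta>: "0 < \<delta>" using \<epsilon> kappa_pos by (simp add: \<delta>_def)
  have I: "finite ?I" by (rule finite_boundary [OF A(1)])
  have C: "finite (barrier A w)" by (rule finite_barrier [OF A(1)])
  have h: "0 \<le> ?h y" for y by (rule harmonic_measure_nonneg [OF I])
  have o: "0 \<le> ?o y" for y by (rule harmonic_measure_nonneg [OF C])
  have v: "0 \<le> v y" for y unfolding v_def by (rule clean_visits_nonneg) (use A in simp)
  have h1: "(\<Sum>y\<in>?I. ?h y) = 1"
    by (rule sum_harmonic_measure [OF I]) (use boundary_nonempty A in auto)
  have small: "v y \<le> \<epsilon>" if "\<not> ripe \<epsilon> N (insert y A)" "touching (insert y A) w" for y
  proof -
    have "v y \<le> clean_visits w 1 N (insert y A)"
      unfolding v_def by (rule clean_visits_horizon_mono) (use A n in auto)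
    then show ?thesis using that unfolding ripe_def by (meson not_le less_imp_le order_trans)
  qed
  have far: "?h y * t y \<le> ?o y * v y + (?h y - ?o y) * \<epsilon> + ?h y * (\<delta> * ?c)" if y: "y \<in> ?I - ?D" for y
  proof -
    have le: "?o y \<le> ?h y"
      by (rule harmonic_measure_mono [OF C]) (use y in \<open>auto simp: barrier_def\<close>)
    define v' where "v' = (if ripe \<epsilon> N (insert y A) then 0 else v y)"
    have tw: "touching (insert y A) w" using touching_insert [OF w] y by blast
    have v': "v' \<le> v y" "v' \<le> \<epsilon>" using v small [OF _ tw] \<epsilon> by (auto simp: v'_def)
    have "?D - insert y A = ?D - A" using y by blast
    then have "t y \<le> v' + \<delta> * ?c"
      using mult_nonneg_nonneg [OF less_imp_le [OF \<delta>], of ?c] tw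
      by (simp add: t_def v'_def exposure_def v_def \<delta>_def)
    then have "?h y * t y \<le> ?h y * (v' + \<delta> * ?c)" by (rule mult_left_mono [OF _ h])
    also have "\<dots> = ?o y * v' + (?h y - ?o y) * v' + ?h y * (\<delta> * ?c)" by (simp add: algebra_simps)
    also have "\<dots> \<le> ?o y * v y + (?h y - ?o y) * \<epsilon> + ?h y * (\<delta> * ?c)"
      by (intro add_mono mult_left_mono v' o order_refl) (use le in simp)
    finally show ?thesis .
  qed
  have close: "?h y * t y \<le> ?h y * \<epsilon> + ?h y * (\<delta> * ?c) - \<delta> * ?h y" if y: "y \<in> ?I \<inter> ?D" for y
  proof -
    have yA: "y \<in> ?D - A" using y by (auto simp: boundary_iff)
    have "?D - insert y A = (?D - A) - {y}" by blast
    then have c: "real (card (?D - insert y A)) = ?c - 1"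
      using yA finite_disc card_gt_0_iff [of "?D - A"]
      by (auto simp: card_Diff_singleton of_nat_diff Suc_leI)
    have "1 \<le> ?c" using c of_nat_0_le_iff [of "card (?D - insert y A)"] by linarith
    then have pos: "0 \<le> \<delta> * (?c - 1)" using \<delta> by simp
    have "t y \<le> \<epsilon> + \<delta> * (?c - 1)"
      using small [of y] pos \<epsilon> c by (auto simp: t_def exposure_def v_def \<delta>_def)
    then have "?h y * t y \<le> ?h y * (\<epsilon> + \<delta> * (?c - 1))" by (rule mult_left_mono [OF _ h])
    then show ?thesis by (simp add: algebra_simps)
  qed
  let ?O = "\<Sum>y\<in>?I - ?D. ?o y" and ?V = "\<Sum>y\<in>?I - ?D. ?o y * v y"
  let ?hD = "\<Sum>y\<in>?I \<inter> ?D. ?h y" and ?hF = "\<Sum>y\<in>?I - ?D. ?h y"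
  have split: "(\<Sum>y\<in>?I. f y) = (\<Sum>y\<in>?I - ?D. f y) + (\<Sum>y\<in>?I \<inter> ?D. f y)" for f :: "pt \<Rightarrow> real"
    using sum.Int_Diff [OF I, of f ?D] by simp
  have "(\<Sum>y\<in>?I. ?h y * t y) \<le>
      (\<Sum>y\<in>?I - ?D. ?o y * v y + (?h y - ?o y) * \<epsilon> + ?h y * (\<delta> * ?c)) +
      (\<Sum>y\<in>?I \<inter> ?D. ?h y * \<epsilon> + ?h y * (\<delta> * ?c) - \<delta> * ?h y)"
    unfolding split by (intro add_mono sum_mono far close)
  also have "\<dots> = ?V + (?hF - ?O) * \<epsilon> + ?hF * (\<delta> * ?c) + (?hD * \<epsilon> + ?hD * (\<delta> * ?c) - \<delta> * ?hD)"
    by (simp add: sum.distrib sum_subtractf left_diff_distrib flip: sum_distrib_left sum_distrib_right)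
  also have "\<dots> = ?V + \<epsilon> * (?hF + ?hD - ?O) + \<delta> * ?c * (?hF + ?hD) - \<delta> * ?hD"
    by (simp add: algebra_simps)
  also have "?hF + ?hD = 1" using h1 split [of ?h] by simp
  also have "1 - ?O = visit A w" using sum_pass_visit [OF A, of w] by simp
  also have "?V + \<epsilon> * visit A w + \<delta> * ?c * 1 - \<delta> * ?hD \<le> ?V + \<delta> * ?c"
  proof -
    have "\<epsilon> * visit A w = \<delta> * (kappa * visit A w)" using kappa_pos by (simp add: \<delta>_def)
    also have "\<dots> \<le> \<delta> * ?hD" by (intro mult_left_mono visit_lands [OF A w]) (use \<delta> in simp)
    finally show ?thesis by simp
  qed
  also have "\<dots> = exposure \<epsilon> (Suc n) A w - clean_entry A w"
    by (simp add: exposure_def v_def \<delta>_def)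
  finally show ?thesis by (simp only: t_def)
qed

text \<open>
In each idle step the total exposure of the discs that already touch falls on average by at least 1.
A landing at \<open>y\<close> can only create touching discs with centre within distance 30 of \<open>y\<close>, and each of them has
exposure at most \<open>quota \<epsilon>\<close> unless the cluster has become ripe.
\<close>

lemma idle_le_exposure:
  assumes "0 < \<epsilon>" "finite A" "A \<noteq> {}" "n \<le> N"
  shows "idle (ripe \<epsilon> N) n A \<le>
    (\<Sum>w | touching A w. exposure \<epsilon> n A w) + real n * (real (card (disc 0)) * quota \<epsilon>)"
  using assms
proof (induction n arbitrary: A)
  case 0
  then show ?case by (auto intro!: sum_nonneg exposure_nonneg)
next
  case (Suc n)
  note \<epsilon> = Suc.prems(1) and A = Suc.prems(2,3)
  let ?Q = "real (card (disc 0)) * quota \<epsilon>"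
  let ?h = "harmonic_measure (boundary A)" and ?T = "{w. touching A w}"
  define t where "t = (\<lambda>w y. if ripe \<epsilon> N (insert y A) \<or> \<not> touching (insert y A) w then 0
    else exposure \<epsilon> n (insert y A) w)"
  have quota: "0 \<le> quota \<epsilon>" using \<epsilon> kappa_pos by (simp add: quota_def)
  have T: "finite ?T" by (rule finite_touching [OF A(1)])
  have I: "finite (boundary A)" by (rule finite_boundary [OF A(1)])
  have t: "0 \<le> t w y" for w y
    unfolding t_def using exposure_nonneg [of "insert y A" \<epsilon> n w] \<epsilon> A by simp
  \<comment> \<open>discs that touched before are counted in \<open>t\<close>, the new ones in the first \<open>?Q\<close>\<close>
  have step: "idle (ripe \<epsilon> N) n (insert y A) \<le> (\<Sum>w\<in>?T. t w y) + (?Q + real n * ?Q)" for y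
  proof (cases "ripe \<epsilon> N (insert y A)")
    case True
    then have "idle (ripe \<epsilon> N) n (insert y A) = 0" by (cases n) simp_all
    moreover have "0 \<le> (\<Sum>w\<in>?T. t w y)" by (intro sum_nonneg t)
    ultimately show ?thesis using quota by simp
  next
    case False
    let ?A = "insert y A"
    let ?T' = "{w. touching ?A w}"
    have A': "finite ?A" using A by simp
    have T': "finite ?T'" by (rule finite_touching [OF A'])
    have new: "?T' - ?T \<subseteq> disc y"
    proof
      fix w assume w: "w \<in> ?T' - ?T"
      have "y \<in> disc w"
      proof (rule ccontr)
        assume "y \<notin> disc w"
        then have "touching A w" using w by (auto simp: touching_def)
        then show False using w by simp
      qed
      then show "w \<in> disc y" using disc_commute by blast
    qed
    have "(\<Sum>w\<in>?T' - ?T. exposure \<epsilon> n ?A w) \<le> (\<Sum>w\<in>?T' - ?T. quota \<epsilon>)"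
    proof (rule sum_mono)
      fix w assume "w \<in> ?T' - ?T"
      then have "touching ?A w" by simp
      then show "exposure \<epsilon> n ?A w \<le> quota \<epsilon>"
        by (rule exposure_le_quota [OF \<epsilon> False _ A']) (use Suc.prems in simp)
    qed
    also have "\<dots> = real (card (?T' - ?T)) * quota \<epsilon>" by simp
    also have "\<dots> \<le> ?Q"
      using card_mono [OF finite_disc new] card_disc [of y] by (intro mult_right_mono quota) simp
    finally have 1: "(\<Sum>w\<in>?T' - ?T. exposure \<epsilon> n ?A w) \<le> ?Q" .
    have "(\<Sum>w\<in>?T' \<inter> ?T. exposure \<epsilon> n ?A w) = (\<Sum>w\<in>?T' \<inter> ?T. t w y)"
      by (rule sum.cong) (simp_all add: t_def False)
    also have "\<dots> \<le> (\<Sum>w\<in>?T. t w y)" by (intro sum_mono2 T t) simp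
    finally have 2: "(\<Sum>w\<in>?T' \<inter> ?T. exposure \<epsilon> n ?A w) \<le> (\<Sum>w\<in>?T. t w y)" .
    have "idle (ripe \<epsilon> N) n ?A \<le> (\<Sum>w\<in>?T'. exposure \<epsilon> n ?A w) + real n * ?Q"
      by (rule Suc.IH) (use Suc.prems in simp_all)
    also have "(\<Sum>w\<in>?T'. exposure \<epsilon> n ?A w) =
        (\<Sum>w\<in>?T' \<inter> ?T. exposure \<epsilon> n ?A w) + (\<Sum>w\<in>?T' - ?T. exposure \<epsilon> n ?A w)"
      by (rule sum.Int_Diff [OF T'])
    finally show ?thesis using 1 2 by linarith
  qed
  have h1: "(\<Sum>y\<in>boundary A. ?h y) = 1"
    by (rule sum_harmonic_measure [OF I]) (use boundary_nonempty A in auto)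
  have "(\<Sum>y\<in>boundary A. ?h y * idle (ripe \<epsilon> N) n (insert y A)) \<le>
      (\<Sum>y\<in>boundary A. ?h y * ((\<Sum>w\<in>?T. t w y) + (?Q + real n * ?Q)))"
    by (intro sum_mono mult_left_mono step harmonic_measure_nonneg I)
  also have "\<dots> = (\<Sum>y\<in>boundary A. ?h y * (\<Sum>w\<in>?T. t w y)) + (\<Sum>y\<in>boundary A. ?h y) * (?Q + real n * ?Q)"
    by (simp only: distrib_left sum.distrib sum_distrib_right)
  also have "(\<Sum>y\<in>boundary A. ?h y * (\<Sum>w\<in>?T. t w y)) = (\<Sum>w\<in>?T. \<Sum>y\<in>boundary A. ?h y * t w y)"
    unfolding sum_distrib_left by (rule sum.swap)
  also have "\<dots> \<le> (\<Sum>w\<in>?T. exposure \<epsilon> (Suc n) A w - clean_entry A w)"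
    unfolding t_def by (intro sum_mono exposure_descent [OF \<epsilon> A]) (use Suc.prems in auto)
  also have "\<dots> = (\<Sum>w\<in>?T. exposure \<epsilon> (Suc n) A w) - (\<Sum>w\<in>?T. clean_entry A w)"
    by (rule sum_subtractf)
  finally have "1 + (\<Sum>y\<in>boundary A. ?h y * idle (ripe \<epsilon> N) n (insert y A)) \<le>
      (\<Sum>w\<in>?T. exposure \<epsilon> (Suc n) A w) + real (Suc n) * ?Q"
    using sum_clean_entry_ge_1 [OF A] h1 by (simp add: distrib_right)
  moreover have "0 \<le> (\<Sum>w\<in>?T. exposure \<epsilon> (Suc n) A w)"
    by (intro sum_nonneg exposure_nonneg A \<epsilon>)
  ultimately show ?case using quota by simp
qed

section \<open>A new hole with probability bounded below\<close>

definition success_rate :: "real \<Rightarrow> real" where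
  "success_rate \<epsilon> = kappa ^ 12 * \<epsilon> ^ 12 / fact 12"

lemma success_rate_pos: "0 < \<epsilon> \<Longrightarrow> 0 < success_rate \<epsilon>"
  using kappa_pos by (simp add: success_rate_def)

lemma ripe_gain:
  assumes \<epsilon>: "0 < \<epsilon>" and b: "finite b" "ripe \<epsilon> N b" and ab: "a \<subseteq> b" "kept a b" and n: "12 * N \<le> n"
  shows "success_rate \<epsilon> \<le> growth_prob (gained a) n b"
proof -
  obtain w where w: "touching b w" "\<epsilon> \<le> clean_visits w 1 N b" using b unfolding ripe_def by blast
  have S: "Suc 11 = 12" by simp
  have ne: "b \<noteq> {}" using w(1) by (auto simp: touching_def)
  have "\<epsilon> ^ 12 / fact 12 \<le> clean_visits w 1 N b ^ 12 / fact 12"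
    using w(2) \<epsilon> by (intro divide_right_mono power_mono) auto
  also have "\<dots> \<le> clean_visits w 12 (N + 11 * N) b"
    by (rule clean_visits_power_bound [where n = N and M = N and A = b and w = w and k = 11, OF order_refl b(1) ne, unfolded S])
  also have "\<dots> \<le> clean_visits w 12 n b"
    by (rule clean_visits_horizon_mono) (use b n in auto)
  finally have "kappa ^ 12 * (\<epsilon> ^ 12 / fact 12) \<le> kappa ^ 12 * clean_visits w 12 n b"
    using kappa_pos by (intro mult_left_mono) auto
  also have "\<dots> \<le> growth_prob (gained a) n b" by (rule clean_visits_gain [OF b(1) w(1) ab])
  finally show ?thesis unfolding success_rate_def times_divide_eq_right .
qed

text \<open>
With \<open>T\<close> the number of landings until the cluster is ripe, \<open>n - idle\<close> is the expectation of the positive part of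
\<open>n - T\<close>, which is at most \<open>n\<close> times the probability of \<open>T < n\<close>; after time \<open>T\<close> a new hole
has probability at least \<open>success_rate \<epsilon>\<close>.
\<close>

lemma growth_prob_ge_active:
  assumes \<epsilon>: "0 < \<epsilon>" and b: "finite b" "b \<noteq> {}" and ab: "a \<subseteq> b" "kept a b"
  shows "success_rate \<epsilon> * (real n - idle (ripe \<epsilon> N) n b) \<le>
    real n * growth_prob (gained a) (n + 12 * N) b"
  using b ab
proof (induction n arbitrary: b)
  case (Suc n)
  let ?h = "harmonic_measure (boundary b)"
  have I: "finite (boundary b)" by (rule finite_boundary [OF Suc.prems(1)])
  have h1: "(\<Sum>y\<in>boundary b. ?h y) = 1"
    by (rule sum_harmonic_measure [OF I]) (use boundary_nonempty Suc.prems in auto)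
  show ?case
  proof (cases "ripe \<epsilon> N b")
    case True
    have "success_rate \<epsilon> \<le> growth_prob (gained a) (Suc n + 12 * N) b"
      by (rule ripe_gain [OF \<epsilon> Suc.prems(1) True Suc.prems(3,4)]) simp
    then have "real (Suc n) * success_rate \<epsilon> \<le> real (Suc n) * growth_prob (gained a) (Suc n + 12 * N) b"
      by (rule mult_left_mono) simp
    then show ?thesis using True by (simp add: mult.commute)
  next
    case False
    have "success_rate \<epsilon> * (real (Suc n) - idle (ripe \<epsilon> N) (Suc n) b) =
        success_rate \<epsilon> * (real n * (\<Sum>y\<in>boundary b. ?h y) - (\<Sum>y\<in>boundary b. ?h y * idle (ripe \<epsilon> N) n (insert y b)))"
      using False h1 by simp
    also have "\<dots> = (\<Sum>y\<in>boundary b. ?h y * (success_rate \<epsilon> * (real n - idle (ripe \<epsilon> N) n (insert y b))))"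
      by (simp add: sum_distrib_left right_diff_distrib sum_subtractf mult_ac)
    also have "\<dots> \<le> (\<Sum>y\<in>boundary b. ?h y * (real n * growth_prob (gained a) (n + 12 * N) (insert y b)))"
    proof (rule sum_mono)
      fix y
      show "?h y * (success_rate \<epsilon> * (real n - idle (ripe \<epsilon> N) n (insert y b))) \<le>
          ?h y * (real n * growth_prob (gained a) (n + 12 * N) (insert y b))"
      proof (cases "?h y = 0")
        case False
        have "kept a (insert y b)" by (rule kept_insert [OF Suc.prems(1,4) False])
        then show ?thesis
          by (intro mult_left_mono Suc.IH harmonic_measure_nonneg I) (use Suc.prems in auto)
      qed simp
    qed
    also have "\<dots> = real n * growth_prob (gained a) (Suc n + 12 * N) b"
      by (simp add: sum_distrib_left mult_ac)
    also have "\<dots> \<le> real (Suc n) * growth_prob (gained a) (Suc n + 12 * N) b"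
      by (intro mult_right_mono growth_prob_nonneg Suc.prems) simp
    finally show ?thesis .
  qed
qed simp

text \<open>
The choice of \<open>\<epsilon>\<close> makes \<open>s * quota \<epsilon>\<close> equal to \<open>1 / 4\<close>. With \<open>N = card a\<close>, at most \<open>s * N\<close> discs
touch initially and \<open>N\<close> landings create at most \<open>s * N\<close> further ones, so the expected idle time is at
most \<open>N / 4 + N / 4\<close>.
\<close>

lemma growth_prob_gained_bound:
  assumes s: "s = real (card (disc 0))" and \<epsilon>: "\<epsilon> = 1 / (4 * s * (1 + s / kappa))"
    and a: "finite a" "a \<noteq> {}"
  shows "success_rate \<epsilon> / 2 \<le> growth_prob (gained a) (13 * card a) a"
proof -
  let ?c = "success_rate \<epsilon>" and ?N = "card a"
  have s0: "0 < s" using card_disc_pos by (simp add: s)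
  have k: "0 < 1 + s / kappa" using s0 kappa_pos by (simp add: add_pos_pos)
  have \<epsilon>0: "0 < \<epsilon>" using s0 k by (simp add: \<epsilon>)
  have q: "s * quota \<epsilon> = 1 / 4"
  proof -
    have "0 < 4 * s * (1 + s / kappa)" by (intro mult_pos_pos s0 k) simp
    then have "\<epsilon> * (4 * s * (1 + s / kappa)) = 1"
      using \<epsilon> nonzero_eq_divide_eq [of "4 * s * (1 + s / kappa)" \<epsilon> 1] by linarith
    moreover have "\<epsilon> * (4 * s * (1 + s / kappa)) = 4 * (s * quota \<epsilon>)"
      unfolding quota_def s by (simp only: mult_ac)
    ultimately show ?thesis by linarith
  qed
  have N: "0 < real ?N" using a by (simp add: card_gt_0_iff)
  have idle: "idle (ripe \<epsilon> ?N) ?N a \<le> real ?N / 2"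
  proof (cases "ripe \<epsilon> ?N a")
    case True
    then show ?thesis by (cases ?N) simp_all
  next
    case False
    have quota: "0 \<le> quota \<epsilon>" unfolding quota_def s [symmetric] using \<epsilon>0 k by simp
    have "(\<Sum>w | touching a w. exposure \<epsilon> ?N a w) \<le> (\<Sum>w | touching a w. quota \<epsilon>)"
      by (intro sum_mono exposure_le_quota [OF \<epsilon>0 False _ a(1)]) auto
    also have "\<dots> = real (card {w. touching a w}) * quota \<epsilon>" by simp
    also have "\<dots> \<le> real (?N * card (disc 0)) * quota \<epsilon>"
    proof (intro mult_right_mono quota of_nat_mono)
      have "card {w. touching a w} \<le> card (near a)"
        by (rule card_mono [OF finite_near [OF a(1)]]) (auto dest: touching_near)
      also have "\<dots> \<le> (\<Sum>p\<in>a. card (disc p))" unfolding near_def by (rule card_UN_le [OF a(1)])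
      also have "\<dots> = (\<Sum>p\<in>a. card (disc 0))" by (intro sum.cong card_disc refl)
      also have "\<dots> = ?N * card (disc 0)" by simp
      finally show "card {w. touching a w} \<le> ?N * card (disc 0)" .
    qed
    also have "\<dots> = real ?N * (s * quota \<epsilon>)" by (simp add: s)
    also have "\<dots> = real ?N / 4" unfolding q by simp
    finally have "(\<Sum>w | touching a w. exposure \<epsilon> ?N a w) \<le> real ?N / 4" .
    moreover have "idle (ripe \<epsilon> ?N) ?N a \<le> (\<Sum>w | touching a w. exposure \<epsilon> ?N a w) + real ?N * (s * quota \<epsilon>)"
      unfolding s by (rule idle_le_exposure [OF \<epsilon>0 a order_refl])
    ultimately show ?thesis unfolding q by linarith
  qed
  have "?c * (real ?N / 2) \<le> ?c * (real ?N - idle (ripe \<epsilon> ?N) ?N a)"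
    by (intro mult_left_mono) (use idle success_rate_pos [OF \<epsilon>0] in auto)
  also have "\<dots> \<le> real ?N * growth_prob (gained a) (?N + 12 * ?N) a"
    by (rule growth_prob_ge_active [OF \<epsilon>0 a order_refl]) (simp add: kept_def)
  also have "?N + 12 * ?N = 13 * ?N" by simp
  also have "?c * (real ?N / 2) = real ?N * (?c / 2)" by simp
  finally have "real ?N * (?c / 2) \<le> real ?N * growth_prob (gained a) (13 * ?N) a" .
  then show ?thesis using N by (simp only: mult_le_cancel_left_pos)
qed

lemma gained_num_holes:
  assumes "finite B" "gained a B"
  shows "num_holes a + 1 \<le> num_holes B"
  using psubset_card_mono [OF finite_holes [OF assms(1)], of "{h. is_hole a h}"] assms(2)
  by (simp add: num_holes_def gained_def)

lemma growth_prob_finite: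
  "finite b \<Longrightarrow> growth_prob (\<lambda>B. finite B \<and> Q B) n b = growth_prob Q n b"
  by (induction n arbitrary: b) simp_all

lemma prob_more_holes:
  assumes a: "finite a" "a \<noteq> {}"
  shows "growth_prob (gained a) n a \<le> \<P>(A in dla a. num_holes (A n) \<ge> num_holes (A 0) + 1)"
proof -
  interpret prob_space "dla a" by (rule prob_space_dla)
  have meas: "{A \<in> space (dla a). num_holes (A n) \<ge> num_holes (A 0) + 1} \<in> events"
  proof -
    have "{A \<in> space (dla a). \<exists>k. A 0 \<in> {B. num_holes B = k} \<and> A n \<in> {B. k + 1 \<le> num_holes B}} \<in> events"
      by (intro sets.sets_Collect_countable_Ex sets.sets_Collect_conj sets_dla_coordinate)
    then show ?thesis by simp
  qed
  have "prob {A \<in> space (dla a). A 0 = a} = 1"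
    using dla_cylinder [of a 0 "\<lambda>_. a"] by simp
  moreover have "{A \<in> space (dla a). A 0 = a} \<in> events" using sets_dla_coordinate [of a 0 "{a}"] by simp
  ultimately have start: "AE A in dla a. A 0 = a" by (simp add: prob_Collect_eq_1)
  have "growth_prob (gained a) n a = growth_prob (\<lambda>B. finite B \<and> gained a B) n a"
    by (rule growth_prob_finite [OF a(1), symmetric])
  also have "\<dots> \<le> prob {A \<in> space (dla a). finite (A n) \<and> gained a (A n)}"
    by (rule growth_prob_le_dla [OF a])
  also have "\<dots> \<le> prob {A \<in> space (dla a). num_holes (A n) \<ge> num_holes (A 0) + 1}"
  proof (rule finite_measure_mono_AE [OF _ meas])
    show "AE A in dla a. A \<in> {A \<in> space (dla a). finite (A n) \<and> gained a (A n)} \<longrightarrow>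
        A \<in> {A \<in> space (dla a). num_holes (A n) \<ge> num_holes (A 0) + 1}"
      using start by eventually_elim (use gained_num_holes in auto)
  qed
  finally show ?thesis .
qed

theorem theorem3p1p1:
  shows "\<exists>c::real. c > 0 \<and>
    (\<forall>a. a \<noteq> {} \<and> finite a \<and> lattice_connected a \<longrightarrow>
      (\<exists>L::nat. L > 0 \<and> \<P>(A in dla a. num_holes (A L) \<ge> num_holes (A 0) + 1) \<ge> c))"
proof -
  define s where "s = real (card (disc 0))"
  define \<epsilon> where "\<epsilon> = 1 / (4 * s * (1 + s / kappa))"
  have s0: "0 < s" using card_disc_pos by (simp add: s_def)
  then have \<epsilon>0: "0 < \<epsilon>" using kappa_pos by (simp add: \<epsilon>_def add_pos_pos)
  show ?thesis
  proof (intro exI conjI allI impI)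
    show "0 < success_rate \<epsilon> / 2" using success_rate_pos [OF \<epsilon>0] by simp
    fix a :: "pt set" assume a: "a \<noteq> {} \<and> finite a \<and> lattice_connected a"
    then show "0 < 13 * card a" by (simp add: card_gt_0_iff)
    show "success_rate \<epsilon> / 2 \<le>
        \<P>(A in dla a. num_holes (A (13 * card a)) \<ge> num_holes (A 0) + 1)"
      using growth_prob_gained_bound [OF s_def \<epsilon>_def, of a] prob_more_holes [of a "13 * card a"] a by linarith
  qed
qed

end
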